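(* Let $f,g:\mathbb{R}\to\mathbb{R}$ satisfy: $f,g\in C^\infty(\mathbb{R})$; $f(0)=0$ and $f''(x)\ge 0$ for all $x\in\mathbb{R}$; $g(x)\ge 0$ for all $x\in\mathbb{R}$, and $g(x)=0$ if and only if $x=0$. Suppose $f'(0)=0$, and let $T>0$, $d>1/2$, $s>3/2$. Let $u_0\in H^s(\mathbb{R})$ be a non-trivial function satisfying $$\sup_{x\in\mathbb{R}}\Big(e^{\frac{|x|}{2}}(1+|x|)^{1/2}(\ln(1+|x|))^d\,(|u_0(x)|+|u_0'(x)|)\Big)<\infty .$$ Suppose that $u\in C^0([0,T];H^s(\mathbb{R}))$ is the (unique) corresponding solution of $$u_t+f'(u)u_x+\partial_x\Lambda^{-2}\Big(g(u)+\frac{f''(u)}{2}u_x^2\Big)=0$$ subject to $u(0,x)=u_0(x)$, and that $g(u(t,x))\le c\,u(t,x)^2$ for some $c>0$. Then there exists a constant $K>0$ (depending only on $f$, $g$ and $T$) such that, for $t\in[0,T]$, $$\sup_{x\in\mathbb{R}}\Big(e^{\frac{|x|}{2}}(1+|x|)^{1/2}(\ln(1+|x|))^d\,(|u(t,x)|+|\partial_xu(t,x)|)\Big)\le K .$$ Moreover, there exist continuous functions $\Phi_\pm:[0,T]\to\mathbb{R}$, $\epsilon_\pm:[0,T]\times\mathbb{R}\to\mathbb{R}$ and $R:\mathbb{R}\to\mathbb{R}$ such that $$u(t,x)=u_0(x)\pm t\,e^{-|x|}\big(\Phi_\pm(t)+\epsilon_\pm(t,x)+R(x)\big),$$ where the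 sign $+$ is taken for $x>0$ and the sign $-$ for $x<0$. Moreover: (i) $\Phi_\pm$ is non-negative, and $\Phi_\pm(t_0)=0$ if and only if $u(t_0,x)=0$ for all $x\in\mathbb{R}$; (ii) $\epsilon_\pm(t,x)\to0$ as $\pm x\to\infty$; (iii) $\Phi_\pm$ is uniformly bounded, that is, $c_1\le\Phi_\pm(t)\le c_2$, for some non-negative constants $c_1$ and $c_2$; (iv) $R(x)\sim O\big((\ln(1+|x|))^{-d}(1+|x|)^{-1}\big)$ as $x\to\pm\infty$.
   Context: Functions are real-valued, $t$ denotes time and $x$ space. $\Lambda^{-2}=(1-\partial_x^2)^{-1}$ is the inverse Helmholtz operator: $\Lambda^{-2}h=p\ast h$ and $\partial_x\Lambda^{-2}h=(\partial_x p)\ast h$, where $p(x)=\tfrac12 e^{-|x|}$, $\partial_xp(x)=-\mathrm{sgn}(x)p(x)$ (in the distributional sense) and $\ast$ is convolution in $x$. $H^s(\mathbb{R})$ is the usual Sobolev space, and $u\in C^0([0,T];H^s(\mathbb{R}))$ means that $t\mapsto u(t,\cdot)$ is continuous from $[0,T]$ into $H^s(\mathbb{R})$. The notation $f_1(x)\sim O(f_2(x))$ as $x\to\infty$ means that there exists some $L$ with $\lim_{x\to\infty}f_1(x)/f_2(x)=L$; similarly for $x\to-\infty$.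
   Formalization: K cannot depend only on f, g, T (at t=0 it would bound the weighted supremum of every admissible u_0); here K is fixed by f, g, T and d and evaluated at the weighted supremum of |u_0|+|u_0'| and at the supremum of |u|+|∂_x u| over [0,T]×ℝ. *)

theory Defs
  imports "HOL-Analysis.Analysis"
begin

definition smooth :: "(real \<Rightarrow> real) \<Rightarrow> bool" where
  "smooth f \<longleftrightarrow> (\<forall>n x. (deriv ^^ n) f differentiable (at x))"


section \<open>The spaces $H^s(R)$, $s \ge 0$\<close>

definition trunc_fourier :: "(real \<Rightarrow> real) \<Rightarrow> real \<Rightarrow> real \<Rightarrow> complex" where
  "trunc_fourier h N \<xi> =
     complex_of_real (1 / sqrt (2 * pi)) * (LINT x:{-N..N}|lborel. cis (- (\<xi> * x)) * complex_of_real (h x))"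

text \<open>The Fourier-Plancherel transform of a square-integrable function need not be given by an
  absolutely convergent integral; it is the limit in $L^2$ of the truncated Fourier integrals.  It
  is determined up to null sets, hence a relation.\<close>

definition is_fourier_L2 :: "(real \<Rightarrow> real) \<Rightarrow> (real \<Rightarrow> complex) \<Rightarrow> bool" where
  "is_fourier_L2 h v \<longleftrightarrow>
     v \<in> borel_measurable lborel \<and>
     ((\<lambda>N. \<integral>\<^sup>+ \<xi>. ennreal ((cmod (v \<xi> - trunc_fourier h N \<xi>))\<^sup>2) \<partial>lborel) \<longlongrightarrow> 0) at_top"

text \<open>The members are functions, not classes modulo null sets.\<close>

definition Hs :: "real \<Rightarrow> (real \<Rightarrow> real) set" where
  "Hs s = {h. h \<in> borel_measurable lborel \<and> integrable lborel (\<lambda>x. (h x)\<^sup>2) \<and>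
     (\<exists>v. is_fourier_L2 h v \<and>
          integrable lborel (\<lambda>\<xi>. (1 + \<xi>\<^sup>2) powr s * (cmod (v \<xi>))\<^sup>2))}"

definition Hs_norm :: "real \<Rightarrow> (real \<Rightarrow> real) \<Rightarrow> real" where
  "Hs_norm s h =
     sqrt (LINT \<xi>|lborel. (1 + \<xi>\<^sup>2) powr s * (cmod ((SOME v. is_fourier_L2 h v) \<xi>))\<^sup>2)"

text \<open>$u \in C^0([0,T]; H^s(R))$.\<close>

definition C0_Hs :: "real \<Rightarrow> real \<Rightarrow> (real \<Rightarrow> real \<Rightarrow> real) \<Rightarrow> bool" where
  "C0_Hs T s u \<longleftrightarrow>
     (\<forall>t\<in>{0..T}. u t \<in> Hs s) \<and>
     (\<forall>t\<in>{0..T}. ((\<lambda>\<tau>. Hs_norm s (\<lambda>x. u \<tau> x - u t x)) \<longlongrightarrow> 0) (at t within {0..T}))"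


section \<open>The equation\<close>

definition conv :: "(real \<Rightarrow> real) \<Rightarrow> (real \<Rightarrow> real) \<Rightarrow> real \<Rightarrow> real" where
  "conv k h x = (LINT y|lborel. k (x - y) * h y)"

definition green :: "real \<Rightarrow> real" where
  "green x = exp (- \<bar>x\<bar>) / 2"

text \<open>$\partial_x \Lambda^{-2} h = (\partial_x p) * h$ with $p$ = \<^const>\<open>green\<close>.\<close>

definition dx_inv_helmholtz :: "(real \<Rightarrow> real) \<Rightarrow> real \<Rightarrow> real" where
  "dx_inv_helmholtz h = conv (\<lambda>x. - sgn x * green x) h"

text \<open>For $u \in C^0([0,T]; H^s)$ with $s > 3/2$ every term of the equation other than $u_t$ is a
  continuous function of $(t,x)$, so the equation is read pointwise, with one-sided
  time derivatives at the end points.  An element of $H^s$ is represented by its continuous (indeed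
  $C^1$) representative, which is what makes the pointwise values meaningful.\<close>

definition solves ::
  "(real \<Rightarrow> real) \<Rightarrow> (real \<Rightarrow> real) \<Rightarrow> real \<Rightarrow> (real \<Rightarrow> real) \<Rightarrow> (real \<Rightarrow> real \<Rightarrow> real) \<Rightarrow> bool" where
  "solves f g T u0 u \<longleftrightarrow>
     (\<forall>t\<in>{0..T}. continuous_on UNIV (u t)) \<and>
     (\<forall>x. u 0 x = u0 x) \<and>
     (\<forall>t\<in>{0..T}. \<forall>x. \<exists>ut.
        ((\<lambda>\<tau>. u \<tau> x) has_real_derivative ut) (at t within {0..T}) \<and>
        ut + deriv f (u t x) * deriv (u t) x
           + dx_inv_helmholtz
               (\<lambda>y. g (u t y) + deriv (deriv f) (u t y) / 2 * (deriv (u t) y)\<^sup>2) x = 0)"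


section \<open>Decay\<close>

definition weighted :: "real \<Rightarrow> (real \<Rightarrow> real) \<Rightarrow> real \<Rightarrow> real" where
  "weighted d h x =
     exp (\<bar>x\<bar> / 2) * (1 + \<bar>x\<bar>) powr (1/2) * ln (1 + \<bar>x\<bar>) powr d * (\<bar>h x\<bar> + \<bar>deriv h x\<bar>)"

text \<open>Stronger than \<open>f1 \<in> O[F](f2)\<close>: the quotient is required to converge (the limit may be 0).\<close>

definition sim_O :: "(real \<Rightarrow> real) \<Rightarrow> (real \<Rightarrow> real) \<Rightarrow> real filter \<Rightarrow> bool" where
  "sim_O f1 f2 F \<longleftrightarrow> (\<exists>L::real. ((\<lambda>x. f1 x / f2 x) \<longlongrightarrow> L) F)"

end

theory Submission
  imports Defs "HOL-Probability.Characteristic_Functions" "HOL-Real_Asymp.Real_Asymp"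
begin

text \<open>For $s > 3/2$ Fourier inversion shows that \<open>u\<close> and \<open>u\<^sub>x\<close> are bounded and jointly continuous.
  The persistence of the decay needs no characteristics: if a weight \<open>\<phi>\<close> is bounded and
  \<open>\<bar>\<phi>'\<bar> \<le> 3/4 * \<phi>\<close>, so that it varies more slowly than the Green function decays, then \<open>\<phi> * u\<close> and
  \<open>\<phi>\<close> times the spatial difference quotients of \<open>u\<close> satisfy transport equations to which a maximum
  principle applies.  With \<open>m\<close> the supremum of \<open>exp (- \<lambda> * t) * \<phi> x * (\<bar>u t x\<bar> + \<bar>u\<^sub>x t x\<bar>)\<close> and \<open>\<lambda>\<close> large, it
  yields \<open>m \<le> 4 * S + m / 2\<close>, where \<open>S\<close> is the supremum at time 0.  For the weight 1 and reversed
  time this is backward uniqueness.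

  The decay makes \<open>exp \<bar>y\<bar> * h t y\<close> integrable, where \<open>h = g u + f'' u / 2 * u\<^sub>x\<^sup>2\<close>.  Hence, for
  \<open>x \<rightarrow> \<infinity>\<close> and uniformly in \<open>t\<close>, \<open>exp x * u\<^sub>t t x\<close> tends to \<open>P t = (\<integral>y. exp y * h t y) / 2\<close>, and \<open>\<Phi> t\<close> is
  the mean of \<open>P\<close> over \<open>{0..t}\<close>.  All lower order terms fit into \<open>\<epsilon>\<close>, so \<open>R = 0\<close> will do.\<close>

section \<open>Fourier inversion and Sobolev embedding\<close>

text \<open>Since \<open>s > 3/2\<close> yields only one continuous space derivative, the equation
  cannot be differentiated in x; this is why difference quotients are used and limits taken in the
  bounds. The weight has to be bounded at first because \<open>m\<close> can be absorbed only when
  it is known to be finite. The rate 3/4 lies above the growth rate 1/2 of the target weight and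
  below the decay rate 1 of the kernel, which leaves the integrable factor
  \<open>exp (- \<bar>z\<bar> / 4)\<close>. The condition \<open>d > 1/2\<close> enters with the
  square of the weight: it beats \<open>exp \<bar>y\<bar>\<close> by about
  \<open>(1 + \<bar>y\<bar>) * ln (1 + \<bar>y\<bar>) powr (2 * d)\<close>, whose reciprocal is
  integrable at infinity exactly when \<open>2 * d > 1\<close>. Positivity of the profile needs only
  the initial time: \<open>P 0 > 0\<close> because the data are non-trivial, and every mean over an
  interval starting at 0 inherits this. By backward uniqueness the solution is the zero function at
  no time, so both sides of the equivalence in (i) are false throughout.\<close>

lemma continuous_on_integral_dominated:
  fixes k :: "'a::metric_space \<Rightarrow> 'b \<Rightarrow> 'c::{banach, second_countable_topology}"
  assumes "\<And>x. x \<in> S \<Longrightarrow> k x \<in> borel_measurable M"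
    and "integrable M w" and "\<And>x y. x \<in> S \<Longrightarrow> y \<in> space M \<Longrightarrow> norm (k x y) \<le> w y"
    and "\<And>y. y \<in> space M \<Longrightarrow> continuous_on S (\<lambda>x. k x y)"
  shows "continuous_on S (\<lambda>x. LINT y|M. k x y)"
  unfolding continuous_on_sequentially comp_def
proof (intro allI ballI impI, elim conjE)
  fix X x assume x: "x \<in> S" "\<forall>n::nat. X n \<in> S" "X \<longlonglongrightarrow> x"
  show "(\<lambda>n. LINT y|M. k (X n) y) \<longlonglongrightarrow> (LINT y|M. k x y)"
  proof (rule integral_dominated_convergence[where w = w])
    show "AE y in M. (\<lambda>n. k (X n) y) \<longlonglongrightarrow> k x y"
      using assms(4) x unfolding continuous_on_sequentially comp_def by (intro AE_I2) blast
  qed (use assms x in auto)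
qed

section \<open>Gaussian damping and pointwise Fourier inversion\<close>

lemma integral_gaussian_cis:
  fixes e z :: real
  assumes "e > 0"
  shows "(LINT \<xi>|lborel. complex_of_real (exp (- (e * \<xi>)\<^sup>2 / 2)) * cis (z * \<xi>))
    = 2 * pi * normal_density 0 e z"
proof -
  have *: "(LINT \<xi>|lborel. std_normal_density \<xi> *\<^sub>R iexp (t * \<xi>)) = exp (- (t^2) / 2)" for t :: real
    using fun_cong[OF char_std_normal_distribution, of t] unfolding char_def
    by (subst (asm) integral_density) auto
  have "(LINT \<xi>|lborel. complex_of_real (exp (- (e * \<xi>)\<^sup>2 / 2)) * cis (z * \<xi>))
     = (1 / e) *\<^sub>R (LINT \<xi>|lborel. complex_of_real (exp (- \<xi>\<^sup>2 / 2)) * cis (z / e * \<xi>))"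
    using lborel_integral_real_affine[of "1/e" "\<lambda>\<xi>. complex_of_real (exp (- (e * \<xi>)\<^sup>2 / 2)) * cis (z * \<xi>)" 0]
      assms by (simp add: field_simps)
  also have "(\<lambda>\<xi>. complex_of_real (exp (- \<xi>\<^sup>2 / 2)) * cis (z / e * \<xi>))
     = (\<lambda>\<xi>. sqrt (2 * pi) *\<^sub>R (std_normal_density \<xi> *\<^sub>R iexp (z / e * \<xi>)))"
    by (rule ext) (simp add: std_normal_density_def scaleR_conv_of_real cis_conv_exp)
  also have "(LINT \<xi>|lborel. sqrt (2 * pi) *\<^sub>R (std_normal_density \<xi> *\<^sub>R iexp (z / e * \<xi>)))
     = sqrt (2 * pi) *\<^sub>R complex_of_real (exp (- ((z / e)^2) / 2))"
    by (subst integral_scaleR_right) (simp only: *)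
  finally show ?thesis
    using assms
    by (simp add: normal_density_def scaleR_conv_of_real power_divide real_sqrt_mult
        field_simps flip: of_real_mult of_real_divide)
qed

lemma mult_le_half_squares: "a * b \<le> (a\<^sup>2 + b\<^sup>2) / (2::real)"
  using sum_squares_bound[of a b] by (simp add: field_simps)

lemma integrable_mult_of_squares:
  fixes p q :: "'a \<Rightarrow> real"
  assumes [measurable]: "p \<in> borel_measurable M" "q \<in> borel_measurable M"
    and "integrable M (\<lambda>x. (p x)\<^sup>2)" "integrable M (\<lambda>x. (q x)\<^sup>2)"
  shows "integrable M (\<lambda>x. p x * q x)"
proof (rule Bochner_Integration.integrable_bound)
  show "integrable M (\<lambda>x. ((p x)\<^sup>2 + (q x)\<^sup>2) / 2)" using assms by auto
  show "AE x in M. norm (p x * q x) \<le> norm (((p x)\<^sup>2 + (q x)\<^sup>2) / 2)"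
    using mult_le_half_squares[of "\<bar>p x\<bar>" "\<bar>q x\<bar>" for x] by (auto simp: abs_mult)
qed measurable

lemma integrable_gaussian_square:
  assumes "e > 0" shows "integrable lborel (\<lambda>x. (normal_density 0 e (a - x))\<^sup>2)"
proof -
  have i: "integrable lborel (\<lambda>x. normal_density 0 e (a - x))"
    using lborel_integrable_real_affine[of "normal_density 0 e" "-1" a] assms by simp
  show ?thesis
  proof (rule Bochner_Integration.integrable_bound)
    show "integrable lborel (\<lambda>x. (1 / sqrt (2 * pi * e\<^sup>2)) * normal_density 0 e (a - x))"
      using i by auto
    show "AE x in lborel. norm ((normal_density 0 e (a - x))\<^sup>2)
       \<le> norm ((1 / sqrt (2 * pi * e\<^sup>2)) * normal_density 0 e (a - x))"
    proof (rule AE_I2)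
      fix x
      have "normal_density 0 e (a - x) \<le> 1 / sqrt (2 * pi * e\<^sup>2)"
        unfolding normal_density_def by (auto intro!: divide_right_mono)
      then show "norm ((normal_density 0 e (a - x))\<^sup>2)
       \<le> norm ((1 / sqrt (2 * pi * e\<^sup>2)) * normal_density 0 e (a - x))"
        using mult_right_mono[of "normal_density 0 e (a - x)" "1 / sqrt (2 * pi * e\<^sup>2)" "normal_density 0 e (a - x)"]
        by (simp add: power2_eq_square abs_mult)
    qed
  qed auto
qed

text \<open>The scales \<open>e\<close> tend to 0; the mass outside \<open>{-\<delta>..\<delta>}\<close> is bounded through the second moment.\<close>

lemma gaussian_approximate_identity:
  fixes h :: "real \<Rightarrow> real" and x \<eta> :: real
  assumes hm[measurable]: "h \<in> borel_measurable borel" and h2: "integrable lborel (\<lambda>x. (h x)\<^sup>2)"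
    and ct: "isCont h x" and "\<eta> > 0"
  shows "\<forall>\<^sub>F e in at_right 0. \<bar>(LINT y|lborel. h y * normal_density 0 e (x - y)) - h x\<bar> \<le> \<eta>"
proof -
  obtain \<delta> where d: "\<delta> > 0" "\<And>y. \<bar>y - x\<bar> < \<delta> \<Longrightarrow> \<bar>h y - h x\<bar> < \<eta> / 2"
    using ct \<open>\<eta> > 0\<close> unfolding continuous_at_eps_delta dist_real_def
    by (meson half_gt_zero)
  \<comment> \<open>Away from x, \<open>\<bar>h y\<bar> \<le> 1/2 + (h y)\<^sup>2 / 2\<close> splits
    \<open>\<bar>h y - h x\<bar>\<close> into a constant, charged to the second moment
    \<open>e\<^sup>2\<close> through \<open>1 \<le> (x - y)\<^sup>2 / \<delta>\<^sup>2\<close>, and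
    an integrable square, charged to the value of the density at \<delta>.\<close>
  define C where "C = (1 / 2 + \<bar>h x\<bar>) / \<delta>\<^sup>2"
  define I where "I = (LINT y|lborel. (h y)\<^sup>2)"
  define b where "b e = C * e\<^sup>2 + I / 2 * normal_density 0 e \<delta>" for e
  have main: "\<bar>(LINT y|lborel. h y * normal_density 0 e (x - y)) - h x\<bar> \<le> \<eta> / 2 + b e" if "e > 0" for e
  proof -
    let ?G = "\<lambda>y. normal_density 0 e (x - y)"
    have iG: "integrable lborel ?G"
      using lborel_integrable_real_affine[of "normal_density 0 e" "-1" x] that by simp
    have G1: "(LINT y|lborel. ?G y) = 1"
      using lborel_integral_real_affine[of "-1" "normal_density 0 e" x] that by simp
    have m: "has_bochner_integral lborel (\<lambda>y. normal_density 0 e y * y^2) (e^2)"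
      using normal_moment_even[OF that, of 0 1] by simp
    have iG2: "integrable lborel (\<lambda>y. ?G y * (x - y)^2)"
      using lborel_integrable_real_affine[of "\<lambda>y. normal_density 0 e y * y^2" "-1" x] m
      by (simp add: has_bochner_integral_iff)
    have G2: "(LINT y|lborel. ?G y * (x - y)^2) = e^2"
      using lborel_integral_real_affine[of "-1" "\<lambda>y. normal_density 0 e y * y^2" x] m
      by (simp add: has_bochner_integral_iff)
    have ihG: "integrable lborel (\<lambda>y. h y * ?G y)"
      by (rule integrable_mult_of_squares) (use h2 integrable_gaussian_square[OF that] in auto)
    have "(LINT y|lborel. h y * ?G y) - h x = (LINT y|lborel. h y * ?G y) - h x * (LINT y|lborel. ?G y)"
      using G1 by simp
    also have "\<dots> = (LINT y|lborel. (h y - h x) * ?G y)"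
      using ihG iG by (simp add: left_diff_distrib)
    also have "\<bar>\<dots>\<bar> \<le> (LINT y|lborel. \<bar>(h y - h x) * ?G y\<bar>)"
      by (rule integral_abs_bound)
    also have "\<dots> \<le> (LINT y|lborel. \<eta>/2 * ?G y + C * (?G y * (x-y)^2) + (h y)\<^sup>2 * (normal_density 0 e \<delta> / 2))"
    proof (rule integral_mono)
      show "integrable lborel (\<lambda>y. \<bar>(h y - h x) * ?G y\<bar>)"
        using ihG iG by (auto simp: left_diff_distrib)
      fix y
      show "\<bar>(h y - h x) * ?G y\<bar> \<le> \<eta>/2 * ?G y + C * (?G y * (x-y)^2) + (h y)\<^sup>2 * (normal_density 0 e \<delta> / 2)"
      proof (cases "\<bar>y - x\<bar> < \<delta>")
        case True
        have "\<bar>(h y - h x) * ?G y\<bar> \<le> \<eta>/2 * ?G y"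
          using mult_right_mono[of "\<bar>h y - h x\<bar>" "\<eta> / 2" "?G y"] d(2)[OF True] by (simp add: abs_mult)
        moreover have "0 \<le> C * (?G y * (x-y)^2)" "0 \<le> (h y)\<^sup>2 * (normal_density 0 e \<delta> / 2)"
          by (auto simp: C_def)
        ultimately show ?thesis by linarith
      next
        case False
        then have s: "(x - y)^2 \<ge> \<delta>^2" using d(1)
          by (metis abs_le_square_iff abs_minus_commute abs_of_pos not_less)
        then have far: "?G y \<le> normal_density 0 e \<delta>"
          unfolding normal_density_def
          by (intro mult_left_mono) (auto intro!: divide_right_mono)
        have one: "1 \<le> (x-y)^2 / \<delta>^2" using s d(1) by (simp add: field_simps)
        have "\<bar>h y\<bar> \<le> 1 / 2 + (h y)^2 / 2"
          using mult_le_half_squares[of 1 "\<bar>h y\<bar>"] by simp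
        then have "\<bar>h y - h x\<bar> \<le> (1/2 + \<bar>h x\<bar>) + (h y)^2 / 2" by linarith
        then have "\<bar>h y - h x\<bar> * ?G y \<le> ((1/2 + \<bar>h x\<bar>) + (h y)^2 / 2) * ?G y"
          by (intro mult_right_mono) auto
        also have "\<dots> = (1/2 + \<bar>h x\<bar>) * ?G y * 1 + (h y)^2 / 2 * ?G y"
          by (simp add: algebra_simps)
        also have "\<dots> \<le> (1/2 + \<bar>h x\<bar>) * ?G y * ((x-y)^2 / \<delta>^2) + (h y)^2 / 2 * normal_density 0 e \<delta>"
          by (intro add_mono mult_left_mono one far) auto
        also have "\<dots> = C * (?G y * (x-y)^2) + (h y)\<^sup>2 * (normal_density 0 e \<delta> / 2)"
          by (simp add: C_def field_simps)
        finally have "\<bar>h y - h x\<bar> * ?G y \<le> \<dots>" .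
        moreover have "0 \<le> \<eta>/2 * ?G y" using \<open>\<eta> > 0\<close> by auto
        ultimately show ?thesis by (simp add: abs_mult)
      qed
    qed (use iG iG2 h2 in auto)
    also have "\<dots> = \<eta>/2 + b e"
      using iG iG2 h2 by (simp add: G1 G2 b_def I_def algebra_simps)
    finally show ?thesis .
  qed
  have "((\<lambda>e. normal_density 0 e \<delta>) \<longlongrightarrow> 0) (at_right 0)"
    unfolding normal_density_def using d(1) by real_asymp
  then have "(b \<longlongrightarrow> C * 0\<^sup>2 + I / 2 * 0) (at_right 0)"
    unfolding b_def by (intro tendsto_intros)
  then have "\<forall>\<^sub>F e in at_right 0. b e < \<eta> / 2"
    using \<open>\<eta> > 0\<close> by (intro order_tendstoD) auto
  then show ?thesis
    using eventually_at_right_less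
  proof eventually_elim
    case (elim e) then show ?case using main[of e] by linarith
  qed
qed

lemma measurable_cis[measurable (raw)]:
  "q \<in> borel_measurable M \<Longrightarrow> (\<lambda>x. cis (q x)) \<in> borel_measurable M"
  by (rule borel_measurable_continuous_on[OF continuous_on_cis[OF continuous_on_id]]) auto

lemma set_integrable_of_square_integrable:
  fixes h :: "real \<Rightarrow> real"
  assumes [measurable]: "h \<in> borel_measurable borel" and "integrable lborel (\<lambda>x. (h x)\<^sup>2)"
  shows "integrable lborel (\<lambda>y. indicator {a..b} y * h y)"
proof (rule integrable_mult_of_squares)
  have "(\<lambda>x. (indicator {a..b} x)\<^sup>2) = (indicator {a..b} :: real \<Rightarrow> real)"
    by (auto simp: indicator_def)
  then show "integrable lborel (\<lambda>x. (indicator {a..b} x :: real)\<^sup>2)"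
    using integrable_real_indicator[of "{a..b}" lborel] by (simp add: emeasure_lborel_Icc_eq)
qed (use assms in auto)

lemma measurable_trunc_fourier[measurable]:
  assumes [measurable]: "h \<in> borel_measurable borel"
  shows "trunc_fourier h N \<in> borel_measurable borel"
  unfolding trunc_fourier_def set_lebesgue_integral_def by measurable

text \<open>Fubini applies because the Gaussian factor makes the double integral absolutely
  convergent; the inner integral over \<xi> is again a Gaussian, now in \<open>x - y\<close>. The
  factor \<open>sqrt (2 * pi)\<close> is the \<open>2 * pi\<close> of that integral divided by the
  normalisation of \<open>trunc_fourier\<close>.\<close>

lemma trunc_fourier_gaussian:
  fixes h :: "real \<Rightarrow> real"
  assumes hm[measurable]: "h \<in> borel_measurable borel" and h2: "integrable lborel (\<lambda>x. (h x)\<^sup>2)"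
    and "e > 0"
  shows "(LINT \<xi>|lborel. trunc_fourier h N \<xi> * (complex_of_real (exp (- (e * \<xi>)\<^sup>2 / 2)) * cis (x * \<xi>)))
    = complex_of_real (sqrt (2 * pi) * (LINT y|lborel. indicator {-N..N} y * (h y * normal_density 0 e (x - y))))"
proof -
  define m where "m \<xi> = complex_of_real (exp (- (e * \<xi>)\<^sup>2 / 2)) * cis (x * \<xi>)" for \<xi>
  define k where "k \<xi> y = indicator {-N..N} y *\<^sub>R (cis (- (\<xi> * y)) * complex_of_real (h y)) * m \<xi>" for \<xi> y
  have [measurable]: "m \<in> borel_measurable borel"
    unfolding m_def[abs_def] by measurable
  have nm: "norm (m \<xi>) = exp (- (e * \<xi>)\<^sup>2 / 2)" for \<xi> by (simp add: m_def norm_mult)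
  have "exp (- (e * \<xi>)\<^sup>2 / 2) = sqrt (2 * pi * (1/e)\<^sup>2) * normal_density 0 (1/e) \<xi>" for \<xi>
    using \<open>e > 0\<close> by (simp add: normal_density_def power_divide power_mult_distrib real_sqrt_mult field_simps)
  then have im: "integrable lborel (\<lambda>\<xi>. norm (m \<xi>))"
    unfolding nm using \<open>e > 0\<close> by simp
  have [measurable]: "case_prod k \<in> borel_measurable (lborel \<Otimes>\<^sub>M lborel)"
    unfolding k_def[abs_def] by measurable
  have nk: "norm (k \<xi> y) = \<bar>indicator {-N..N} y * h y\<bar> * norm (m \<xi>)" for \<xi> y
    by (simp add: k_def norm_mult abs_mult)
  have ih: "integrable lborel (\<lambda>y. indicator {-N..N} y * h y)"
    by (rule set_integrable_of_square_integrable) (use assms in auto)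
  have ik: "integrable (lborel \<Otimes>\<^sub>M lborel) (case_prod k)"
  proof (rule lborel_pair.Fubini_integrable)
    show "integrable lborel (\<lambda>\<xi>. LINT y|lborel. norm (case_prod k (\<xi>, y)))"
      unfolding prod.case nk using im ih by simp
    show "AE \<xi> in lborel. integrable lborel (\<lambda>y. case_prod k (\<xi>, y))"
    proof (rule AE_I2)
      fix \<xi>
      have "integrable lborel (\<lambda>y. norm (k \<xi> y))" unfolding nk using ih by simp
      moreover have "k \<xi> \<in> borel_measurable lborel" unfolding k_def[abs_def] by measurable
      ultimately show "integrable lborel (\<lambda>y. case_prod k (\<xi>, y))"
        by (simp add: integrable_norm_iff)
    qed
  qed measurable
  have "(LINT \<xi>|lborel. trunc_fourier h N \<xi> * m \<xi>)
      = (LINT \<xi>|lborel. complex_of_real (1 / sqrt (2 * pi)) * (LINT y|lborel. k \<xi> y))"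
    unfolding trunc_fourier_def set_lebesgue_integral_def k_def
    by (simp flip: integral_mult_left_zero)
  also have "\<dots> = complex_of_real (1 / sqrt (2 * pi)) * (LINT y|lborel. LINT \<xi>|lborel. k \<xi> y)"
    using lborel_pair.Fubini_integral[OF ik] by simp
  also have "(\<lambda>y. LINT \<xi>|lborel. k \<xi> y)
      = (\<lambda>y. complex_of_real (2 * pi * (indicator {-N..N} y * (h y * normal_density 0 e (x - y)))))"
  proof
    fix y
    have "(LINT \<xi>|lborel. k \<xi> y) = (LINT \<xi>|lborel. complex_of_real (indicator {-N..N} y * h y)
        * (complex_of_real (exp (- (e * \<xi>)\<^sup>2 / 2)) * cis ((x - y) * \<xi>)))"
    proof (rule Bochner_Integration.integral_cong[OF refl])
      fix \<xi>
      have c: "cis ((x - y) * \<xi>) = cis (- (\<xi> * y)) * cis (x * \<xi>)"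
        by (simp add: cis_mult algebra_simps)
      show "k \<xi> y = complex_of_real (indicator {-N..N} y * h y)
        * (complex_of_real (exp (- (e * \<xi>)\<^sup>2 / 2)) * cis ((x - y) * \<xi>))"
        unfolding k_def m_def c scaleR_conv_of_real of_real_mult by (simp only: mult_ac)
    qed
    then show "(LINT \<xi>|lborel. k \<xi> y) = 2 * pi * (indicator {-N..N} y * (h y * normal_density 0 e (x - y)))"
      using integral_gaussian_cis[OF \<open>e > 0\<close>, of "x - y"] by simp
  qed
  also have "complex_of_real (1 / sqrt (2 * pi)) * (LINT y|lborel. complex_of_real (2 * pi * (indicator {-N..N} y * (h y * normal_density 0 e (x - y)))))
      = complex_of_real (sqrt (2 * pi) * (LINT y|lborel. indicator {-N..N} y * (h y * normal_density 0 e (x - y))))"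
    unfolding integral_complex_of_real integral_mult_right_zero
    by (simp add: field_simps flip: of_real_mult of_real_divide power2_eq_square)
  finally show ?thesis unfolding m_def .
qed

text \<open>The truncated transforms converge to \<open>v\<close> only in L2. Pairing them with the
  square-integrable multiplier \<open>m\<close> turns this into convergence of numbers, by
  Cauchy-Schwarz; on the other side dominated convergence removes the cut-off in y.\<close>

lemma fourier_L2_gaussian:
  fixes h :: "real \<Rightarrow> real"
  assumes hm[measurable]: "h \<in> borel_measurable borel" and h2: "integrable lborel (\<lambda>x. (h x)\<^sup>2)"
    and F: "is_fourier_L2 h v" and iv: "integrable lborel v" and "e > 0"
  shows "(LINT \<xi>|lborel. v \<xi> * (complex_of_real (exp (- (e * \<xi>)\<^sup>2 / 2)) * cis (x * \<xi>)))
    = complex_of_real (sqrt (2 * pi) * (LINT y|lborel. h y * normal_density 0 e (x - y)))"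
proof -
  define m where "m \<xi> = complex_of_real (exp (- (e * \<xi>)\<^sup>2 / 2)) * cis (x * \<xi>)" for \<xi>
  have [measurable]: "m \<in> borel_measurable borel"
    unfolding m_def[abs_def] by measurable
  have vm[measurable]: "v \<in> borel_measurable borel"
    and lim: "((\<lambda>N. \<integral>\<^sup>+ \<xi>. ennreal ((cmod (v \<xi> - trunc_fourier h N \<xi>))\<^sup>2) \<partial>lborel) \<longlongrightarrow> 0) at_top"
    using F by (auto simp: is_fourier_L2_def)
  have nm: "norm (m \<xi>) = exp (- (e * \<xi>)\<^sup>2 / 2)" for \<xi> by (simp add: m_def norm_mult)
  have im: "integrable lborel (\<lambda>\<xi>. norm (m \<xi>))"
  proof -
    have "exp (- (e * \<xi>)\<^sup>2 / 2) = sqrt (2 * pi * (1/e)\<^sup>2) * normal_density 0 (1/e) \<xi>" for \<xi>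
      using \<open>e > 0\<close> by (simp add: normal_density_def power_divide power_mult_distrib real_sqrt_mult field_simps)
    then show ?thesis unfolding nm using \<open>e > 0\<close> by simp
  qed
  have im2: "integrable lborel (\<lambda>\<xi>. (norm (m \<xi>))\<^sup>2)"
  proof (rule Bochner_Integration.integrable_bound[OF im])
    show "AE \<xi> in lborel. norm ((norm (m \<xi>))\<^sup>2) \<le> norm (norm (m \<xi>))"
      by (auto simp: nm power2_eq_square mult_le_one intro!: mult_left_le)
  qed auto
  have ivm: "integrable lborel (\<lambda>\<xi>. v \<xi> * m \<xi>)"
    by (rule Bochner_Integration.integrable_bound[OF iv])
      (auto simp: norm_mult nm intro!: mult_left_le)
  have itm: "integrable lborel (\<lambda>\<xi>. trunc_fourier h N \<xi> * m \<xi>)" for N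
  proof -
    have ih: "integrable lborel (\<lambda>y. indicator {-N..N} y * h y)"
      by (rule set_integrable_of_square_integrable) (use assms in auto)
    define C where "C = 1 / sqrt (2 * pi) * (LINT y|lborel. \<bar>indicator {-N..N} y * h y\<bar>)"
    have b: "norm (trunc_fourier h N \<xi>) \<le> C" for \<xi>
    proof -
      have "norm (LINT y:{-N..N}|lborel. cis (- (\<xi> * y)) * complex_of_real (h y))
        \<le> (LINT y|lborel. norm (indicator {-N..N} y *\<^sub>R (cis (- (\<xi> * y)) * complex_of_real (h y))))"
        unfolding set_lebesgue_integral_def by (rule integral_norm_bound)
      then have "norm (LINT y:{-N..N}|lborel. cis (- (\<xi> * y)) * complex_of_real (h y))
        \<le> (LINT y|lborel. \<bar>indicator {-N..N} y * h y\<bar>)"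
        by (simp add: norm_mult abs_mult)
      from mult_left_mono[OF this, of "1 / sqrt (2 * pi)"] show ?thesis
        by (simp add: trunc_fourier_def C_def norm_mult norm_divide)
    qed
    show ?thesis
    proof (rule Bochner_Integration.integrable_bound)
      show "integrable lborel (\<lambda>\<xi>. C * norm (m \<xi>))" using im by simp
      show "AE \<xi> in lborel. norm (trunc_fourier h N \<xi> * m \<xi>) \<le> norm (C * norm (m \<xi>))"
        using b by (intro AE_I2) (auto simp: norm_mult abs_mult intro!: mult_right_mono order_trans[OF b])
    qed measurable
  qed
  define E where "E = (\<integral>\<^sup>+ \<xi>. (ennreal (norm (m \<xi>)))\<^sup>2 \<partial>lborel)"
  have Efin: "E < top"
    using im2 unfolding E_def integrable_iff_bounded by (simp add: ennreal_power)
  define D where "D N = norm ((LINT \<xi>|lborel. v \<xi> * m \<xi>) - (LINT \<xi>|lborel. trunc_fourier h N \<xi> * m \<xi>))" for N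
  have D: "ennreal ((D N)\<^sup>2) \<le> E * (\<integral>\<^sup>+ \<xi>. ennreal ((cmod (v \<xi> - trunc_fourier h N \<xi>))\<^sup>2) \<partial>lborel)" for N
  proof -
    have "ennreal (D N) \<le> (\<integral>\<^sup>+ \<xi>. ennreal (norm ((v \<xi> - trunc_fourier h N \<xi>) * m \<xi>)) \<partial>lborel)"
      using integral_norm_bound_ennreal[OF Bochner_Integration.integrable_diff[OF ivm itm[of N]]] ivm itm[of N]
      by (simp add: D_def left_diff_distrib)
    then have "(ennreal (D N))\<^sup>2 \<le> (\<integral>\<^sup>+ \<xi>. ennreal (cmod (v \<xi> - trunc_fourier h N \<xi>)) * ennreal (norm (m \<xi>)) \<partial>lborel)\<^sup>2"
      by (intro power_mono) (auto simp: norm_mult ennreal_mult)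
    also have "\<dots> \<le> (\<integral>\<^sup>+ \<xi>. (ennreal (cmod (v \<xi> - trunc_fourier h N \<xi>)))\<^sup>2 \<partial>lborel) * E"
      unfolding E_def by (rule Cauchy_Schwarz_nn_integral) measurable
    finally show ?thesis by (simp add: ennreal_power D_def mult.commute)
  qed
  have "((\<lambda>N. ennreal ((D N)\<^sup>2)) \<longlongrightarrow> 0) at_top"
  proof (rule tendsto_sandwich[OF _ _ tendsto_const])
    show "((\<lambda>N. E * (\<integral>\<^sup>+ \<xi>. ennreal ((cmod (v \<xi> - trunc_fourier h N \<xi>))\<^sup>2) \<partial>lborel)) \<longlongrightarrow> 0) at_top"
      using ennreal_tendsto_cmult[OF Efin lim] by simp
  qed (use D in auto)
  then have "((\<lambda>N. (D N)\<^sup>2) \<longlongrightarrow> 0) at_top"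
    using tendsto_ennrealD[of "\<lambda>N. (D N)\<^sup>2" 0 at_top] by auto
  from tendsto_real_sqrt[OF this] have "(D \<longlongrightarrow> 0) at_top" by (simp add: D_def[abs_def])
  then have 1: "((\<lambda>N. LINT \<xi>|lborel. trunc_fourier h N \<xi> * m \<xi>) \<longlongrightarrow> (LINT \<xi>|lborel. v \<xi> * m \<xi>)) at_top"
    unfolding D_def by (subst (asm) norm_minus_commute) (simp add: tendsto_norm_zero_iff flip: Lim_null)
  have "((\<lambda>N. LINT y|lborel. indicator {-N..N} y * (h y * normal_density 0 e (x - y)))
      \<longlongrightarrow> (LINT y|lborel. h y * normal_density 0 e (x - y))) at_top"
  proof (rule integral_dominated_convergence_at_top[where w = "\<lambda>y. \<bar>h y * normal_density 0 e (x - y)\<bar>"])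
    show "integrable lborel (\<lambda>y. \<bar>h y * normal_density 0 e (x - y)\<bar>)"
      by (intro integrable_abs integrable_mult_of_squares) (use h2 integrable_gaussian_square[OF \<open>e > 0\<close>] in auto)
    show "AE y in lborel. ((\<lambda>N. indicator {-N..N} y * (h y * normal_density 0 e (x - y))) \<longlongrightarrow> h y * normal_density 0 e (x - y)) at_top"
    proof (intro AE_I2 tendsto_eventually eventually_mono[OF eventually_ge_at_top])
      fix y N :: real assume "\<bar>y\<bar> \<le> N"
      then show "indicator {-N..N} y * (h y * normal_density 0 e (x - y)) = h y * normal_density 0 e (x - y)"
        by (auto simp: indicator_def)
    qed
  qed (auto simp: indicator_def)
  then have 2: "((\<lambda>N. LINT \<xi>|lborel. trunc_fourier h N \<xi> * m \<xi>) \<longlongrightarrow> 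
      complex_of_real (sqrt (2 * pi) * (LINT y|lborel. h y * normal_density 0 e (x - y)))) at_top"
    unfolding m_def trunc_fourier_gaussian[OF hm h2 \<open>e > 0\<close>]
    by (intro tendsto_intros)
  from tendsto_unique[OF _ 1 2] show ?thesis by (simp add: m_def)
qed

text \<open>The damped formula is followed along \<open>e n\<close> to 0: Gaussian averages tend to
  \<open>h x\<close> at a point of continuity, and \<open>norm (v \<xi>)\<close> dominates the
  damped inverse transform.\<close>

lemma fourier_inversion:
  fixes h :: "real \<Rightarrow> real"
  assumes hm[measurable]: "h \<in> borel_measurable borel" and h2: "integrable lborel (\<lambda>x. (h x)\<^sup>2)"
    and F: "is_fourier_L2 h v" and iv: "integrable lborel v" and ct: "isCont h x"
  shows "complex_of_real (h x) = complex_of_real (1 / sqrt (2 * pi)) * (LINT \<xi>|lborel. v \<xi> * cis (x * \<xi>))"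
proof -
  have vm[measurable]: "v \<in> borel_measurable borel" using F by (auto simp: is_fourier_L2_def)
  define e :: "nat \<Rightarrow> real" where "e n = 1 / real (Suc n)" for n
  have e: "e n > 0" for n by (simp add: e_def)
  have e0: "e \<longlonglongrightarrow> 0" unfolding e_def by (rule LIMSEQ_Suc[OF lim_1_over_n])
  have "((\<lambda>e. LINT y|lborel. h y * normal_density 0 e (x - y)) \<longlongrightarrow> h x) (at_right 0)"
  proof (rule tendstoI)
    fix \<eta> :: real assume "\<eta> > 0"
    then show "\<forall>\<^sub>F e in at_right 0. dist (LINT y|lborel. h y * normal_density 0 e (x - y)) (h x) < \<eta>"
      using gaussian_approximate_identity[OF hm h2 ct, of "\<eta>/2"]
      by (auto simp: dist_real_def elim!: eventually_mono)
  qed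
  moreover have "filterlim e (at_right 0) sequentially"
    using e e0 by (auto simp: filterlim_at less_imp_neq[symmetric] intro!: always_eventually)
  ultimately have "(\<lambda>n. LINT y|lborel. h y * normal_density 0 (e n) (x - y)) \<longlonglongrightarrow> h x"
    by (rule filterlim_compose)
  then have 1: "(\<lambda>n. LINT \<xi>|lborel. v \<xi> * (complex_of_real (exp (- (e n * \<xi>)\<^sup>2 / 2)) * cis (x * \<xi>))) \<longlonglongrightarrow> complex_of_real (sqrt (2 * pi) * h x)"
    unfolding fourier_L2_gaussian[OF hm h2 F iv e] by (intro tendsto_intros)
  have 2: "(\<lambda>n. LINT \<xi>|lborel. v \<xi> * (complex_of_real (exp (- (e n * \<xi>)\<^sup>2 / 2)) * cis (x * \<xi>))) \<longlonglongrightarrow> (LINT \<xi>|lborel. v \<xi> * cis (x * \<xi>))"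
  proof (rule integral_dominated_convergence[where w = "\<lambda>\<xi>. norm (v \<xi>)"])
    show "AE \<xi> in lborel. (\<lambda>n. v \<xi> * (complex_of_real (exp (- (e n * \<xi>)\<^sup>2 / 2)) * cis (x * \<xi>))) \<longlonglongrightarrow> v \<xi> * cis (x * \<xi>)"
    proof (rule AE_I2)
      fix \<xi>
      have "(\<lambda>n. v \<xi> * (complex_of_real (exp (- (e n * \<xi>)\<^sup>2 / 2)) * cis (x * \<xi>))) \<longlonglongrightarrow> v \<xi> * (complex_of_real (exp (- (0 * \<xi>)\<^sup>2 / 2)) * cis (x * \<xi>))"
        by (intro tendsto_intros e0) auto
      then show "(\<lambda>n. v \<xi> * (complex_of_real (exp (- (e n * \<xi>)\<^sup>2 / 2)) * cis (x * \<xi>))) \<longlonglongrightarrow> v \<xi> * cis (x * \<xi>)" by simp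
    qed
    show "(\<lambda>\<xi>. v \<xi> * cis (x * \<xi>)) \<in> borel_measurable lborel"
      "(\<lambda>\<xi>. v \<xi> * (complex_of_real (exp (- (e n * \<xi>)\<^sup>2 / 2)) * cis (x * \<xi>))) \<in> borel_measurable lborel" for n
      by measurable
  qed (use iv in \<open>auto simp: norm_mult intro!: mult_left_le\<close>)
  show ?thesis using LIMSEQ_unique[OF 1 2]
    by (simp add: field_simps)
qed

section \<open>Integrals of functions of the absolute value\<close>

lemma has_bochner_integral_even_FTC:
  fixes q Q :: "real \<Rightarrow> real"
  assumes qm[measurable]: "q \<in> borel_measurable borel"
    and dQ: "\<And>x. x \<ge> 0 \<Longrightarrow> (Q has_real_derivative q x) (at x)"
    and nn: "\<And>x. x \<ge> 0 \<Longrightarrow> q x \<ge> 0" and l: "(Q \<longlongrightarrow> l) at_top"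
  shows "has_bochner_integral lborel (\<lambda>x. q \<bar>x\<bar>) (2 * (l - Q 0))"
proof -
  have "(\<integral>\<^sup>+x. ennreal (q x) * indicator {0..} x \<partial>lborel) = ennreal (l - Q 0)"
    by (rule nn_integral_FTC_atLeast[OF qm dQ nn l])
  moreover have "Q 0 \<le> l"
  proof (rule tendsto_lowerbound[OF l])
    show "\<forall>\<^sub>F x in at_top. Q 0 \<le> Q x"
      using eventually_ge_at_top[of 0]
    proof eventually_elim
      case (elim x) then show ?case
        by (rule DERIV_nonneg_imp_nondecreasing) (use dQ nn in blast)
    qed
  qed auto
  moreover have "ennreal (indicator {0..} x * q x) = ennreal (q x) * indicator {0..} x" for x
    by (simp add: indicator_def)
  ultimately have R: "has_bochner_integral lborel (\<lambda>x. indicator {0..} x * q x) (l - Q 0)"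
    using nn by (intro has_bochner_integral_nn_integral AE_I2) (simp_all, simp add: indicator_def)
  then have L: "has_bochner_integral lborel (\<lambda>x. indicator {0..} (-x) * q (-x)) (l - Q 0)"
    using lborel_has_bochner_integral_real_affine_iff[of "-1" "\<lambda>x. indicator {0..} x * q x" "l - Q 0" 0] by simp
  have S: "has_bochner_integral lborel (\<lambda>x. indicator {0..} x * q x + indicator {0..} (-x) * q (-x)) (2 * (l - Q 0))"
    using has_bochner_integral_add[OF R L] by simp
  \<comment> \<open>The two half-lines share the point 0, where the sum counts \<open>q\<close>
    twice.\<close>
  have "AE x in lborel. indicator {0..} x * q x + indicator {0..} (-x) * q (-x) = q \<bar>x\<bar>"
    using AE_lborel_singleton[of 0] by eventually_elim (auto simp: indicator_def)
  then show ?thesis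
    by (rule has_bochner_integral_cong_AE[THEN iffD1, OF _ _ _ S, rotated 2]) simp_all
qed

text \<open>Comparison with \<open>(1 + \<bar>x\<bar>) powr (- 2 * a)\<close>, which has an explicit
  antiderivative, through
  \<open>(1 + \<bar>x\<bar>)\<^sup>2 \<le> 2 * (1 + x\<^sup>2)\<close>.\<close>

lemma integrable_bracket_powr:
  fixes a :: real
  assumes "a > 1/2"
  shows "integrable lborel (\<lambda>x::real. (1 + x\<^sup>2) powr (- a))"
proof -
  have "has_bochner_integral lborel (\<lambda>x::real. (1 + \<bar>x\<bar>) powr (- 2 * a)) (2 * (0 - (1 + 0) powr (1 - 2 * a) / (1 - 2 * a)))"
  proof (rule has_bochner_integral_even_FTC[where Q = "\<lambda>x. (1 + x) powr (1 - 2 * a) / (1 - 2 * a)"])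
    show "((\<lambda>x. (1 + x) powr (1 - 2 * a) / (1 - 2 * a)) has_real_derivative (1 + x) powr (- 2 * a)) (at x)"
      if "x \<ge> 0" for x
      using that assms DERIV_cdivide[OF DERIV_fun_powr[of "\<lambda>x. 1 + x" 1 x "1 - 2 * a"], of "1 - 2 * a"]
      by (auto intro!: derivative_eq_intros)
    show "((\<lambda>x. (1 + x) powr (1 - 2 * a) / (1 - 2 * a)) \<longlongrightarrow> 0) at_top"
      using assms by real_asymp
  qed auto
  then have i: "integrable lborel (\<lambda>x::real. 2 powr a * (1 + \<bar>x\<bar>) powr (- 2 * a))"
    by (auto simp: has_bochner_integral_iff)
  show ?thesis
  proof (rule Bochner_Integration.integrable_bound[OF i])
    show "AE x in lborel. norm ((1 + x\<^sup>2) powr (- a)) \<le> norm (2 powr a * (1 + \<bar>x\<bar>) powr (- 2 * a))"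
    proof (rule AE_I2)
      fix x :: real
      have "(1 + \<bar>x\<bar>)\<^sup>2 / 2 \<le> 1 + x\<^sup>2"
        using mult_le_half_squares[of 1 "\<bar>x\<bar>"] by (simp add: power2_eq_square algebra_simps)
      then have "(1 + x\<^sup>2) powr (- a) \<le> ((1 + \<bar>x\<bar>)\<^sup>2 / 2) powr (- a)"
        using assms by (intro powr_mono2') auto
      also have "\<dots> = 2 powr a * (1 + \<bar>x\<bar>) powr (- 2 * a)"
        by (simp add: powr_divide powr_powr powr_minus field_simps flip: powr_numeral)
      finally show "norm ((1 + x\<^sup>2) powr (- a)) \<le> norm (2 powr a * (1 + \<bar>x\<bar>) powr (- 2 * a))" by simp
    qed
  qed auto
qed

section \<open>Differences and uniqueness of Fourier-Plancherel transforms\<close>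

lemma norm_diff_square_le:
  fixes a b :: "'a::real_normed_vector"
  shows "(norm (a - b))\<^sup>2 \<le> 2 * (norm a)\<^sup>2 + 2 * (norm b)\<^sup>2"
proof -
  have "(norm (a - b))\<^sup>2 \<le> (norm a + norm b)\<^sup>2"
    by (intro power_mono norm_triangle_ineq4) auto
  also have "\<dots> \<le> 2 * (norm a)\<^sup>2 + 2 * (norm b)\<^sup>2"
    using mult_le_half_squares[of "norm a" "norm b"] by (simp add: power2_eq_square algebra_simps)
  finally show ?thesis .
qed

text \<open>Continuity into \<open>Hs\<close> is expressed through norms of differences, so their
  transforms have to be identified. Truncated transforms are additive because a square-integrable
  function is integrable on bounded intervals.\<close>

lemma is_fourier_L2_diff:
  fixes h k :: "real \<Rightarrow> real"
  assumes h[measurable]: "h \<in> borel_measurable borel" "integrable lborel (\<lambda>x. (h x)\<^sup>2)" and F: "is_fourier_L2 h v"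
    and k[measurable]: "k \<in> borel_measurable borel" "integrable lborel (\<lambda>x. (k x)\<^sup>2)" and G: "is_fourier_L2 k w"
  shows "is_fourier_L2 (\<lambda>x. h x - k x) (\<lambda>\<xi>. v \<xi> - w \<xi>)"
proof -
  have [measurable]: "v \<in> borel_measurable borel" "w \<in> borel_measurable borel"
    using F G by (auto simp: is_fourier_L2_def)
  let ?e = "\<lambda>h v N. \<integral>\<^sup>+ \<xi>. ennreal ((cmod (v \<xi> - trunc_fourier h N \<xi>))\<^sup>2) \<partial>lborel"
  have int: "integrable lborel (\<lambda>y. indicator {-N..N} y *\<^sub>R (cis (- (\<xi> * y)) * complex_of_real (h y)))"
    if [measurable]: "h \<in> borel_measurable borel" and "integrable lborel (\<lambda>x. (h x)\<^sup>2)" for h N \<xi>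
    by (rule Bochner_Integration.integrable_bound[OF set_integrable_of_square_integrable[OF that, of "-N" N]])
      (measurable, simp add: norm_mult abs_mult)
  have tr: "trunc_fourier (\<lambda>x. h x - k x) N \<xi> = trunc_fourier h N \<xi> - trunc_fourier k N \<xi>" for N \<xi>
  proof -
    have "indicator {-N..N} y *\<^sub>R (cis (- (\<xi> * y)) * complex_of_real (h y - k y))
       = indicator {-N..N} y *\<^sub>R (cis (- (\<xi> * y)) * complex_of_real (h y))
       - indicator {-N..N} y *\<^sub>R (cis (- (\<xi> * y)) * complex_of_real (k y))" for y
      by (simp add: right_diff_distrib scaleR_diff_right)
    then show ?thesis
      unfolding trunc_fourier_def set_lebesgue_integral_def
      by (simp only: Bochner_Integration.integral_diff[OF int[OF h] int[OF k]] right_diff_distrib)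
  qed
  have le: "?e (\<lambda>x. h x - k x) (\<lambda>\<xi>. v \<xi> - w \<xi>) N \<le> 2 * ?e h v N + 2 * ?e k w N" for N
  proof -
    have "?e (\<lambda>x. h x - k x) (\<lambda>\<xi>. v \<xi> - w \<xi>) N \<le> (\<integral>\<^sup>+ \<xi>. 2 * ennreal ((cmod (v \<xi> - trunc_fourier h N \<xi>))\<^sup>2)
       + 2 * ennreal ((cmod (w \<xi> - trunc_fourier k N \<xi>))\<^sup>2) \<partial>lborel)"
    proof (rule nn_integral_mono)
      fix \<xi>
      let ?a = "v \<xi> - trunc_fourier h N \<xi>" and ?b = "w \<xi> - trunc_fourier k N \<xi>"
      have eq: "v \<xi> - w \<xi> - (trunc_fourier h N \<xi> - trunc_fourier k N \<xi>) = ?a - ?b" by simp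
      have "ennreal ((cmod (?a - ?b))\<^sup>2) \<le> ennreal (2 * (cmod ?a)\<^sup>2 + 2 * (cmod ?b)\<^sup>2)"
        by (rule ennreal_leI[OF norm_diff_square_le])
      then show "ennreal ((cmod ((v \<xi> - w \<xi>) - trunc_fourier (\<lambda>x. h x - k x) N \<xi>))\<^sup>2) \<le>
        2 * ennreal ((cmod ?a)\<^sup>2) + 2 * ennreal ((cmod ?b)\<^sup>2)"
        unfolding tr eq by (simp add: ennreal_plus ennreal_mult)
    qed
    also have "\<dots> = 2 * ?e h v N + 2 * ?e k w N"
      by (simp add: nn_integral_add nn_integral_cmult)
    finally show ?thesis .
  qed
  have "((\<lambda>N. 2 * ?e h v N + 2 * ?e k w N) \<longlongrightarrow> 2 * 0 + 2 * 0) at_top"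
    using F G unfolding is_fourier_L2_def by (intro tendsto_add ennreal_tendsto_cmult) auto
  then have lim: "((\<lambda>N. 2 * ?e h v N + 2 * ?e k w N) \<longlongrightarrow> 0) at_top" by simp
  have "((\<lambda>N. ?e (\<lambda>x. h x - k x) (\<lambda>\<xi>. v \<xi> - w \<xi>) N) \<longlongrightarrow> 0) at_top"
    by (rule tendsto_sandwich[OF _ _ tendsto_const lim]) (simp_all add: le)
  then show ?thesis unfolding is_fourier_L2_def by auto
qed

text \<open>Both are L2 limits of the same truncated transforms. This is what frees
  \<open>Hs_norm\<close> from the choice made by \<open>SOME\<close>.\<close>

lemma is_fourier_L2_unique:
  fixes h :: "real \<Rightarrow> real"
  assumes h[measurable]: "h \<in> borel_measurable borel"
    and F: "is_fourier_L2 h v" and G: "is_fourier_L2 h w"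
  shows "AE \<xi> in lborel. v \<xi> = w \<xi>"
proof -
  have [measurable]: "v \<in> borel_measurable borel" "w \<in> borel_measurable borel"
    using F G by (auto simp: is_fourier_L2_def)
  let ?e = "\<lambda>v N. \<integral>\<^sup>+ \<xi>. ennreal ((cmod (v \<xi> - trunc_fourier h N \<xi>))\<^sup>2) \<partial>lborel"
  have le: "(\<integral>\<^sup>+ \<xi>. ennreal ((cmod (v \<xi> - w \<xi>))\<^sup>2) \<partial>lborel) \<le> 2 * ?e v N + 2 * ?e w N" for N
  proof -
    have "(\<integral>\<^sup>+ \<xi>. ennreal ((cmod (v \<xi> - w \<xi>))\<^sup>2) \<partial>lborel) \<le> (\<integral>\<^sup>+ \<xi>. 2 * ennreal ((cmod (v \<xi> - trunc_fourier h N \<xi>))\<^sup>2)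
       + 2 * ennreal ((cmod (w \<xi> - trunc_fourier h N \<xi>))\<^sup>2) \<partial>lborel)"
    proof (rule nn_integral_mono)
      fix \<xi>
      let ?a = "v \<xi> - trunc_fourier h N \<xi>" and ?b = "w \<xi> - trunc_fourier h N \<xi>"
      have "ennreal ((cmod (?a - ?b))\<^sup>2) \<le> ennreal (2 * (cmod ?a)\<^sup>2 + 2 * (cmod ?b)\<^sup>2)"
        by (rule ennreal_leI[OF norm_diff_square_le])
      then show "ennreal ((cmod (v \<xi> - w \<xi>))\<^sup>2) \<le> 2 * ennreal ((cmod ?a)\<^sup>2) + 2 * ennreal ((cmod ?b)\<^sup>2)"
        by (simp add: ennreal_plus ennreal_mult)
    qed
    also have "\<dots> = 2 * ?e v N + 2 * ?e w N"
      by (simp add: nn_integral_add nn_integral_cmult)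
    finally show ?thesis .
  qed
  have "((\<lambda>N. 2 * ?e v N + 2 * ?e w N) \<longlongrightarrow> 2 * 0 + 2 * 0) at_top"
    using F G unfolding is_fourier_L2_def by (intro tendsto_add ennreal_tendsto_cmult) auto
  then have "(\<integral>\<^sup>+ \<xi>. ennreal ((cmod (v \<xi> - w \<xi>))\<^sup>2) \<partial>lborel) \<le> 2 * 0 + 2 * 0"
    by (rule tendsto_lowerbound) (use le in \<open>auto intro: always_eventually\<close>)
  then have "(\<integral>\<^sup>+ \<xi>. ennreal ((cmod (v \<xi> - w \<xi>))\<^sup>2) \<partial>lborel) = 0" by simp
  then have "AE \<xi> in lborel. ennreal ((cmod (v \<xi> - w \<xi>))\<^sup>2) = 0"
    by (subst (asm) nn_integral_0_iff_AE) auto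
  then show ?thesis by eventually_elim (auto simp: ennreal_eq_0_iff)
qed

lemma Hs_diff:
  assumes "h \<in> Hs s" "k \<in> Hs s"
  shows "(\<lambda>x. h x - k x) \<in> Hs s"
proof -
  from assms obtain v w where
    h[measurable]: "h \<in> borel_measurable borel" "integrable lborel (\<lambda>x. (h x)\<^sup>2)" and F: "is_fourier_L2 h v"
    and k[measurable]: "k \<in> borel_measurable borel" "integrable lborel (\<lambda>x. (k x)\<^sup>2)" and G: "is_fourier_L2 k w"
    and v: "integrable lborel (\<lambda>\<xi>. (1 + \<xi>\<^sup>2) powr s * (cmod (v \<xi>))\<^sup>2)"
    and w: "integrable lborel (\<lambda>\<xi>. (1 + \<xi>\<^sup>2) powr s * (cmod (w \<xi>))\<^sup>2)"
    by (auto simp: Hs_def)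
  have [measurable]: "v \<in> borel_measurable borel" "w \<in> borel_measurable borel"
    using F G by (auto simp: is_fourier_L2_def)
  have "integrable lborel (\<lambda>x. (h x - k x)\<^sup>2)"
    by (rule Bochner_Integration.integrable_bound[of _ "\<lambda>x. 2 * (h x)\<^sup>2 + 2 * (k x)\<^sup>2"])
      (use h k norm_diff_square_le[of "h x" "k x" for x] in auto)
  moreover have "integrable lborel (\<lambda>\<xi>. (1 + \<xi>\<^sup>2) powr s * (cmod (v \<xi> - w \<xi>))\<^sup>2)"
  proof (rule Bochner_Integration.integrable_bound)
    show "integrable lborel (\<lambda>\<xi>. 2 * ((1 + \<xi>\<^sup>2) powr s * (cmod (v \<xi>))\<^sup>2) + 2 * ((1 + \<xi>\<^sup>2) powr s * (cmod (w \<xi>))\<^sup>2))"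
      using v w by auto
    show "AE \<xi> in lborel. norm ((1 + \<xi>\<^sup>2) powr s * (cmod (v \<xi> - w \<xi>))\<^sup>2)
      \<le> norm (2 * ((1 + \<xi>\<^sup>2) powr s * (cmod (v \<xi>))\<^sup>2) + 2 * ((1 + \<xi>\<^sup>2) powr s * (cmod (w \<xi>))\<^sup>2))"
    proof (rule AE_I2)
      fix \<xi> :: real
      show "norm ((1 + \<xi>\<^sup>2) powr s * (cmod (v \<xi> - w \<xi>))\<^sup>2)
      \<le> norm (2 * ((1 + \<xi>\<^sup>2) powr s * (cmod (v \<xi>))\<^sup>2) + 2 * ((1 + \<xi>\<^sup>2) powr s * (cmod (w \<xi>))\<^sup>2))"
        using mult_left_mono[OF norm_diff_square_le[of "v \<xi>" "w \<xi>"], of "(1 + \<xi>\<^sup>2) powr s"] by (simp add: algebra_simps)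
    qed
  qed measurable
  moreover have "is_fourier_L2 (\<lambda>x. h x - k x) (\<lambda>\<xi>. v \<xi> - w \<xi>)"
    by (rule is_fourier_L2_diff) fact+
  ultimately show ?thesis unfolding Hs_def by auto
qed

text \<open>Membership in \<open>Hs\<close> provides integrability for some transform, whereas the
  norm uses the one picked by \<open>SOME\<close>. As the integral of a non-integrable function is 0
  by convention, the norm carries information only after integrability has been moved to the picked
  transform.\<close>

lemma Hs_canonical_fourier:
  assumes "h \<in> Hs s"
  defines "v \<equiv> SOME v. is_fourier_L2 h v"
  shows "is_fourier_L2 h v" and "integrable lborel (\<lambda>\<xi>. (1 + \<xi>\<^sup>2) powr s * (cmod (v \<xi>))\<^sup>2)"
    and "(Hs_norm s h)\<^sup>2 = (LINT \<xi>|lborel. (1 + \<xi>\<^sup>2) powr s * (cmod (v \<xi>))\<^sup>2)"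
proof -
  from assms(1) obtain w where
    h[measurable]: "h \<in> borel_measurable borel" and G: "is_fourier_L2 h w"
    and w: "integrable lborel (\<lambda>\<xi>. (1 + \<xi>\<^sup>2) powr s * (cmod (w \<xi>))\<^sup>2)"
    by (auto simp: Hs_def)
  show F: "is_fourier_L2 h v" unfolding v_def by (rule someI[of _ w]) (rule G)
  have [measurable]: "v \<in> borel_measurable borel" "w \<in> borel_measurable borel"
    using F G by (auto simp: is_fourier_L2_def)
  show "integrable lborel (\<lambda>\<xi>. (1 + \<xi>\<^sup>2) powr s * (cmod (v \<xi>))\<^sup>2)"
  proof (rule integrable_cong_AE_imp[OF w])
    show "AE \<xi> in lborel. (1 + \<xi>\<^sup>2) powr s * (cmod (w \<xi>))\<^sup>2 = (1 + \<xi>\<^sup>2) powr s * (cmod (v \<xi>))\<^sup>2"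
      using is_fourier_L2_unique[OF h F G] by eventually_elim simp
  qed measurable
  show "(Hs_norm s h)\<^sup>2 = (LINT \<xi>|lborel. (1 + \<xi>\<^sup>2) powr s * (cmod (v \<xi>))\<^sup>2)"
    unfolding Hs_norm_def v_def[symmetric] by (simp add: integral_nonneg_AE)
qed

section \<open>Embedding into continuously differentiable functions\<close>

lemma has_real_derivative_integral_dominated:
  fixes k k' :: "real \<Rightarrow> 'a \<Rightarrow> real"
  assumes ik: "\<And>x. integrable M (k x)" and m: "\<And>x. k' x \<in> borel_measurable M"
    and d: "\<And>x y. ((\<lambda>x. k x y) has_real_derivative k' x y) (at x)"
    and b: "\<And>x y. \<bar>k' x y\<bar> \<le> w y" and w: "integrable M w"
  shows "((\<lambda>x. LINT y|M. k x y) has_real_derivative (LINT y|M. k' x y)) (at x)"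
  unfolding has_field_derivative_iff tendsto_at_iff_sequentially comp_def
proof (intro allI impI)
  fix X :: "nat \<Rightarrow> real" assume X: "\<forall>i. X i \<in> UNIV - {x}" "X \<longlonglongrightarrow> x"
  have "(\<lambda>n. LINT y|M. (k (X n) y - k x y) / (X n - x)) \<longlonglongrightarrow> (LINT y|M. k' x y)"
  proof (rule integral_dominated_convergence[OF m _ w])
    show "(\<lambda>y. (k (X n) y - k x y) / (X n - x)) \<in> borel_measurable M" for n
      using borel_measurable_integrable[OF ik[of "X n"]] borel_measurable_integrable[OF ik[of x]]
      by measurable
    show "AE y in M. (\<lambda>n. (k (X n) y - k x y) / (X n - x)) \<longlonglongrightarrow> k' x y"
      using d[of _ x] X unfolding has_field_derivative_iff tendsto_at_iff_sequentially comp_def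
      by blast
    show "AE y in M. norm ((k (X n) y - k x y) / (X n - x)) \<le> w y" for n
    proof (rule AE_I2)
      fix y
      have "norm (k (X n) y - k x y) \<le> w y * norm (X n - x)"
        by (rule field_differentiable_bound[of UNIV "\<lambda>x. k x y" "\<lambda>x. k' x y"])
          (use d b in auto)
      then show "norm ((k (X n) y - k x y) / (X n - x)) \<le> w y"
        using X(1) by (simp add: field_simps)
    qed
  qed
  moreover have "(LINT y|M. (k (X n) y - k x y) / (X n - x))
      = ((LINT y|M. k (X n) y) - (LINT y|M. k x y)) / (X n - x)" for n
    using Bochner_Integration.integral_diff[OF ik[of "X n"] ik[of x]]
    by (simp only: integral_divide_zero)
  ultimately show "(\<lambda>n. ((LINT y|M. k (X n) y) - (LINT y|M. k x y)) / (X n - x)) \<longlonglongrightarrow> (LINT y|M. k' x y)"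
    by (simp only:)
qed

text \<open>\<open>h\<close> and its derivative are inverse Fourier integrals dominated by
  \<open>(1 + \<bar>\<xi>\<bar>) * cmod (v \<xi>)\<close>. Young's inequality with a parameter
  \<kappa> takes the place of Cauchy-Schwarz; the second integral is finite because
  \<open>1 - s < - 1/2\<close>. Leaving \<kappa> free lets a small norm yield a small
  supremum.\<close>

lemma Hs_embedding_C1:
  fixes h :: "real \<Rightarrow> real"
  assumes s: "s > 3/2" and h: "h \<in> Hs s" and ct: "continuous_on UNIV h"
  obtains h' where "\<And>x. (h has_real_derivative h' x) (at x)" "continuous_on UNIV h'"
    "\<And>\<kappa> x. \<kappa> > 0 \<Longrightarrow> \<bar>h x\<bar> + \<bar>h' x\<bar> \<le>
      ((Hs_norm s h)\<^sup>2 / \<kappa> + \<kappa> * (LINT \<xi>|lborel. 2 * (1 + \<xi>\<^sup>2) powr (1 - s))) / 2"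
proof -
  define v where "v = (SOME v. is_fourier_L2 h v)"
  note cf = Hs_canonical_fourier[OF h, folded v_def]
  have h'[measurable]: "h \<in> borel_measurable borel" and h2: "integrable lborel (\<lambda>x. (h x)\<^sup>2)"
    using h by (auto simp: Hs_def)
  have [measurable]: "v \<in> borel_measurable borel"
    using cf(1) by (auto simp: is_fourier_L2_def)
  define W where "W \<xi> = (1 + \<bar>\<xi>\<bar>) * cmod (v \<xi>)" for \<xi>
  define I where "I = (LINT \<xi>|lborel. 2 * (1 + \<xi>\<^sup>2) powr (1 - s))"
  define Z where "Z \<kappa> \<xi> = ((1 + \<xi>\<^sup>2) powr s * (cmod (v \<xi>))\<^sup>2 / \<kappa> + \<kappa> * (2 * (1 + \<xi>\<^sup>2) powr (1 - s))) / 2" for \<kappa> \<xi>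
  have WZ: "W \<xi> \<le> Z \<kappa> \<xi>" if "\<kappa> > 0" for \<kappa> \<xi>
  proof -
    \<comment> \<open>The factors \<open>(1 + \<xi>\<^sup>2) powr (s/2)\<close> and
      \<open>sqrt \<kappa>\<close> are inserted and cancelled, so that
      \<open>a * b = W \<xi>\<close>.\<close>
    define a where "a = (1 + \<xi>\<^sup>2) powr (s/2) * cmod (v \<xi>) / sqrt \<kappa>"
    define b where "b = sqrt \<kappa> * ((1 + \<bar>\<xi>\<bar>) * (1 + \<xi>\<^sup>2) powr (- (s/2)))"
    have p: "1 + \<xi>\<^sup>2 > 0" by (rule add_pos_nonneg) auto
    have sq: "((1 + \<xi>\<^sup>2) powr (r/2))\<^sup>2 = (1 + \<xi>\<^sup>2) powr r" for r
      using p by (simp add: power2_eq_square flip: powr_add)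
    have "W \<xi> = a * b"
      using p that by (simp add: a_def b_def W_def powr_minus)
    also have "\<dots> \<le> (a\<^sup>2 + b\<^sup>2) / 2" by (rule mult_le_half_squares)
    also have "a\<^sup>2 = (1 + \<xi>\<^sup>2) powr s * (cmod (v \<xi>))\<^sup>2 / \<kappa>"
      using that by (simp add: a_def power_mult_distrib power_divide sq)
    also have "b\<^sup>2 = \<kappa> * ((1 + \<bar>\<xi>\<bar>)\<^sup>2 * (1 + \<xi>\<^sup>2) powr (- s))"
      using that sq[of "-s"] by (simp add: b_def power_mult_distrib)
    also have "\<dots> \<le> \<kappa> * ((2 * (1 + \<xi>\<^sup>2)) * (1 + \<xi>\<^sup>2) powr (- s))"
      using that mult_le_half_squares[of 1 "\<bar>\<xi>\<bar>"]
      by (intro mult_left_mono mult_right_mono) (auto simp: power2_eq_square algebra_simps)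
    also have "(2 * (1 + \<xi>\<^sup>2)) * (1 + \<xi>\<^sup>2) powr (- s) = 2 * (1 + \<xi>\<^sup>2) powr (1 - s)"
      using p by (simp add: powr_diff powr_minus field_simps)
    finally show ?thesis by (simp add: Z_def)
  qed
  have iZ: "integrable lborel (Z \<kappa>)" for \<kappa>
    using cf(2) integrable_bracket_powr[of "s - 1"] s unfolding Z_def[abs_def]
    by (auto intro!: Bochner_Integration.integrable_add integrable_divide)
  have intZ: "(LINT \<xi>|lborel. Z \<kappa> \<xi>) = ((Hs_norm s h)\<^sup>2 / \<kappa> + \<kappa> * I) / 2" for \<kappa>
    using cf(2) integrable_bracket_powr[of "s - 1"] s unfolding Z_def[abs_def] I_def cf(3)
    by (subst integral_divide_zero, subst Bochner_Integration.integral_add) auto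
  have [measurable]: "W \<in> borel_measurable borel" unfolding W_def[abs_def] by measurable
  have W0: "W \<xi> \<ge> 0" for \<xi> by (simp add: W_def)
  have iW: "integrable lborel W"
    by (rule Bochner_Integration.integrable_bound[OF iZ[of 1]])
      (use WZ[of 1] W0 in \<open>auto intro: order_trans[OF _ abs_ge_self]\<close>)
  have iv: "integrable lborel v"
    by (rule Bochner_Integration.integrable_bound[OF iW]) (auto simp: W_def algebra_simps)
  \<comment> \<open>As \<open>h\<close> is real, only the real part of the inversion integral
    matters; \<open>k'\<close> is the x-derivative of this real integrand.\<close>
  define k where "k x \<xi> = Re (v \<xi> * cis (x * \<xi>))" for x \<xi>
  define k' where "k' x \<xi> = - \<xi> * Im (v \<xi> * cis (x * \<xi>))" for x \<xi>
  have [measurable]: "k x \<in> borel_measurable borel" "k' x \<in> borel_measurable borel" for x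
    unfolding k_def[abs_def] k'_def[abs_def] by measurable
  have cv: "cmod (v \<xi> * cis (x * \<xi>)) = cmod (v \<xi>)" for x \<xi> by (simp add: norm_mult)
  have kb: "\<bar>k x \<xi>\<bar> \<le> cmod (v \<xi>)" for x \<xi>
    using abs_Re_le_cmod[of "v \<xi> * cis (x * \<xi>)"] unfolding cv k_def .
  have kb': "\<bar>k' x \<xi>\<bar> \<le> \<bar>\<xi>\<bar> * cmod (v \<xi>)" for x \<xi>
    using mult_left_mono[OF abs_Im_le_cmod[of "v \<xi> * cis (x * \<xi>)"], of "\<bar>\<xi>\<bar>"]
    unfolding cv k'_def abs_mult by simp
  have kW: "\<bar>k x \<xi>\<bar> + \<bar>k' x \<xi>\<bar> \<le> W \<xi>" for x \<xi>
    using kb[of x \<xi>] kb'[of x \<xi>] by (simp add: W_def algebra_simps)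
  have ik: "integrable lborel (k x)" "integrable lborel (k' x)" for x
    by (rule Bochner_Integration.integrable_bound[OF iW], measurable,
      use kW[of x] in \<open>auto simp: W0 intro!: AE_I2 order_trans[OF _ kW[of x]]\<close>)+
  define h' where "h' x = 1 / sqrt (2 * pi) * (LINT \<xi>|lborel. k' x \<xi>)" for x
  have hk: "h x = 1 / sqrt (2 * pi) * (LINT \<xi>|lborel. k x \<xi>)" for x
  proof -
    have "isCont h x" using ct by (simp add: continuous_on_eq_continuous_at)
    from fourier_inversion[OF _ h2 cf(1) iv this] have
      "complex_of_real (h x) = complex_of_real (1 / sqrt (2 * pi)) * (LINT \<xi>|lborel. v \<xi> * cis (x * \<xi>))" by simp
    from arg_cong[OF this, of Re] have "h x = 1 / sqrt (2 * pi) * Re (LINT \<xi>|lborel. v \<xi> * cis (x * \<xi>))"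
      by (simp add: Re_divide_of_real)
    moreover have "integrable lborel (\<lambda>\<xi>. v \<xi> * cis (x * \<xi>))"
      by (rule Bochner_Integration.integrable_bound[OF iv]) (auto simp: norm_mult)
    ultimately show ?thesis by (simp only: k_def integral_Re)
  qed
  have pi1: "\<bar>1 / sqrt (2 * pi)\<bar> \<le> 1"
    using pi_gt3 by (auto simp: field_simps real_le_rsqrt)
  show ?thesis
  proof (rule that[of h'])
    show "(h has_real_derivative h' x) (at x)" for x
    proof -
      have "((\<lambda>x. LINT \<xi>|lborel. k x \<xi>) has_real_derivative (LINT \<xi>|lborel. k' x \<xi>)) (at x)"
      proof (rule has_real_derivative_integral_dominated[OF ik(1) _ _ _ iW])
        show "((\<lambda>x. k x y) has_real_derivative k' x y) (at x)" for x y
          unfolding k_def k'_def by (auto intro!: derivative_eq_intros simp: algebra_simps)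
        show "\<bar>k' x y\<bar> \<le> W y" for x y using kW[of x y] by linarith
      qed auto
      from DERIV_cmult[OF this, of "1 / sqrt (2 * pi)"] show ?thesis
        unfolding h'_def hk[abs_def] by simp
    qed
    show "continuous_on UNIV h'"
      unfolding h'_def[abs_def]
    proof (intro continuous_intros continuous_on_integral_dominated[OF _ iW])
      show "norm (k' x y) \<le> W y" for x y using kW[of x y] by simp
      show "continuous_on UNIV (\<lambda>x. k' x y)" for y
        unfolding k'_def by (intro continuous_intros)
    qed auto
    show "\<bar>h x\<bar> + \<bar>h' x\<bar> \<le> ((Hs_norm s h)\<^sup>2 / \<kappa> + \<kappa> * (LINT \<xi>|lborel. 2 * (1 + \<xi>\<^sup>2) powr (1 - s))) / 2" if "\<kappa> > 0" for \<kappa> x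
    proof -
      have "\<bar>h x\<bar> + \<bar>h' x\<bar> = \<bar>1 / sqrt (2 * pi)\<bar> * (\<bar>LINT \<xi>|lborel. k x \<xi>\<bar> + \<bar>LINT \<xi>|lborel. k' x \<xi>\<bar>)"
        unfolding h'_def hk by (simp add: abs_mult algebra_simps)
      also have "\<dots> \<le> 1 * (\<bar>LINT \<xi>|lborel. k x \<xi>\<bar> + \<bar>LINT \<xi>|lborel. k' x \<xi>\<bar>)"
        by (intro mult_right_mono pi1) auto
      also have "\<dots> \<le> (LINT \<xi>|lborel. \<bar>k x \<xi>\<bar>) + (LINT \<xi>|lborel. \<bar>k' x \<xi>\<bar>)"
        unfolding mult_1 by (intro add_mono integral_abs_bound)
      also have "\<dots> = (LINT \<xi>|lborel. \<bar>k x \<xi>\<bar> + \<bar>k' x \<xi>\<bar>)"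
        using ik by simp
      also have "\<dots> \<le> (LINT \<xi>|lborel. Z \<kappa> \<xi>)"
        using ik by (intro integral_mono iZ order_trans[OF kW WZ[OF that]]) auto
      finally show ?thesis unfolding intZ I_def .
    qed
  qed
qed

section \<open>Joint continuity and uniform bounds for curves in Sobolev space\<close>

lemma continuous_on_uniform_fst:
  fixes w :: "real \<Rightarrow> real \<Rightarrow> real"
  assumes u: "\<And>t e. t \<in> S \<Longrightarrow> e > 0 \<Longrightarrow> \<forall>\<^sub>F \<tau> in at t within S. \<forall>x. \<bar>w \<tau> x - w t x\<bar> \<le> e"
    and c: "\<And>t. t \<in> S \<Longrightarrow> continuous_on UNIV (w t)"
  shows "continuous_on (S \<times> UNIV) (\<lambda>(t, x). w t x)"
  unfolding continuous_on_iff
proof (intro ballI allI impI)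
  fix z :: "real \<times> real" and e :: real assume "z \<in> S \<times> UNIV" "e > 0"
  then obtain t x where z: "z = (t, x)" "t \<in> S" by auto
  from u[OF z(2), of "e/3"] \<open>e > 0\<close> obtain d1 where d1: "d1 > 0"
    "\<And>\<tau> x. \<tau> \<in> S \<Longrightarrow> \<tau> \<noteq> t \<Longrightarrow> dist \<tau> t < d1 \<Longrightarrow> \<bar>w \<tau> x - w t x\<bar> \<le> e/3"
    unfolding eventually_at by auto
  from c[OF z(2)] \<open>e > 0\<close> obtain d2 where d2: "d2 > 0" "\<And>y. dist y x < d2 \<Longrightarrow> \<bar>w t y - w t x\<bar> < e/3"
    unfolding continuous_on_iff dist_real_def by (metis UNIV_I zero_less_divide_iff zero_less_numeral)
  show "\<exists>d>0. \<forall>z'\<in>S \<times> UNIV. dist z' z < d \<longrightarrow> dist (case z' of (t, x) \<Rightarrow> w t x) (case z of (t, x) \<Rightarrow> w t x) < e"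
  proof (intro exI[of _ "min d1 d2"] conjI ballI impI)
    fix z' :: "real \<times> real" assume "z' \<in> S \<times> UNIV" and *: "dist z' z < min d1 d2"
    then obtain \<tau> y where z': "z' = (\<tau>, y)" "\<tau> \<in> S" by auto
    have "dist \<tau> t < d1" "dist y x < d2"
      using * dist_fst_le[of z' z] dist_snd_le[of z' z] unfolding z' z by auto
    then have "\<bar>w \<tau> y - w t y\<bar> \<le> e/3" "\<bar>w t y - w t x\<bar> < e/3"
      using d1(2)[OF z'(2), of y] d2(2)[of y] \<open>e > 0\<close> by (cases "\<tau> = t"; simp)+
    then show "dist (case z' of (t, x) \<Rightarrow> w t x) (case z of (t, x) \<Rightarrow> w t x) < e"
      unfolding z' z prod.case dist_real_def using \<open>e > 0\<close> by linarith
  qed (use d1 d2 in auto)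
qed

text \<open>For quantities whose continuity in time is not at hand: a finite subcover suffices, the
  sum of absolute values standing for the maximum.\<close>

lemma locally_bounded_imp_bounded_compact:
  fixes N :: "'a::metric_space \<Rightarrow> real"
  assumes "compact S"
    and l: "\<And>t. t \<in> S \<Longrightarrow> \<exists>B d. d > 0 \<and> (\<forall>\<tau>\<in>S. dist \<tau> t < d \<longrightarrow> N \<tau> \<le> B)"
  shows "\<exists>M. \<forall>t\<in>S. N t \<le> M"
proof -
  from l obtain B d where d: "\<And>t. t \<in> S \<Longrightarrow> d t > 0"
    "\<And>t \<tau>. t \<in> S \<Longrightarrow> \<tau> \<in> S \<Longrightarrow> dist \<tau> t < d t \<Longrightarrow> N \<tau> \<le> B t"
    by metis
  have "S \<subseteq> (\<Union>t\<in>S. ball t (d t))" using d(1) by force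
  then obtain D where D: "D \<subseteq> S" "finite D" "S \<subseteq> (\<Union>t\<in>D. ball t (d t))"
    using compactE_image[OF assms(1), of S "\<lambda>t. ball t (d t)"] by auto
  have "N t \<le> (\<Sum>\<tau>\<in>D. \<bar>B \<tau>\<bar>)" if "t \<in> S" for t
  proof -
    from D(3) that obtain \<tau> where \<tau>: "\<tau> \<in> D" "dist t \<tau> < d \<tau>" by (auto simp: dist_commute)
    then have "N t \<le> \<bar>B \<tau>\<bar>" using d(2)[of \<tau> t] D(1) that by fastforce
    also have "\<dots> \<le> (\<Sum>\<tau>\<in>D. \<bar>B \<tau>\<bar>)" by (rule member_le_sum) (use \<tau> D in auto)
    finally show ?thesis .
  qed
  then show ?thesis by blast
qed

lemma C0_Hs_regularity:
  fixes u :: "real \<Rightarrow> real \<Rightarrow> real"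
  assumes s: "s > 3/2" and C0: "C0_Hs T s u" and ct: "\<And>t. t \<in> {0..T} \<Longrightarrow> continuous_on UNIV (u t)"
  shows "\<And>t x. t \<in> {0..T} \<Longrightarrow> (u t has_real_derivative deriv (u t) x) (at x)"
    and "continuous_on ({0..T} \<times> UNIV) (\<lambda>(t, x). u t x)"
    and "continuous_on ({0..T} \<times> UNIV) (\<lambda>(t, x). deriv (u t) x)"
    and "\<exists>M. \<forall>t\<in>{0..T}. \<forall>x. \<bar>u t x\<bar> + \<bar>deriv (u t) x\<bar> \<le> M"
proof -
  define I where "I = (LINT \<xi>|lborel. 2 * (1 + \<xi>\<^sup>2) powr (1 - s))"
  have I0: "I \<ge> 0" unfolding I_def by (intro integral_nonneg_AE) auto
  have emb: "(h has_real_derivative deriv h x) (at x)" "continuous_on UNIV (deriv h)"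
     "\<kappa> > 0 \<Longrightarrow> \<bar>h x\<bar> + \<bar>deriv h x\<bar> \<le> ((Hs_norm s h)\<^sup>2 / \<kappa> + \<kappa> * I) / 2"
    if hh: "h \<in> Hs s" "continuous_on UNIV h" for h x \<kappa>
  proof -
    obtain h' where h': "\<And>x. (h has_real_derivative h' x) (at x)" "continuous_on UNIV h'"
      "\<And>\<kappa> x. \<kappa> > 0 \<Longrightarrow> \<bar>h x\<bar> + \<bar>h' x\<bar> \<le> ((Hs_norm s h)\<^sup>2 / \<kappa> + \<kappa> * I) / 2"
      using Hs_embedding_C1[OF s hh] unfolding I_def by blast
    have [simp]: "deriv h = h'" using h'(1) by (intro ext DERIV_imp_deriv)
    show "(h has_real_derivative deriv h x) (at x)" "continuous_on UNIV (deriv h)"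
      "\<kappa> > 0 \<Longrightarrow> \<bar>h x\<bar> + \<bar>deriv h x\<bar> \<le> ((Hs_norm s h)\<^sup>2 / \<kappa> + \<kappa> * I) / 2"
      using h' by auto
  qed
  have mem: "u t \<in> Hs s" if "t \<in> {0..T}" for t using C0 that by (auto simp: C0_Hs_def)
  show der: "(u t has_real_derivative deriv (u t) x) (at x)" if "t \<in> {0..T}" for t x
    using emb(1) mem ct that by blast
  have unif: "\<forall>\<^sub>F \<tau> in at t within {0..T}. \<forall>x. \<bar>u \<tau> x - u t x\<bar> + \<bar>deriv (u \<tau>) x - deriv (u t) x\<bar> \<le> e"
    if t: "t \<in> {0..T}" and e: "e > 0" for t e
  proof -
    \<comment> \<open>This keeps \<open>\<kappa> * I\<close> at most \<open>e\<close>; the other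
      term falls below \<open>e\<close> once the squared norm is below \<open>e * \<kappa>\<close>.
      The added 1 covers \<open>I = 0\<close>.\<close>
    define \<kappa> where "\<kappa> = e / (I + 1)"
    have k: "\<kappa> > 0" "\<kappa> * I \<le> e" using e I0 by (auto simp: \<kappa>_def field_simps)
    have "((\<lambda>\<tau>. Hs_norm s (\<lambda>x. u \<tau> x - u t x)) \<longlongrightarrow> 0) (at t within {0..T})"
      using C0 t by (auto simp: C0_Hs_def)
    from tendsto_power[OF this, of 2] have sq: "((\<lambda>\<tau>. (Hs_norm s (\<lambda>x. u \<tau> x - u t x))\<^sup>2) \<longlongrightarrow> 0) (at t within {0..T})"
      by simp
    have "\<forall>\<^sub>F \<tau> in at t within {0..T}. (Hs_norm s (\<lambda>x. u \<tau> x - u t x))\<^sup>2 < e * \<kappa>"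
      using order_tendstoD(2)[OF sq, of "e * \<kappa>"] e k by simp
    moreover have "\<forall>\<^sub>F \<tau> in at t within {0..T}. \<tau> \<in> {0..T}"
      by (auto simp: eventually_at intro: exI[of _ 1])
    ultimately show ?thesis
    proof eventually_elim
      case (elim \<tau>)
      show ?case
      proof
        fix x
        let ?h = "\<lambda>x. u \<tau> x - u t x"
        have h: "?h \<in> Hs s" "continuous_on UNIV ?h"
          by (rule Hs_diff[OF mem[OF elim(2)] mem[OF t]])
            (rule continuous_on_diff[OF ct[OF elim(2)] ct[OF t]])
        have dd: "deriv ?h x = deriv (u \<tau>) x - deriv (u t) x"
          by (rule DERIV_imp_deriv[OF DERIV_diff[OF der[OF elim(2)] der[OF t]]])
        have "\<bar>?h x\<bar> + \<bar>deriv ?h x\<bar> \<le> ((Hs_norm s ?h)\<^sup>2 / \<kappa> + \<kappa> * I) / 2"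
          using emb(3)[OF h k(1)] .
        also have "\<dots> \<le> (e + e) / 2"
          using elim(1) k by (intro divide_right_mono add_mono) (simp_all add: divide_le_eq)
        finally show "\<bar>u \<tau> x - u t x\<bar> + \<bar>deriv (u \<tau>) x - deriv (u t) x\<bar> \<le> e" unfolding dd by simp
      qed
    qed
  qed
  show "continuous_on ({0..T} \<times> UNIV) (\<lambda>(t, x). u t x)"
  proof (rule continuous_on_uniform_fst)
    show "\<forall>\<^sub>F \<tau> in at t within {0..T}. \<forall>x. \<bar>u \<tau> x - u t x\<bar> \<le> e" if "t \<in> {0..T}" "e > 0" for t e
    proof (rule eventually_mono[OF unif[OF that]], rule allI)
      fix \<tau> x assume "\<forall>x. \<bar>u \<tau> x - u t x\<bar> + \<bar>deriv (u \<tau>) x - deriv (u t) x\<bar> \<le> e"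
      from spec[OF this, of x] show "\<bar>u \<tau> x - u t x\<bar> \<le> e" by linarith
    qed
  qed (use ct in auto)
  show "continuous_on ({0..T} \<times> UNIV) (\<lambda>(t, x). deriv (u t) x)"
  proof (rule continuous_on_uniform_fst)
    show "\<forall>\<^sub>F \<tau> in at t within {0..T}. \<forall>x. \<bar>deriv (u \<tau>) x - deriv (u t) x\<bar> \<le> e" if "t \<in> {0..T}" "e > 0" for t e
    proof (rule eventually_mono[OF unif[OF that]], rule allI)
      fix \<tau> x assume "\<forall>x. \<bar>u \<tau> x - u t x\<bar> + \<bar>deriv (u \<tau>) x - deriv (u t) x\<bar> \<le> e"
      from spec[OF this, of x] show "\<bar>deriv (u \<tau>) x - deriv (u t) x\<bar> \<le> e" by linarith
    qed
    show "continuous_on UNIV (deriv (u t))" if "t \<in> {0..T}" for t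
      using emb(2) mem ct that by blast
  qed
  define B where "B t = ((Hs_norm s (u t))\<^sup>2 / 1 + 1 * I) / 2" for t
  have uB: "\<bar>u t x\<bar> + \<bar>deriv (u t) x\<bar> \<le> B t" if "t \<in> {0..T}" for t x
    unfolding B_def by (rule emb(3)) (use mem ct that in auto)
  \<comment> \<open>The bound \<open>B t\<close> serves only at a fixed time; nearby slices differ
    from that slice by at most 1, which bounds the suprema \<open>N\<close> locally by
    \<open>B t + 1\<close>.\<close>
  define N where "N t = (SUP x. \<bar>u t x\<bar> + \<bar>deriv (u t) x\<bar>)" for t
  have "\<exists>M. \<forall>t\<in>{0..T}. N t \<le> M"
  proof (rule locally_bounded_imp_bounded_compact)
    fix t assume t: "t \<in> {0..T}"
    from unif[OF this, of 1] obtain d where d: "d > 0"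
      "\<And>\<tau> x. \<tau> \<in> {0..T} \<Longrightarrow> \<tau> \<noteq> t \<Longrightarrow> dist \<tau> t < d \<Longrightarrow> \<bar>u \<tau> x - u t x\<bar> + \<bar>deriv (u \<tau>) x - deriv (u t) x\<bar> \<le> 1"
      unfolding eventually_at by auto
    have "N \<tau> \<le> B t + 1" if \<tau>: "\<tau> \<in> {0..T}" "dist \<tau> t < d" for \<tau>
      unfolding N_def
    proof (rule cSUP_least)
      show "\<bar>u \<tau> x\<bar> + \<bar>deriv (u \<tau>) x\<bar> \<le> B t + 1" for x
        using uB[OF t, of x] d(2)[OF \<tau>(1) _ \<tau>(2), of x] by (cases "\<tau> = t"; simp)
    qed auto
    then show "\<exists>B d. d > 0 \<and> (\<forall>\<tau>\<in>{0..T}. dist \<tau> t < d \<longrightarrow> N \<tau> \<le> B)"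
      using d(1) by blast
  qed auto
  moreover have "\<bar>u t x\<bar> + \<bar>deriv (u t) x\<bar> \<le> N t" if "t \<in> {0..T}" for t x
    unfolding N_def by (rule cSUP_upper) (use uB[OF that] in \<open>auto intro!: bdd_aboveI\<close>)
  ultimately show "\<exists>M. \<forall>t\<in>{0..T}. \<forall>x. \<bar>u t x\<bar> + \<bar>deriv (u t) x\<bar> \<le> M"
    by (meson order_trans)
qed

section \<open>A maximum principle for transport equations\<close>

text \<open>The term \<open>\<eta> * sqrt (1 + x\<^sup>2)\<close> forces a first violation of the bound to happen at a
  finite point, where the \<open>x\<close>-derivative is at most \<open>\<eta>\<close>.\<close>

lemma transport_maximum_principle:
  fixes y yt yx :: "real \<Rightarrow> real \<Rightarrow> real" and m M :: "real \<Rightarrow> real"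
  assumes A: "A \<ge> 0" and cont: "continuous_on ({0..T} \<times> UNIV) (\<lambda>(t, x). y t x)"
    and bd: "\<And>t x. t \<in> {0..T} \<Longrightarrow> y t x \<le> Y"
    and dt: "\<And>t x. t \<in> {0..T} \<Longrightarrow> ((\<lambda>\<tau>. y \<tau> x) has_real_derivative yt t x) (at t within {0..T})"
    and dx: "\<And>t x. t \<in> {0..T} \<Longrightarrow> (y t has_real_derivative yx t x) (at x)"
    and ineq: "\<And>t x. t \<in> {0..T} \<Longrightarrow> yt t x \<le> A * \<bar>yx t x\<bar> + m t"
    and M: "\<And>t. t \<in> {0..T} \<Longrightarrow> (M has_real_derivative m t) (at t within {0..T})"
    and init: "\<And>x. y 0 x \<le> M 0"
    and t: "t \<in> {0..T}"
  shows "y t x \<le> M t"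
proof -
  \<comment> \<open>The 1 makes the inequality strict at time 0; the slope \<open>A + 1\<close> pays
    for the drift, which is at most \<open>A * \<eta>\<close>, and leaves \<eta> to spare.\<close>
  have key: "y t x < M t + \<eta> * (1 + (A + 1) * t + sqrt (1 + x\<^sup>2))" if \<eta>: "\<eta> > 0" and t: "t \<in> {0..T}" for \<eta> t x
  proof (rule ccontr)
    assume neg: "\<not> ?thesis"
    define Z where "Z t x = y t x - (M t + \<eta> * (1 + (A + 1) * t + sqrt (1 + x\<^sup>2)))" for t x
    \<comment> \<open>The set of violations is compact: closed by continuity, and bounded in x
      because \<open>y\<close> is bounded above and \<open>M\<close> below while the barrier grows
      linearly. Hence there is a violation of least time.\<close>
    define S where "S = ({0..T} \<times> UNIV) \<inter> {z. case z of (t, x) \<Rightarrow> Z t x \<ge> 0}"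
    have Mc: "continuous_on {0..T} M"
      unfolding continuous_on_eq_continuous_within by (intro ballI DERIV_continuous[OF M])
    have Zc: "continuous_on ({0..T} \<times> UNIV) (\<lambda>(t, x). Z t x)"
      unfolding Z_def case_prod_beta
      by (intro continuous_intros continuous_on_compose2[OF Mc] cont[unfolded case_prod_beta]) auto
    obtain L where L: "\<And>t. t \<in> {0..T} \<Longrightarrow> L \<le> M t"
    proof (cases "{0..T} = {}")
      case False
      then obtain r where "\<forall>t\<in>{0..T}. M r \<le> M t"
        using continuous_attains_inf[OF compact_Icc _ Mc] by blast
      then show ?thesis using that by blast
    qed auto
    have "S \<subseteq> {0..T} \<times> {- ((Y - L) / \<eta>)..(Y - L) / \<eta>}"
    proof safe
      fix t x assume "(t, x) \<in> S"
      then have tT: "t \<in> {0..T}" and Z: "Z t x \<ge> 0" by (auto simp: S_def)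
      then show "t \<in> {0..T}" by simp
      have "\<bar>x\<bar> \<le> sqrt (1 + x\<^sup>2)" by (simp add: real_le_rsqrt)
      moreover have "0 \<le> (A + 1) * t" using A tT by simp
      ultimately have "\<eta> * \<bar>x\<bar> \<le> \<eta> * (1 + (A + 1) * t + sqrt (1 + x\<^sup>2))"
        using \<eta> by (intro mult_left_mono) auto
      also have "\<dots> \<le> Y - L" using Z bd[OF tT, of x] L[OF tT] by (simp add: Z_def)
      finally have "\<bar>x\<bar> \<le> (Y - L) / \<eta>" using \<eta> by (simp add: field_simps)
      then show "x \<in> {- ((Y - L) / \<eta>)..(Y - L) / \<eta>}" by auto
    qed
    then have "bounded S"
      by (rule bounded_subset[rotated]) (intro bounded_Times bounded_closed_interval)
    moreover have "closed S"
    proof -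
      have "closed (({0..T} \<times> UNIV) \<inter> (\<lambda>(t, x). Z t x) -` {0..})"
        by (rule continuous_closed_preimage[OF Zc]) (auto intro: closed_Times)
      moreover have "S = ({0..T} \<times> UNIV) \<inter> (\<lambda>(t, x). Z t x) -` {0..}"
        by (auto simp: S_def)
      ultimately show ?thesis by simp
    qed
    ultimately have "compact S" by (simp add: compact_eq_bounded_closed)
    moreover have "(t, x) \<in> S" using neg t by (auto simp: S_def Z_def)
    ultimately obtain z where z: "z \<in> S" "\<forall>w\<in>S. fst z \<le> fst w"
      using continuous_attains_inf[of S fst] by (force intro: continuous_intros)
    obtain \<tau> \<xi> where zz: "z = (\<tau>, \<xi>)" by force
    have \<tau>: "\<tau> \<in> {0..T}" and Z0: "Z \<tau> \<xi> \<ge> 0" using z(1) by (auto simp: S_def zz)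
    have before: "Z r w < 0" if "0 \<le> r" "r < \<tau>" for r w
    proof (rule ccontr)
      assume "\<not> ?thesis"
      then have "(r, w) \<in> S" using that \<tau> by (simp add: S_def)
      then show False using z(2) that by (auto simp: zz)
    qed
    have "Z 0 \<xi> < 0"
    proof -
      have "0 < \<eta> * (1 + sqrt (1 + \<xi>\<^sup>2))" using \<eta> by (intro mult_pos_pos add_pos_nonneg) auto
      then show ?thesis using init[of \<xi>] by (simp add: Z_def)
    qed
    then have \<tau>0: "\<tau> > 0" using Z0 \<tau> by (cases "\<tau> = 0") auto
    \<comment> \<open>No violation occurs before \<tau>, so the slice at \<tau> is at most 0 by
      continuity in time, and \<xi> is a global maximum of it.\<close>
    have Zle: "Z \<tau> w \<le> 0" for w
    proof (rule tendsto_upperbound)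
      have "continuous_on {0..T} (\<lambda>r. Z r w)"
      proof -
        have c: "continuous_on {0..T} (\<lambda>r. (r, w))" by (intro continuous_intros)
        from continuous_on_compose2[OF Zc c] show ?thesis by (simp add: image_subset_iff)
      qed
      then have "((\<lambda>r. Z r w) \<longlongrightarrow> Z \<tau> w) (at \<tau> within {0..T})"
        using \<tau> by (auto simp: continuous_on_def)
      from tendsto_within_subset[OF this, of "{0..\<tau>}"] \<tau>
      show "((\<lambda>r. Z r w) \<longlongrightarrow> Z \<tau> w) (at_left \<tau>)"
        unfolding at_within_Icc_at_left[OF \<tau>0] by auto
      show "\<forall>\<^sub>F r in at_left \<tau>. Z r w \<le> 0"
        using \<tau>0 before by (auto simp: eventually_at_left intro!: exI[of _ 0] less_imp_le)
    qed simp
    have p: "0 < 1 + \<xi>\<^sup>2" by (rule add_pos_nonneg) auto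
    have S: "((\<lambda>w. sqrt (1 + w\<^sup>2)) has_real_derivative \<xi> / sqrt (1 + \<xi>\<^sup>2)) (at \<xi>)"
      using p by (auto intro!: derivative_eq_intros simp: field_simps)
    have Zx: "(Z \<tau> has_real_derivative yx \<tau> \<xi> - \<eta> * (\<xi> / sqrt (1 + \<xi>\<^sup>2))) (at \<xi>)"
      unfolding Z_def[abs_def]
      by (rule DERIV_cong, (rule DERIV_diff DERIV_add DERIV_const DERIV_cmult dx[OF \<tau>] S)+) simp
    have "Z \<tau> \<xi> = 0" using Z0 Zle[of \<xi>] by simp
    then have "yx \<tau> \<xi> - \<eta> * (\<xi> / sqrt (1 + \<xi>\<^sup>2)) = 0"
      using DERIV_local_max[OF Zx, of 1] Zle by auto
    moreover have "\<bar>\<xi> / sqrt (1 + \<xi>\<^sup>2)\<bar> \<le> 1"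
      using p by (simp add: abs_divide real_le_rsqrt divide_le_eq)
    ultimately have yx: "\<bar>yx \<tau> \<xi>\<bar> \<le> \<eta>"
      using \<eta> mult_left_mono[of "\<bar>\<xi> / sqrt (1 + \<xi>\<^sup>2)\<bar>" 1 \<eta>] by (simp add: abs_mult)
    have "((\<lambda>r. Z r \<xi>) has_real_derivative yt \<tau> \<xi> - (m \<tau> + \<eta> * (A + 1))) (at \<tau> within {0..T})"
      unfolding Z_def by (auto intro!: derivative_eq_intros dt[OF \<tau>] M[OF \<tau>] simp: algebra_simps)
    then have Zt: "((\<lambda>r. Z r \<xi>) has_real_derivative yt \<tau> \<xi> - (m \<tau> + \<eta> * (A + 1))) (at \<tau> within {0..\<tau>})"
      by (rule has_field_derivative_subset) (use \<tau> in auto)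
    \<comment> \<open>The left side is at most
      \<open>A * \<eta> - (A + 1) * \<eta> = - \<eta>\<close>. A negative time derivative makes
      \<open>Z\<close> positive slightly earlier, against the minimality of \<tau>.\<close>
    have "yt \<tau> \<xi> - (m \<tau> + \<eta> * (A + 1)) < 0"
      using ineq[OF \<tau>, of \<xi>] mult_left_mono[OF yx A] \<eta> by (simp add: algebra_simps)
    from has_real_derivative_neg_dec_left[OF Zt this] obtain d where d: "d > 0"
      "\<And>h. h > 0 \<Longrightarrow> \<tau> - h \<in> {0..\<tau>} \<Longrightarrow> h < d \<Longrightarrow> Z \<tau> \<xi> < Z (\<tau> - h) \<xi>" by blast
    define h where "h = min (d/2) (\<tau>/2)"
    have h: "h > 0" "\<tau> - h \<in> {0..\<tau>}" "h < d" "\<tau> - h < \<tau>" "0 \<le> \<tau> - h"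
      using d(1) \<tau>0 by (auto simp: h_def min_def)
    show False using d(2)[OF h(1-3)] before[OF h(5,4), of \<xi>] Z0 by linarith
  qed
  show ?thesis
  proof (rule field_le_epsilon)
    fix e :: real assume "e > 0"
    define c where "c = 1 + (A + 1) * t + sqrt (1 + x\<^sup>2)"
    have "c > 0" using A t unfolding c_def by (intro add_pos_nonneg) auto
    then show "y t x \<le> M t + e" using key[of "e / c" t x] \<open>e > 0\<close> t by (simp add: c_def)
  qed
qed

section \<open>The kernel of the nonlocal term\<close>

lemma has_bochner_integral_exp_abs:
  fixes c :: real assumes "c > 0"
  shows "has_bochner_integral lborel (\<lambda>y. exp (- c * \<bar>x - y\<bar>)) (2 / c)"
proof -
  have "has_bochner_integral lborel (\<lambda>y. exp (- c * \<bar>y\<bar>)) (2 * (0 - (- exp (- c * 0) / c)))"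
  proof (rule has_bochner_integral_even_FTC[where Q = "\<lambda>x. - exp (- c * x) / c"])
    show "((\<lambda>x. - exp (- c * x) / c) \<longlongrightarrow> 0) at_top" using assms by real_asymp
  qed (use assms in \<open>auto intro!: derivative_eq_intros\<close>)
  then show ?thesis
    using lborel_has_bochner_integral_real_affine_iff[of "-1" "\<lambda>y. exp (- c * \<bar>y\<bar>)" "2 / c" x] assms
    by simp
qed

definition dx_green :: "real \<Rightarrow> real" where
  "dx_green x = - sgn x * green x"

lemma dx_inv_helmholtz_eq: "dx_inv_helmholtz h x = (LINT y|lborel. dx_green (x - y) * h y)"
  by (simp add: dx_inv_helmholtz_def conv_def dx_green_def)

lemma abs_dx_green_le: "\<bar>dx_green x\<bar> \<le> exp (- \<bar>x\<bar>) / 2"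
  by (simp add: dx_green_def green_def abs_mult sgn_real_def)

lemma measurable_dx_green[measurable]: "dx_green \<in> borel_measurable borel"
  unfolding dx_green_def[abs_def] green_def[abs_def] by measurable

text \<open>The jump of the kernel at 0 contributes the indicator.\<close>

lemma abs_dx_green_diff_le:
  assumes "\<delta> > 0" "\<delta> \<le> 1"
  shows "\<bar>dx_green (z + \<delta>) - dx_green z\<bar> \<le> 3/2 * \<delta> * exp (- \<bar>z\<bar>) + indicator {-\<delta>..0} z"
proof (cases "z \<in> {-\<delta>..0}")
  case True
  have "\<bar>dx_green w\<bar> \<le> 1/2" for w
  proof -
    have "exp (- \<bar>w\<bar>) \<le> 1" by simp
    then show ?thesis using abs_dx_green_le[of w] by linarith
  qed
  from this[of "z + \<delta>"] this[of z] have "\<bar>dx_green (z + \<delta>) - dx_green z\<bar> \<le> 1" by linarith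
  then show ?thesis using True assms by (simp add: add_increasing)
next
  case False
  have e1: "\<bar>exp (s * \<delta>) - 1\<bar> \<le> 3 * \<delta>" if "\<bar>s\<bar> = 1" for s :: real
  proof -
    have "norm (exp (s * \<delta>) - exp 0) \<le> exp 1 * norm (s * \<delta> - 0)"
    proof (rule field_differentiable_bound[of "{-1..1}" exp exp])
      show "norm (exp z) \<le> exp (1::real)" if "z \<in> {-1..1}" for z :: real using that by simp
    qed (use that assms in \<open>auto intro!: derivative_eq_intros simp: abs_if split: if_splits\<close>)
    also have "\<dots> \<le> 3 * \<delta>"
      using that assms exp_le by (intro mult_mono) (auto simp: abs_mult)
    finally show ?thesis by simp
  qed
  show ?thesis
  proof (cases "z > 0")
    case True
    have "exp (- (z + \<delta>)) = exp (- z) * exp (- 1 * \<delta>)" by (simp flip: exp_add)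
    then have eq: "dx_green (z + \<delta>) - dx_green z = - (exp (-z) / 2) * (exp (- 1 * \<delta>) - 1)"
      using True assms by (simp add: dx_green_def green_def field_simps)
    have "\<bar>dx_green (z + \<delta>) - dx_green z\<bar> = (exp (-z) / 2) * \<bar>exp (-1 * \<delta>) - 1\<bar>" unfolding eq by (simp add: abs_mult)
    also have "\<dots> \<le> (exp (-z) / 2) * (3 * \<delta>)" by (intro mult_left_mono e1) auto
    finally show ?thesis using True by (simp add: mult_ac)
  next
    case F: False
    with False assms have z: "z < 0" "z + \<delta> < 0" by auto
    have eq: "dx_green (z + \<delta>) - dx_green z = (exp z / 2) * (exp (1 * \<delta>) - 1)"
      using z by (simp add: dx_green_def green_def algebra_simps exp_add)
    have "\<bar>dx_green (z + \<delta>) - dx_green z\<bar> = (exp z / 2) * \<bar>exp (1 * \<delta>) - 1\<bar>" unfolding eq by (simp add: abs_mult)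
    also have "\<dots> \<le> (exp z / 2) * (3 * \<delta>)" by (intro mult_left_mono e1) auto
    finally show ?thesis using z by (simp add: mult_ac)
  qed
qed

section \<open>Weighted estimates\<close>

text \<open>The sign \<open>\<sigma>\<close> makes the setting stable under \<open>t \<mapsto> t\<^sub>0 - t\<close> and under \<open>x \<mapsto> - x\<close>,
  which both turn the equation into the one with \<open>- \<sigma>\<close>.\<close>

locale transport =
  fixes f1 f2 g :: "real \<Rightarrow> real" and T \<sigma> L b :: real and u p :: "real \<Rightarrow> real \<Rightarrow> real"
  assumes \<sigma>: "\<bar>\<sigma>\<bar> = 1" and L: "L > 0" and b: "b \<ge> 0"
    and f1_cont: "continuous_on UNIV f1" and f2_cont: "continuous_on UNIV f2" and g_cont: "continuous_on UNIV g"
    and f1_le: "\<And>v. \<bar>v\<bar> \<le> b \<Longrightarrow> \<bar>f1 v\<bar> \<le> L * \<bar>v\<bar>"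
    and f1_lip: "\<And>v w. \<bar>v\<bar> \<le> b \<Longrightarrow> \<bar>w\<bar> \<le> b \<Longrightarrow> \<bar>f1 v - f1 w\<bar> \<le> L * \<bar>v - w\<bar>"
    and f2_nonneg: "\<And>v. f2 v \<ge> 0" and f2_le: "\<And>v. \<bar>v\<bar> \<le> b \<Longrightarrow> f2 v \<le> 2 * L"
    and g_nonneg: "\<And>v. g v \<ge> 0" and g_le: "\<And>v. \<bar>v\<bar> \<le> b \<Longrightarrow> g v \<le> L * \<bar>v\<bar>"
    and u_cont: "continuous_on ({0..T} \<times> UNIV) (\<lambda>(t, x). u t x)"
    and p_cont: "continuous_on ({0..T} \<times> UNIV) (\<lambda>(t, x). p t x)"
    and u_x: "\<And>t x. t \<in> {0..T} \<Longrightarrow> (u t has_real_derivative p t x) (at x)"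
    and u_bound: "\<And>t x. t \<in> {0..T} \<Longrightarrow> \<bar>u t x\<bar> + \<bar>p t x\<bar> \<le> b"
    and u_t: "\<And>t x. t \<in> {0..T} \<Longrightarrow> ((\<lambda>\<tau>. u \<tau> x) has_real_derivative
      - \<sigma> * (f1 (u t x) * p t x + dx_inv_helmholtz (\<lambda>y. g (u t y) + f2 (u t y) / 2 * (p t y)\<^sup>2) x))
      (at t within {0..T})"
begin

text \<open>The source of the nonlocal term. Its non-negativity is what gives the asymptotic profile
  a sign.\<close>

definition h :: "real \<Rightarrow> real \<Rightarrow> real" where
  "h t y = g (u t y) + f2 (u t y) / 2 * (p t y)\<^sup>2"

definition F :: "real \<Rightarrow> real \<Rightarrow> real" where
  "F t x = dx_inv_helmholtz (h t) x"

text \<open>One constant for both nonlinearities: it bounds \<open>h\<close> relative to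
  \<open>\<bar>u\<bar> + \<bar>p\<bar>\<close>, the part \<open>L * b\<close> coming from
  \<open>f2 / 2 * p\<^sup>2\<close>, and it also bounds the speed \<open>f1 u\<close>.\<close>

definition C :: real where "C = L * (1 + b)"

lemma C_pos: "C > 0" and Lb_le_C: "L * b \<le> C"
  using L b by (auto simp: C_def algebra_simps intro: add_pos_nonneg)

lemma u_t': "t \<in> {0..T} \<Longrightarrow>
   ((\<lambda>\<tau>. u \<tau> x) has_real_derivative - \<sigma> * (f1 (u t x) * p t x + F t x)) (at t within {0..T})"
  using u_t[of t x] unfolding F_def h_def[abs_def] .

lemma abs_u_le: "t \<in> {0..T} \<Longrightarrow> \<bar>u t x\<bar> \<le> b" and abs_p_le: "t \<in> {0..T} \<Longrightarrow> \<bar>p t x\<bar> \<le> b"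
  using u_bound[of t x] by linarith+

lemma h_cont: "continuous_on ({0..T} \<times> UNIV) (\<lambda>(t, x). h t x)"
  unfolding h_def case_prod_beta
  by (intro continuous_intros continuous_on_compose2[OF g_cont] continuous_on_compose2[OF f2_cont]
      u_cont[unfolded case_prod_beta] p_cont[unfolded case_prod_beta]) auto

lemma h_cont_x: "t \<in> {0..T} \<Longrightarrow> continuous_on UNIV (h t)"
proof -
  assume t: "t \<in> {0..T}"
  have c: "continuous_on UNIV (\<lambda>y::real. (t, y))" by (intro continuous_intros)
  from continuous_on_compose2[OF h_cont c] t show ?thesis by (auto simp: image_subset_iff)
qed

lemma measurable_h: "t \<in> {0..T} \<Longrightarrow> h t \<in> borel_measurable borel"
  by (rule borel_measurable_continuous_onI[OF h_cont_x])

lemma h_nonneg: "h t y \<ge> 0"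
  using g_nonneg f2_nonneg by (simp add: h_def)

lemma h_le: "t \<in> {0..T} \<Longrightarrow> h t y \<le> C * (\<bar>u t y\<bar> + \<bar>p t y\<bar>)"
proof -
  assume t: "t \<in> {0..T}"
  note bu = abs_u_le[OF t, of y] and bp = abs_p_le[OF t, of y]
  have "f2 (u t y) / 2 * (p t y)\<^sup>2 \<le> L * (b * \<bar>p t y\<bar>)"
  proof (rule mult_mono)
    show "(p t y)\<^sup>2 \<le> b * \<bar>p t y\<bar>"
      using mult_right_mono[OF bp, of "\<bar>p t y\<bar>"] by (simp add: power2_eq_square)
  qed (use f2_le[OF bu] L in auto)
  moreover have "0 \<le> L * b * \<bar>u t y\<bar>" "0 \<le> L * \<bar>p t y\<bar>" using L b by auto
  ultimately show ?thesis using g_le[OF bu] by (simp add: h_def C_def algebra_simps)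
qed

lemma h_bounded: "t \<in> {0..T} \<Longrightarrow> \<bar>h t y\<bar> \<le> C * b"
  using order_trans[OF h_le mult_left_mono[OF u_bound]] h_nonneg[of t y] C_pos by simp

lemma integrable_dx_green_h:
  assumes t: "t \<in> {0..T}"
  shows "integrable lborel (\<lambda>y. dx_green (x - y) * h t y)"
proof -
  have [measurable]: "h t \<in> borel_measurable borel" by (rule measurable_h[OF t])
  have "integrable lborel (\<lambda>y. exp (- 1 * \<bar>x - y\<bar>) * (C * b / 2))"
    using has_bochner_integral_exp_abs[of 1 x] by (auto simp: has_bochner_integral_iff)
  then show ?thesis
  proof (rule Bochner_Integration.integrable_bound)
    have "\<bar>dx_green (x - y)\<bar> * \<bar>h t y\<bar> \<le> exp (- \<bar>x - y\<bar>) / 2 * (C * b)" for y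
      by (intro mult_mono abs_dx_green_le h_bounded[OF t]) auto
    then show "AE y in lborel. norm (dx_green (x - y) * h t y) \<le> norm (exp (- 1 * \<bar>x - y\<bar>) * (C * b / 2))"
      using C_pos b by (auto simp: abs_mult)
  qed measurable
qed

text \<open>Moving the weight from x to y under the integral costs
  \<open>exp (3/4 * \<bar>x - y\<bar>)\<close>, which the decay of the kernel has to pay for;
  \<open>w\<close> is an integrable majorant of what remains.\<close>

lemma weighted_kernel_bound:
  assumes t: "t \<in> {0..T}" and k[measurable]: "k \<in> borel_measurable borel"
    and \<phi>: "\<And>x. \<phi> x > 0" "\<And>x y. \<phi> x \<le> exp (3/4 * \<bar>x - y\<bar>) * \<phi> y"
    and B: "\<And>y. \<phi> y * (\<bar>u t y\<bar> + \<bar>p t y\<bar>) \<le> B"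
    and w: "\<And>y. \<bar>k y\<bar> * exp (3/4 * \<bar>x - y\<bar>) \<le> w y" "has_bochner_integral lborel w I"
  shows "\<phi> x * \<bar>LINT y|lborel. k y * h t y\<bar> \<le> C * B * I"
proof -
  have [measurable]: "h t \<in> borel_measurable borel" by (rule measurable_h[OF t])
  have le: "\<phi> x * \<bar>k y * h t y\<bar> \<le> C * B * w y" for y
  proof -
    have "\<phi> x * \<bar>k y * h t y\<bar> = \<phi> x * (\<bar>k y\<bar> * h t y)" using h_nonneg by (simp add: abs_mult)
    also have "\<dots> \<le> (exp (3/4 * \<bar>x - y\<bar>) * \<phi> y) * (\<bar>k y\<bar> * h t y)"
      using h_nonneg by (intro mult_right_mono \<phi>) auto
    also have "\<dots> = (\<bar>k y\<bar> * exp (3/4 * \<bar>x - y\<bar>)) * (\<phi> y * h t y)" by simp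
    also have "\<dots> \<le> w y * (C * B)"
    proof (rule mult_mono[OF w(1)])
      have "\<phi> y * h t y \<le> \<phi> y * (C * (\<bar>u t y\<bar> + \<bar>p t y\<bar>))"
        using \<phi>(1)[of y] by (intro mult_left_mono h_le[OF t]) auto
      also have "\<dots> \<le> C * B" using mult_left_mono[OF B, of C y] C_pos by (simp add: algebra_simps)
      finally show "\<phi> y * h t y \<le> C * B" .
      show "0 \<le> w y" using w(1)[of y] by (rule order_trans[rotated]) auto
    qed (use \<phi>(1)[of y] h_nonneg in auto)
    finally show ?thesis by (simp add: mult_ac)
  qed
  have iw: "integrable lborel (\<lambda>y. C * B * w y)" using w(2) by (auto simp: has_bochner_integral_iff)
  have i1: "integrable lborel (\<lambda>y. \<phi> x * \<bar>k y * h t y\<bar>)"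
    by (rule Bochner_Integration.integrable_bound[OF iw])
      (use le \<phi>(1)[of x] in \<open>auto intro!: AE_I2 order_trans[OF le]\<close>)
  have "\<phi> x * \<bar>LINT y|lborel. k y * h t y\<bar> \<le> \<phi> x * (LINT y|lborel. \<bar>k y * h t y\<bar>)"
    using \<phi>(1)[of x] by (intro mult_left_mono integral_abs_bound) auto
  also have "\<dots> = (LINT y|lborel. \<phi> x * \<bar>k y * h t y\<bar>)" by simp
  also have "\<dots> \<le> (LINT y|lborel. C * B * w y)"
    by (rule integral_mono[OF i1 iw le])
  also have "\<dots> = C * B * I" using w(2) by (simp add: has_bochner_integral_iff)
  finally show ?thesis .
qed

text \<open>The kernel times the cost of moving the weight decays like
  \<open>exp (- \<bar>z\<bar> / 4)\<close>, whose integral is 8. The factor 1/2 of the kernel gives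
  4; for differences, \<open>3/2 * \<delta> * 8\<close> and the contribution
  \<open>3 * \<delta>\<close> of the jump add up to \<open>15 * \<delta>\<close>.\<close>

lemma weighted_F_bound:
  assumes t: "t \<in> {0..T}"
    and \<phi>: "\<And>x. \<phi> x > 0" "\<And>x y. \<phi> x \<le> exp (3/4 * \<bar>x - y\<bar>) * \<phi> y"
    and B: "\<And>y. \<phi> y * (\<bar>u t y\<bar> + \<bar>p t y\<bar>) \<le> B"
  shows "\<phi> x * \<bar>F t x\<bar> \<le> C * B * 4"
    and "0 < \<delta> \<Longrightarrow> \<delta> \<le> 1 \<Longrightarrow> \<phi> x * \<bar>F t (x + \<delta>) - F t x\<bar> \<le> C * B * (15 * \<delta>)"
proof -
  have e: "has_bochner_integral lborel (\<lambda>y. a * exp (- (1/4) * \<bar>x - y\<bar>)) (a * 8)" for a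
    using has_bochner_integral_mult_right[OF has_bochner_integral_exp_abs[of "1/4" x], of a] by simp
  have ee: "exp (- \<bar>x - y\<bar>) * exp (3/4 * \<bar>x - y\<bar>) = exp (- (1/4) * \<bar>x - y\<bar>)" for y
    unfolding exp_add[symmetric] by (rule arg_cong[of _ _ exp]) argo
  show "\<phi> x * \<bar>F t x\<bar> \<le> C * B * 4"
    unfolding F_def dx_inv_helmholtz_eq
  proof (rule weighted_kernel_bound[OF t _ \<phi> B])
    show "\<bar>dx_green (x - y)\<bar> * exp (3/4 * \<bar>x - y\<bar>) \<le> 1/2 * exp (- (1/4) * \<bar>x - y\<bar>)" for y
    proof -
      have "\<bar>dx_green (x - y)\<bar> * exp (3/4 * \<bar>x - y\<bar>) \<le> exp (- \<bar>x - y\<bar>) / 2 * exp (3/4 * \<bar>x - y\<bar>)"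
        by (intro mult_right_mono abs_dx_green_le) auto
      also have "\<dots> = 1/2 * exp (- (1/4) * \<bar>x - y\<bar>)"
        using ee[of y] by simp
      finally show ?thesis .
    qed
    show "has_bochner_integral lborel (\<lambda>y. 1/2 * exp (- (1/4) * \<bar>x - y\<bar>)) 4"
      using e[of "1/2"] by simp
  qed measurable
  assume \<delta>: "0 < \<delta>" "\<delta> \<le> 1"
  have "F t (x + \<delta>) - F t x = (LINT y|lborel. (dx_green (x + \<delta> - y) - dx_green (x - y)) * h t y)"
    unfolding F_def dx_inv_helmholtz_eq left_diff_distrib
    by (rule Bochner_Integration.integral_diff[symmetric]; rule integrable_dx_green_h[OF t])
  moreover have "\<phi> x * \<bar>LINT y|lborel. (dx_green (x + \<delta> - y) - dx_green (x - y)) * h t y\<bar> \<le> C * B * (15 * \<delta>)"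
  proof (rule weighted_kernel_bound[OF t _ \<phi> B])
    show "\<bar>dx_green (x + \<delta> - y) - dx_green (x - y)\<bar> * exp (3/4 * \<bar>x - y\<bar>)
      \<le> 3/2 * \<delta> * exp (- (1/4) * \<bar>x - y\<bar>) + 3 * indicator {x..x+\<delta>} y" for y
    proof -
      have ind: "indicator {-\<delta>..0} (x - y) = (indicator {x..x+\<delta>} y :: real)"
        by (auto simp: indicator_def)
      have "\<bar>dx_green (x - y + \<delta>) - dx_green (x - y)\<bar> * exp (3/4 * \<bar>x - y\<bar>)
        \<le> (3/2 * \<delta> * exp (- \<bar>x - y\<bar>) + indicator {x..x+\<delta>} y) * exp (3/4 * \<bar>x - y\<bar>)"
        using abs_dx_green_diff_le[OF \<delta>, of "x - y"] unfolding ind by (intro mult_right_mono) auto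
      also have "\<dots> = 3/2 * \<delta> * exp (- (1/4) * \<bar>x - y\<bar>) + indicator {x..x+\<delta>} y * exp (3/4 * \<bar>x - y\<bar>)"
        using ee[of y] by (simp add: algebra_simps)
      also have "indicator {x..x+\<delta>} y * exp (3/4 * \<bar>x - y\<bar>) \<le> indicator {x..x+\<delta>} y * 3"
      proof (cases "y \<in> {x..x+\<delta>}")
        case True
        then have "exp (3/4 * \<bar>x - y\<bar>) \<le> exp 1" using \<delta> by auto
        then have "exp (3/4 * \<bar>x - y\<bar>) \<le> 3" using exp_le by linarith
        then show ?thesis by (intro mult_left_mono) auto
      qed auto
      finally show ?thesis by (simp add: algebra_simps)
    qed
    have "has_bochner_integral lborel (\<lambda>y. indicator {x..x+\<delta>} y) (measure lborel {x..x+\<delta>})"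
      by (rule has_bochner_integral_real_indicator) (auto simp: emeasure_lborel_Icc_eq)
    from has_bochner_integral_add[OF e[of "3/2 * \<delta>"] has_bochner_integral_mult_right[OF this, of 3]]
    show "has_bochner_integral lborel (\<lambda>y. 3/2 * \<delta> * exp (- (1/4) * \<bar>x - y\<bar>) + 3 * indicator {x..x+\<delta>} y) (15 * \<delta>)"
      using \<delta> by simp
  qed measurable
  ultimately show "\<phi> x * \<bar>F t (x + \<delta>) - F t x\<bar> \<le> C * B * (15 * \<delta>)" by simp
qed

text \<open>The maximum principle is applied to \<open>\<phi> * w\<close> with both signs. The term
  containing \<open>\<phi>'\<close> costs \<open>9/4\<close> times
  \<open>C * (B * exp (84 * C * t))\<close>, rounded up to 3; with the 18 from \<open>r\<close> this
  makes 21. The rate 84 is 4 times 21, so that integration in time leaves the factor 1/4.\<close>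

lemma transport_weighted_bound:
  fixes w wx r :: "real \<Rightarrow> real \<Rightarrow> real" and \<phi> \<phi>' :: "real \<Rightarrow> real"
  assumes \<phi>: "\<And>x. \<phi> x > 0" "\<And>x. (\<phi> has_real_derivative \<phi>' x) (at x)" "\<And>x. \<bar>\<phi>' x\<bar> \<le> 3/4 * \<phi> x"
    and wc: "continuous_on ({0..T} \<times> UNIV) (\<lambda>(t, x). w t x)"
    and w_t: "\<And>t x. t \<in> {0..T} \<Longrightarrow> ((\<lambda>\<tau>. w \<tau> x) has_real_derivative
        - \<sigma> * (f1 (u t x) * wx t x + r t x)) (at t within {0..T})"
    and w_x: "\<And>t x. t \<in> {0..T} \<Longrightarrow> (w t has_real_derivative wx t x) (at x)"
    and B: "B \<ge> 0" "\<And>t x. t \<in> {0..T} \<Longrightarrow> \<phi> x * \<bar>w t x\<bar> \<le> 3 * (B * exp (84 * C * t))"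
    and r: "\<And>t x. t \<in> {0..T} \<Longrightarrow> \<phi> x * \<bar>r t x\<bar> \<le> 18 * C * (B * exp (84 * C * t))"
    and init: "\<And>x. \<phi> x * \<bar>w 0 x\<bar> \<le> S"
    and t: "t \<in> {0..T}"
  shows "\<phi> x * \<bar>w t x\<bar> \<le> S + B / 4 * exp (84 * C * t)"
proof -
  have main: "s * (\<phi> x * w t x) \<le> S + B / 4 * exp (84 * C * t)" if s: "\<bar>s\<bar> = 1" for s
  proof (rule transport_maximum_principle[where y = "\<lambda>t x. s * (\<phi> x * w t x)"
        and yt = "\<lambda>t x. s * (\<phi> x * (- \<sigma> * (f1 (u t x) * wx t x + r t x)))"
        and yx = "\<lambda>t x. s * (\<phi>' x * w t x + \<phi> x * wx t x)"
        and m = "\<lambda>t. 21 * C * (B * exp (84 * C * t))" and A = "L * b" and Y = "3 * (B * exp (84 * C * T))"])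
    have \<phi>c: "continuous_on UNIV \<phi>"
      using \<phi>(2) by (intro continuous_at_imp_continuous_on ballI) (blast intro: DERIV_isCont)
    show "continuous_on ({0..T} \<times> UNIV) (\<lambda>(t, x). s * (\<phi> x * w t x))"
      unfolding case_prod_beta
      by (intro continuous_intros continuous_on_compose2[OF \<phi>c] wc[unfolded case_prod_beta]) auto
    have sa: "s * (\<phi> x * a) \<le> \<phi> x * \<bar>a\<bar>" for x a
      using s \<phi>(1)[of x] by (metis abs_ge_self abs_mult abs_of_pos mult_1)
    show "s * (\<phi> x * w t x) \<le> 3 * (B * exp (84 * C * T))" if t: "t \<in> {0..T}" for t x
    proof -
      have "B * exp (84 * C * t) \<le> B * exp (84 * C * T)"
        using B(1) C_pos t by (intro mult_left_mono) auto
      then show ?thesis using sa[of x "w t x"] B(2)[OF t, of x] by linarith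
    qed
    show "((\<lambda>\<tau>. s * (\<phi> x * w \<tau> x)) has_real_derivative
        s * (\<phi> x * (- \<sigma> * (f1 (u t x) * wx t x + r t x)))) (at t within {0..T})" if "t \<in> {0..T}" for t x
      by (intro DERIV_cmult w_t that)
    show "((\<lambda>x. s * (\<phi> x * w t x)) has_real_derivative s * (\<phi>' x * w t x + \<phi> x * wx t x)) (at x)"
      if "t \<in> {0..T}" for t x
      using DERIV_cmult[OF DERIV_mult[OF \<phi>(2)[of x] w_x[OF that, of x]], of s] by (simp add: mult.commute)
    show "s * (\<phi> x * (- \<sigma> * (f1 (u t x) * wx t x + r t x)))
        \<le> L * b * \<bar>s * (\<phi>' x * w t x + \<phi> x * wx t x)\<bar> + 21 * C * (B * exp (84 * C * t))"
      if t: "t \<in> {0..T}" for t x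
    proof -
      let ?X = "\<phi>' x * w t x + \<phi> x * wx t x"
      have fb: "\<bar>f1 (u t x)\<bar> \<le> L * b"
        using f1_le[OF abs_u_le[OF t]] mult_left_mono[OF abs_u_le[OF t, of x], of L] L by (meson order_trans less_imp_le)
      \<comment> \<open>\<open>?X\<close> is the x-derivative of \<open>\<phi> * w\<close>; adding
        and subtracting the \<open>\<phi>'\<close> term puts it behind the speed, as the maximum
        principle requires.\<close>
      have "s * (\<phi> x * (- \<sigma> * (f1 (u t x) * wx t x + r t x)))
        = s * (- \<sigma>) * (f1 (u t x) * ?X) + s * \<sigma> * (f1 (u t x) * (\<phi>' x * w t x)) + s * (- \<sigma>) * (\<phi> x * r t x)"
        by (simp add: algebra_simps)
      also have "\<dots> \<le> \<bar>s * (- \<sigma>) * (f1 (u t x) * ?X)\<bar> + \<bar>s * \<sigma> * (f1 (u t x) * (\<phi>' x * w t x))\<bar>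
         + \<bar>s * (- \<sigma>) * (\<phi> x * r t x)\<bar>"
        by linarith
      also have "\<dots> = \<bar>f1 (u t x)\<bar> * \<bar>?X\<bar> + \<bar>f1 (u t x)\<bar> * (\<bar>\<phi>' x\<bar> * \<bar>w t x\<bar>) + \<phi> x * \<bar>r t x\<bar>"
        using \<phi>(1)[of x] s \<sigma> by (simp only: abs_mult abs_minus_cancel) simp
      also have "\<dots> \<le> L * b * \<bar>?X\<bar> + C * (3/4 * (3 * (B * exp (84 * C * t)))) + 18 * C * (B * exp (84 * C * t))"
      proof (rule add_mono[OF add_mono[OF mult_right_mono[OF fb] mult_mono] r[OF t]])
        show "\<bar>f1 (u t x)\<bar> \<le> C" using fb Lb_le_C by linarith
        have "\<bar>\<phi>' x\<bar> * \<bar>w t x\<bar> \<le> (3/4 * \<phi> x) * \<bar>w t x\<bar>" by (intro mult_right_mono \<phi>) auto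
        then show "\<bar>\<phi>' x\<bar> * \<bar>w t x\<bar> \<le> 3/4 * (3 * (B * exp (84 * C * t)))"
          using B(2)[OF t, of x] by simp
      qed (use L b C_pos in auto)
      also have "\<dots> \<le> L * b * \<bar>?X\<bar> + 21 * C * (B * exp (84 * C * t))"
        using B(1) C_pos by simp
      finally show ?thesis using s by (simp add: abs_mult)
    qed
    show "((\<lambda>t. S + B / 4 * exp (84 * C * t)) has_real_derivative 21 * C * (B * exp (84 * C * t))) (at t within {0..T})" for t
      by (auto intro!: derivative_eq_intros)
    show "s * (\<phi> x * w 0 x) \<le> S + B / 4 * exp (84 * C * 0)" for x
      using sa[of x "w 0 x"] init[of x] B(1) by simp
  qed (use L b t in auto)
  have "\<phi> x * \<bar>w t x\<bar> = \<bar>\<phi> x * w t x\<bar>" using \<phi>(1)[of x] by (simp add: abs_mult)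
  then show ?thesis using main[of 1] main[of "-1"] by linarith
qed

text \<open>The logarithm of the weight is Lipschitz with constant 3/4.\<close>

lemma weight_ratio:
  fixes \<phi> \<phi>' :: "real \<Rightarrow> real"
  assumes \<phi>: "\<And>x. \<phi> x > 0" "\<And>x. (\<phi> has_real_derivative \<phi>' x) (at x)" "\<And>x. \<bar>\<phi>' x\<bar> \<le> 3/4 * \<phi> x"
  shows "\<phi> x \<le> exp (3/4 * \<bar>x - y\<bar>) * \<phi> y"
proof -
  have "norm (ln (\<phi> x) - ln (\<phi> y)) \<le> 3/4 * norm (x - y)"
  proof (rule field_differentiable_bound[of UNIV "\<lambda>x. ln (\<phi> x)" "\<lambda>x. \<phi>' x / \<phi> x"])
    show "((\<lambda>x. ln (\<phi> x)) has_real_derivative \<phi>' z / \<phi> z) (at z within UNIV)" for z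
      using DERIV_chain2[OF DERIV_ln_divide[OF \<phi>(1)[of z]] \<phi>(2)[of z]] by simp
    show "norm (\<phi>' z / \<phi> z) \<le> 3/4" for z
      using \<phi>(3)[of z] \<phi>(1)[of z] by (simp add: abs_divide divide_le_eq)
  qed auto
  then have "ln (\<phi> x) \<le> 3/4 * \<bar>x - y\<bar> + ln (\<phi> y)" unfolding real_norm_def by linarith
  then have "exp (ln (\<phi> x)) \<le> exp (3/4 * \<bar>x - y\<bar> + ln (\<phi> y))" by (subst exp_le_cancel_iff)
  then show ?thesis using \<phi>(1) by (simp add: exp_add)
qed

text \<open>\<open>u\<close> contributes \<open>S + B/4 * exp (84 * C * t)\<close> and
  \<open>p\<close> contributes \<open>3 * S + B/4 * exp (84 * C * t)\<close>. The 3 bounds the cost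
  of moving the weight to the intermediate point of the mean value theorem, at distance less than 1.
  What matters is that the coefficient of \<open>B\<close> drops from 1 to 1/2.\<close>

lemma weighted_step:
  fixes \<phi> \<phi>' :: "real \<Rightarrow> real"
  assumes \<phi>: "\<And>x. \<phi> x > 0" "\<And>x. (\<phi> has_real_derivative \<phi>' x) (at x)" "\<And>x. \<bar>\<phi>' x\<bar> \<le> 3/4 * \<phi> x"
    and B: "B \<ge> 0" "\<And>t x. t \<in> {0..T} \<Longrightarrow> \<phi> x * (\<bar>u t x\<bar> + \<bar>p t x\<bar>) \<le> B * exp (84 * C * t)"
    and S: "\<And>x. \<phi> x * (\<bar>u 0 x\<bar> + \<bar>p 0 x\<bar>) \<le> S"
    and t: "t \<in> {0..T}"
  shows "\<phi> x * (\<bar>u t x\<bar> + \<bar>p t x\<bar>) \<le> 4 * S + B / 2 * exp (84 * C * t)"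
proof -
  note \<phi>r = weight_ratio[OF \<phi>]
  have zero: "0 \<in> {0..T}" using t by auto
  have B0: "0 \<le> B * exp (84 * C * t)" for t using B(1) by simp
  have u_le: "\<phi> x * \<bar>u t x\<bar> \<le> S + B / 4 * exp (84 * C * t)"
  proof (rule transport_weighted_bound[OF \<phi> u_cont u_t' u_x B(1) _ _ _ t])
    show "\<phi> x * \<bar>u t x\<bar> \<le> 3 * (B * exp (84 * C * t))" if "t \<in> {0..T}" for t x
    proof -
      have "\<phi> x * \<bar>u t x\<bar> \<le> \<phi> x * (\<bar>u t x\<bar> + \<bar>p t x\<bar>)" using \<phi>(1)[of x] by simp
      then show ?thesis using B(2)[OF that, of x] B0[of t] by linarith
    qed
    show "\<phi> x * \<bar>F t x\<bar> \<le> 18 * C * (B * exp (84 * C * t))" if "t \<in> {0..T}" for t x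
    proof -
      have "\<phi> x * \<bar>F t x\<bar> \<le> C * (B * exp (84 * C * t)) * 4"
        by (rule weighted_F_bound(1)[OF that \<phi>(1) \<phi>r B(2)[OF that]])
      also have "\<dots> \<le> C * (B * exp (84 * C * t)) * 18"
        using C_pos B0[of t] by (intro mult_left_mono) auto
      finally show ?thesis by (simp add: mult_ac)
    qed
    show "\<phi> x * \<bar>u 0 x\<bar> \<le> S" for x
      by (rule order_trans[OF _ S[of x]]) (use \<phi>(1)[of x] in simp)
  qed
  have p_le: "\<phi> x * \<bar>p t x\<bar> \<le> 3 * S + B / 4 * exp (84 * C * t)"
  proof (rule tendsto_upperbound)
    \<comment> \<open>\<open>p\<close> is merely continuous, so the estimate is made for the
      difference quotients of \<open>u\<close>, uniformly in \<delta>.\<close>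
    define w where "w \<delta> t x = (u t (x + \<delta>) - u t x) / \<delta>" for \<delta> t x
    have "((\<lambda>\<delta>. w \<delta> t x) \<longlongrightarrow> p t x) (at 0)"
      using u_x[OF t, of x] unfolding DERIV_def w_def .
    then have "((\<lambda>\<delta>. w \<delta> t x) \<longlongrightarrow> p t x) (at_right 0)"
      by (rule filterlim_mono) (auto simp: at_le)
    then show "((\<lambda>\<delta>. \<phi> x * \<bar>w \<delta> t x\<bar>) \<longlongrightarrow> \<phi> x * \<bar>p t x\<bar>) (at_right 0)"
      by (intro tendsto_intros)
    have wb: "\<phi> x * \<bar>w \<delta> t x\<bar> \<le> 3 * D"
      if t: "t \<in> {0..T}" and \<delta>: "0 < \<delta>" "\<delta> \<le> 1" and D: "\<And>x. \<phi> x * (\<bar>u t x\<bar> + \<bar>p t x\<bar>) \<le> D" for \<delta> t x D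
    proof -
      have "\<exists>z. x < z \<and> z < x + \<delta> \<and> u t (x + \<delta>) - u t x = (x + \<delta> - x) * p t z"
        by (rule MVT2) (use \<delta> u_x[OF t] in auto)
      then obtain z where z: "x < z" "z < x + \<delta>" "u t (x + \<delta>) - u t x = \<delta> * p t z" by auto
      then have "w \<delta> t x = p t z" using \<delta> by (simp add: w_def)
      then have "\<phi> x * \<bar>w \<delta> t x\<bar> \<le> \<phi> x * (\<bar>u t z\<bar> + \<bar>p t z\<bar>)" using \<phi>(1)[of x] by simp
      also have "\<dots> \<le> (exp (3/4 * \<bar>x - z\<bar>) * \<phi> z) * (\<bar>u t z\<bar> + \<bar>p t z\<bar>)"
        by (intro mult_right_mono \<phi>r) auto
      also have "\<dots> = exp (3/4 * \<bar>x - z\<bar>) * (\<phi> z * (\<bar>u t z\<bar> + \<bar>p t z\<bar>))" by simp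
      also have "\<dots> \<le> 3 * D"
      proof (rule mult_mono[OF _ D])
        have "exp (3/4 * \<bar>x - z\<bar>) \<le> exp 1" using z \<delta> by simp
        then show "exp (3/4 * \<bar>x - z\<bar>) \<le> 3" using exp_le by linarith
      qed (use \<phi>(1)[of z] in auto)
      finally show ?thesis .
    qed
    have "\<phi> x * \<bar>w \<delta> t x\<bar> \<le> 3 * S + B / 4 * exp (84 * C * t)" if \<delta>: "0 < \<delta>" "\<delta> \<le> 1" for \<delta>
    \<comment> \<open>Discrete product rule: the increment of \<open>f1 u * p\<close> is
      \<open>f1 (u t x)\<close> times the increment of \<open>p\<close>, which is transport, plus
      the increment of \<open>f1 u\<close> times \<open>p t (x + \<delta>)\<close>, which joins the
      increment of \<open>F\<close> in \<open>r\<close>.\<close>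
    proof (rule transport_weighted_bound[OF \<phi> _ _ _ B(1) _ _ _ t, where wx = "\<lambda>t x. (p t (x + \<delta>) - p t x) / \<delta>"
        and r = "\<lambda>t x. (f1 (u t (x + \<delta>)) - f1 (u t x)) / \<delta> * p t (x + \<delta>) + (F t (x + \<delta>) - F t x) / \<delta>"])
      show "continuous_on ({0..T} \<times> UNIV) (\<lambda>(t, x). w \<delta> t x)"
        unfolding w_def case_prod_beta
        by (intro continuous_intros continuous_on_compose2[OF u_cont[unfolded case_prod_beta], of _ "\<lambda>z. (fst z, snd z + \<delta>)", simplified]
            u_cont[unfolded case_prod_beta]) (use \<delta> in auto)
      show "((\<lambda>\<tau>. w \<delta> \<tau> x) has_real_derivative - \<sigma> * (f1 (u t x) * ((p t (x + \<delta>) - p t x) / \<delta>) +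
          ((f1 (u t (x + \<delta>)) - f1 (u t x)) / \<delta> * p t (x + \<delta>) + (F t (x + \<delta>) - F t x) / \<delta>))) (at t within {0..T})"
        if "t \<in> {0..T}" for t x
        unfolding w_def
        by (rule DERIV_cong[OF DERIV_cdivide[OF DERIV_diff[OF u_t'[OF that] u_t'[OF that]]]])
          (use \<delta> in \<open>simp add: field_simps\<close>)
      show "(w \<delta> t has_real_derivative (p t (x + \<delta>) - p t x) / \<delta>) (at x)" if "t \<in> {0..T}" for t x
        unfolding w_def[abs_def] using u_x[OF that, of "x + \<delta>"]
        by (intro DERIV_cdivide DERIV_diff u_x[OF that]) (simp add: DERIV_shift)
      show "\<phi> x * \<bar>w \<delta> t x\<bar> \<le> 3 * (B * exp (84 * C * t))" if "t \<in> {0..T}" for t x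
        by (rule wb[OF that \<delta> B(2)[OF that]])
      show "\<phi> x * \<bar>w \<delta> 0 x\<bar> \<le> 3 * S" for x
        by (rule wb[OF zero \<delta> S])
      show "\<phi> x * \<bar>(f1 (u t (x + \<delta>)) - f1 (u t x)) / \<delta> * p t (x + \<delta>) + (F t (x + \<delta>) - F t x) / \<delta>\<bar>
          \<le> 18 * C * (B * exp (84 * C * t))" if t: "t \<in> {0..T}" for t x
      proof -
        \<comment> \<open>The Lipschitz bound for \<open>f1\<close> costs \<open>3 * C\<close>, the
          increment of \<open>F\<close> costs \<open>15 * C\<close>; together they are the 18 of
          \<open>transport_weighted_bound\<close>.\<close>
        let ?a = "(f1 (u t (x + \<delta>)) - f1 (u t x)) / \<delta>" and ?D = "B * exp (84 * C * t)"
        have "\<bar>?a\<bar> \<le> L * \<bar>w \<delta> t x\<bar>"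
          using f1_lip[OF abs_u_le[OF t] abs_u_le[OF t], of "x + \<delta>" x] \<delta>
          by (simp add: w_def abs_divide divide_right_mono)
        then have "\<bar>?a\<bar> * \<bar>p t (x + \<delta>)\<bar> \<le> (L * \<bar>w \<delta> t x\<bar>) * b"
          by (rule mult_mono[OF _ abs_p_le[OF t]]) (use L in auto)
        then have "\<phi> x * (\<bar>?a\<bar> * \<bar>p t (x + \<delta>)\<bar>) \<le> \<phi> x * ((L * \<bar>w \<delta> t x\<bar>) * b)"
          using \<phi>(1)[of x] by (intro mult_left_mono) auto
        also have "\<dots> = (L * b) * (\<phi> x * \<bar>w \<delta> t x\<bar>)" by simp
        also have "\<dots> \<le> C * (3 * ?D)"
          by (rule mult_mono[OF Lb_le_C wb[OF t \<delta> B(2)[OF t]]]) (use C_pos \<phi>(1)[of x] in auto)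
        finally have 1: "\<phi> x * (\<bar>?a\<bar> * \<bar>p t (x + \<delta>)\<bar>) \<le> C * (3 * ?D)" .
        have "\<phi> x * \<bar>F t (x + \<delta>) - F t x\<bar> \<le> C * ?D * (15 * \<delta>)"
          by (rule weighted_F_bound(2)[OF t \<phi>(1) \<phi>r B(2)[OF t] \<delta>])
        then have 2: "\<phi> x * \<bar>(F t (x + \<delta>) - F t x) / \<delta>\<bar> \<le> C * ?D * 15"
          using \<delta> by (simp add: abs_divide divide_le_eq mult_ac)
        have "\<phi> x * \<bar>?a * p t (x + \<delta>) + (F t (x + \<delta>) - F t x) / \<delta>\<bar>
          \<le> \<phi> x * (\<bar>?a\<bar> * \<bar>p t (x + \<delta>)\<bar> + \<bar>(F t (x + \<delta>) - F t x) / \<delta>\<bar>)"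
          using \<phi>(1)[of x] by (intro mult_left_mono order_trans[OF abs_triangle_ineq]) (auto simp: abs_mult)
        also have "\<dots> \<le> C * (3 * ?D) + C * ?D * 15"
          unfolding distrib_left by (rule add_mono[OF 1 2])
        finally show ?thesis by (simp add: algebra_simps)
      qed
    qed
    then show "\<forall>\<^sub>F \<delta> in at_right 0. \<phi> x * \<bar>w \<delta> t x\<bar> \<le> 3 * S + B / 4 * exp (84 * C * t)"
      unfolding eventually_at_right_field by (intro exI[of _ 1]) auto
  qed simp
  show ?thesis using u_le p_le by (simp add: algebra_simps)
qed

text \<open>\<open>B\<close>, the supremum of the quantity damped by
  \<open>exp (- (84 * C * t))\<close>, is finite because \<phi> and \<open>u\<close>,
  \<open>p\<close> are bounded; only then can \<open>B / 2\<close> be absorbed. The bound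
  \<open>N\<close> leaves no trace in the result, which later permits unbounded weights.\<close>

theorem weighted_estimate:
  fixes \<phi> \<phi>' :: "real \<Rightarrow> real"
  assumes \<phi>: "\<And>x. \<phi> x > 0" "\<And>x. (\<phi> has_real_derivative \<phi>' x) (at x)" "\<And>x. \<bar>\<phi>' x\<bar> \<le> 3/4 * \<phi> x"
    and N: "\<And>x. \<phi> x \<le> N"
    and S: "\<And>x. \<phi> x * (\<bar>u 0 x\<bar> + \<bar>p 0 x\<bar>) \<le> S"
    and t: "t \<in> {0..T}"
  shows "\<phi> x * (\<bar>u t x\<bar> + \<bar>p t x\<bar>) \<le> 8 * S * exp (84 * C * T)"
proof -
  define G where "G t x = exp (- (84 * C * t)) * (\<phi> x * (\<bar>u t x\<bar> + \<bar>p t x\<bar>))" for t x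
  define B where "B = (SUP z\<in>{0..T} \<times> UNIV. G (fst z) (snd z))"
  have S0: "S \<ge> 0" by (rule order_trans[OF _ S[of 0]]) (use \<phi>(1)[of 0] in simp)
  have "G t x \<le> 1 * (N * b)" if "t \<in> {0..T}" for t x
    unfolding G_def
  proof (intro mult_mono N u_bound[OF that])
    show "exp (- (84 * C * t)) \<le> 1" using C_pos that by simp
    show "0 \<le> N" using \<phi>(1)[of x] N[of x] by linarith
    show "0 \<le> \<phi> x * (\<bar>u t x\<bar> + \<bar>p t x\<bar>)" using \<phi>(1)[of x] by simp
  qed auto
  then have bdd: "bdd_above ((\<lambda>z. G (fst z) (snd z)) ` ({0..T} \<times> UNIV))"
    by (intro bdd_aboveI[of _ "1 * (N * b)"]) auto
  have G_le: "G t x \<le> B" if "t \<in> {0..T}" for t x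
    using cSUP_upper[OF _ bdd, of "(t, x)"] that by (simp add: B_def)
  have B0: "B \<ge> 0" by (rule order_trans[OF _ G_le[OF t, of 0]]) (use \<phi>(1)[of 0] in \<open>simp add: G_def\<close>)
  have le: "\<phi> x * (\<bar>u t x\<bar> + \<bar>p t x\<bar>) \<le> B * exp (84 * C * t)" if "t \<in> {0..T}" for t x
    using G_le[OF that, of x] by (simp add: G_def exp_minus field_simps)
  have "B \<le> 4 * S + B / 2"
    unfolding B_def
  proof (rule cSUP_least, goal_cases)
    case (2 z)
    obtain t x where z: "z = (t, x)" "t \<in> {0..T}" using 2 by auto
    have "exp (- (84 * C * t)) \<le> 1" using C_pos z by simp
    then have "exp (- (84 * C * t)) * (4 * S) \<le> 1 * (4 * S)"
      using S0 by (intro mult_right_mono) auto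
    moreover have "exp (- (84 * C * t)) * (\<phi> x * (\<bar>u t x\<bar> + \<bar>p t x\<bar>))
      \<le> exp (- (84 * C * t)) * (4 * S + B / 2 * exp (84 * C * t))"
      by (intro mult_left_mono weighted_step[OF \<phi> B0 le S z(2)]) auto
    moreover have "\<dots> = exp (- (84 * C * t)) * (4 * S) + B / 2"
      by (simp add: distrib_left exp_minus field_simps)
    ultimately have "G t x \<le> 4 * S + B / 2" unfolding G_def by linarith
    then show ?case unfolding z B_def[symmetric] by simp
  qed (use t in auto)
  then have "B \<le> 8 * S" by simp
  then have "B * exp (84 * C * t) \<le> 8 * S * exp (84 * C * T)"
    using C_pos t S0 by (intro mult_mono) auto
  then show ?thesis using le[OF t, of x] by linarith
qed

end

section \<open>Spatial asymptotics\<close>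

context transport
begin

section \<open>Continuity of the time derivative and its averages\<close>

lemma h_cont_t: "continuous_on {0..T} (\<lambda>t. h t y)"
proof -
  have c: "continuous_on {0..T} (\<lambda>t. (t, y))" by (intro continuous_intros)
  from continuous_on_compose2[OF h_cont c] show ?thesis by (auto simp: image_subset_iff)
qed

lemma F_cont: "continuous_on ({0..T} \<times> UNIV) (\<lambda>(t, x). F t x)"
proof -
  \<comment> \<open>Substituting \<open>z = x - y\<close> moves the dependence on x from the
    discontinuous kernel to the continuous source.\<close>
  have F_eq: "F t x = (LINT z|lborel. dx_green z * h t (x - z))" for t x
    using lborel_integral_real_affine[of "-1" "\<lambda>y. dx_green (x - y) * h t y" x]
    by (simp add: F_def dx_inv_helmholtz_eq)
  show ?thesis
    unfolding F_eq case_prod_beta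
  proof (rule continuous_on_integral_dominated)
    show "(\<lambda>z. dx_green z * h (fst q) (snd q - z)) \<in> borel_measurable lborel" if "q \<in> {0..T} \<times> UNIV" for q
    proof -
      have [measurable]: "h (fst q) \<in> borel_measurable borel" using that by (intro measurable_h) auto
      show ?thesis by measurable
    qed
    show "integrable lborel (\<lambda>z. exp (- 1 * \<bar>0 - z\<bar>) * (C * b / 2))"
      using has_bochner_integral_exp_abs[of 1 0] by (auto simp: has_bochner_integral_iff)
    show "norm (dx_green z * h (fst q) (snd q - z)) \<le> exp (- 1 * \<bar>0 - z\<bar>) * (C * b / 2)"
      if "q \<in> {0..T} \<times> UNIV" for q z
    proof -
      have "\<bar>dx_green z\<bar> * \<bar>h (fst q) (snd q - z)\<bar> \<le> exp (- \<bar>z\<bar>) / 2 * (C * b)"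
        by (intro mult_mono abs_dx_green_le h_bounded) (use that in auto)
      then show ?thesis by (simp add: abs_mult)
    qed
    show "continuous_on ({0..T} \<times> UNIV) (\<lambda>q. dx_green z * h (fst q) (snd q - z))" for z
    proof -
      have c: "continuous_on ({0..T} \<times> UNIV) (\<lambda>q::real \<times> real. (fst q, snd q - z))"
        by (intro continuous_intros)
      have "continuous_on ({0..T} \<times> UNIV) (\<lambda>q. h (fst q) (snd q - z))"
        using continuous_on_compose2[OF h_cont c] by (auto simp: image_subset_iff)
      then show ?thesis by (intro continuous_intros)
    qed
  qed
qed

definition ut :: "real \<Rightarrow> real \<Rightarrow> real" where
  "ut t x = - \<sigma> * (f1 (u t x) * p t x + F t x)"

lemma ut_cont: "continuous_on ({0..T} \<times> UNIV) (\<lambda>(t, x). ut t x)"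
  unfolding ut_def case_prod_beta
  by (intro continuous_intros continuous_on_compose2[OF f1_cont] u_cont[unfolded case_prod_beta]
      p_cont[unfolded case_prod_beta] F_cont[unfolded case_prod_beta]) auto

lemma scale_mem: "t \<in> {0..T} \<Longrightarrow> \<theta> \<in> {0..1} \<Longrightarrow> \<theta> * t \<in> {0..T}"
  using mult_left_le_one_le[of t \<theta>] by auto

text \<open>Averaging over \<theta> in [0, 1] along \<open>\<theta> * t\<close>, instead of
  integrating over [0, t], exhibits the factor t and leaves an average that makes sense and is
  continuous at \<open>t = 0\<close>.\<close>

lemma u_increment:
  assumes t: "t \<in> {0..T}"
  shows "u t x = u 0 x + t * integral {0..1} (\<lambda>\<theta>. ut (\<theta> * t) x)"
proof -
  have "((\<lambda>\<theta>. ut (\<theta> * t) x * t) has_integral u (1 * t) x - u (0 * t) x) {0..1}"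
  proof (rule fundamental_theorem_of_calculus)
    fix \<theta> :: real assume \<theta>: "\<theta> \<in> {0..1}"
    have "((\<lambda>\<tau>. u \<tau> x) has_real_derivative ut (\<theta> * t) x) (at (\<theta> * t) within (\<lambda>\<theta>. \<theta> * t) ` {0..1})"
      unfolding ut_def
      by (rule has_field_derivative_subset[OF u_t'[OF scale_mem[OF t \<theta>]]]) (use scale_mem[OF t] in auto)
    moreover have "((\<lambda>\<theta>. \<theta> * t) has_real_derivative t) (at \<theta> within {0..1})"
      by (auto intro!: derivative_eq_intros)
    ultimately have "((\<lambda>\<tau>. u \<tau> x) \<circ> (\<lambda>\<theta>. \<theta> * t) has_real_derivative ut (\<theta> * t) x * t) (at \<theta> within {0..1})"
      by (rule DERIV_image_chain)
    then show "((\<lambda>\<theta>. u (\<theta> * t) x) has_vector_derivative ut (\<theta> * t) x * t) (at \<theta> within {0..1})"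
      by (simp add: comp_def has_real_derivative_iff_has_vector_derivative)
  qed simp
  from integral_unique[OF this] show ?thesis by (simp add: mult.commute)
qed

lemma continuous_on_time_average:
  fixes w :: "real \<Rightarrow> real \<Rightarrow> real"
  assumes "continuous_on ({0..T} \<times> UNIV) (\<lambda>(t, x). w t x)"
  shows "continuous_on ({0..T} \<times> UNIV) (\<lambda>(t, x). integral {0..1} (\<lambda>\<theta>. w (\<theta> * t) x))"
proof -
  have c: "continuous_on (({0..T} \<times> UNIV) \<times> cbox 0 1) (\<lambda>z::(real \<times> real) \<times> real. (snd z * fst (fst z), snd (fst z)))"
    by (intro continuous_intros)
  have "(\<lambda>z::(real \<times> real) \<times> real. (snd z * fst (fst z), snd (fst z))) ` (({0..T} \<times> UNIV) \<times> cbox 0 1) \<subseteq> {0..T} \<times> UNIV"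
    using scale_mem by (fastforce simp: cbox_interval)
  from continuous_on_compose2[OF assms c this]
  have "continuous_on (({0..T} \<times> UNIV) \<times> cbox 0 1) (\<lambda>(q, \<theta>). w (\<theta> * fst q) (snd q))"
    by (simp add: case_prod_beta)
  from integral_continuous_on_param[OF this] show ?thesis
    by (simp add: case_prod_beta cbox_interval)
qed

text \<open>For \<open>y < x\<close> the product \<open>exp x * dx_green (x - y)\<close> equals
  \<open>- exp y / 2\<close> exactly, so \<open>exp x * F t x + P t\<close> sees only the tail
  \<open>y \<ge> x\<close>. The majorant \<open>D\<close>, which is free of t, makes that tail small
  uniformly in time.\<close>

lemma asymptotics_at_top:
  assumes D: "integrable lborel D" "(D \<longlongrightarrow> 0) at_top"
    and uD: "\<And>t y. t \<in> {0..T} \<Longrightarrow> exp \<bar>y\<bar> * ((u t y)\<^sup>2 + (p t y)\<^sup>2) \<le> D y"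
    and c: "c > 0" "\<And>t y. t \<in> {0..T} \<Longrightarrow> g (u t y) \<le> c * (u t y)\<^sup>2"
    and x0: "g (u 0 x0) > 0" and T: "T > 0"
  obtains \<Phi> :: "real \<Rightarrow> real" and \<epsilon> :: "real \<Rightarrow> real \<Rightarrow> real"
  where "continuous_on {0..T} \<Phi>" "continuous_on ({0..T} \<times> UNIV) (\<lambda>(t, x). \<epsilon> t x)"
    "\<And>t x. t \<in> {0..T} \<Longrightarrow> u t x = u 0 x + \<sigma> * (t * exp (- \<bar>x\<bar>) * (\<Phi> t + \<epsilon> t x))"
    "\<And>t. t \<in> {0..T} \<Longrightarrow> \<Phi> t > 0"
    "\<And>t. t \<in> {0..T} \<Longrightarrow> (\<epsilon> t \<longlongrightarrow> 0) at_top"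
proof -
  define K where "K = c + L"
  have K: "K > 0" using c L by (simp add: K_def)
  have D0: "D y \<ge> 0" for y by (rule order_trans[OF _ uD[of 0]]) (use T in auto)
  \<comment> \<open>Here the quadratic bound on \<open>g\<close> enters: a linear one would leave a
    decay of order \<open>exp (- \<bar>y\<bar> / 2)\<close>, too weak against
    \<open>exp \<bar>y\<bar>\<close>.\<close>
  have hD: "exp \<bar>y\<bar> * h t y \<le> K * D y" if t: "t \<in> {0..T}" for t y
  proof -
    have "h t y \<le> c * (u t y)\<^sup>2 + L * (p t y)\<^sup>2"
      unfolding h_def using f2_le[OF abs_u_le[OF t, of y]] by (intro add_mono mult_right_mono c t) auto
    also have "\<dots> \<le> K * ((u t y)\<^sup>2 + (p t y)\<^sup>2)"
      using c L by (simp add: K_def algebra_simps)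
    finally have "exp \<bar>y\<bar> * h t y \<le> exp \<bar>y\<bar> * (K * ((u t y)\<^sup>2 + (p t y)\<^sup>2))"
      by (intro mult_left_mono) auto
    also have "\<dots> \<le> K * D y" using mult_left_mono[OF uD[OF t, of y], of K] K by (simp add: algebra_simps)
    finally show ?thesis .
  qed
  have ehD: "\<bar>exp y * h t y\<bar> \<le> K * D y" if "t \<in> {0..T}" for t y
  proof -
    have "exp y * h t y \<le> exp \<bar>y\<bar> * h t y" using h_nonneg by (intro mult_right_mono) auto
    then show ?thesis using hD[OF that, of y] h_nonneg[of t y] by simp
  qed
  have iKD: "integrable lborel (\<lambda>y. K * D y)" using D by simp
  have m: "(\<lambda>y. exp y * h t y) \<in> borel_measurable lborel" if "t \<in> {0..T}" for t
    using measurable_h[OF that] by measurable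
  have ieh: "integrable lborel (\<lambda>y. exp y * h t y)" if "t \<in> {0..T}" for t
    by (rule Bochner_Integration.integrable_bound[OF iKD m[OF that]])
      (use ehD[OF that] in \<open>auto intro!: AE_I2 order_trans[OF ehD[OF that] abs_ge_self]\<close>)
  define P where "P t = (LINT y|lborel. exp y * h t y) / 2" for t
  have P_cont: "continuous_on {0..T} P"
    unfolding P_def
  proof (intro continuous_on_divide continuous_on_const continuous_on_integral_dominated[OF _ iKD])
    show "continuous_on {0..T} (\<lambda>t. exp y * h t y)" for y
      by (intro continuous_intros h_cont_t)
  qed (use m ehD in auto)
  have P_nonneg: "P t \<ge> 0" for t
    unfolding P_def using h_nonneg by (auto intro!: integral_nonneg_AE)
  \<comment> \<open>Continuity spreads the positive value of the integrand at \<open>x0\<close> over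
    an interval.\<close>
  have P0: "P 0 > 0"
  proof -
    have z: "0 \<in> {0..T}" using T by simp
    define k where "k y = exp y * h 0 y" for y
    have "0 \<le> f2 (u 0 x0) / 2 * (p 0 x0)\<^sup>2" using f2_nonneg by simp
    then have kx: "k x0 > 0" using x0 by (simp add: k_def h_def add_pos_nonneg)
    have "continuous_on UNIV k" unfolding k_def[abs_def] by (intro continuous_intros h_cont_x[OF z])
    then obtain d where d: "d > 0" "\<And>y. dist y x0 < d \<Longrightarrow> dist (k y) (k x0) < k x0 / 2"
      unfolding continuous_on_iff using kx by (metis UNIV_I half_gt_zero)
    have "0 < d * (k x0 / 2)" using d kx by simp
    also have "\<dots> = (LINT y|lborel. indicator {x0 - d/2..x0 + d/2} y * (k x0 / 2))"
      using d(1) by simp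
    also have "\<dots> \<le> (LINT y|lborel. k y)"
    proof (rule integral_mono)
      show "integrable lborel (\<lambda>y. indicator {x0 - d/2..x0 + d/2} y * (k x0 / 2))"
        by (intro integrable_mult_left integrable_real_indicator) (auto simp: emeasure_lborel_Icc_eq)
      show "integrable lborel k" unfolding k_def[abs_def] by (rule ieh[OF z])
      show "indicator {x0 - d/2..x0 + d/2} y * (k x0 / 2) \<le> k y" for y
      proof (cases "y \<in> {x0 - d/2..x0 + d/2}")
        case True
        then have "dist y x0 < d" using d(1) by (auto simp: dist_real_def abs_if)
        from d(2)[OF this] have "k x0 / 2 \<le> k y" by (simp add: dist_real_def abs_if split: if_splits)
        then show ?thesis using True by simp
      qed (simp add: k_def h_nonneg)
    qed
    finally show ?thesis by (simp add: P_def k_def)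
  qed
  \<comment> \<open>The error has a local part, \<open>f1 u * p\<close>, which is quadratic because
    of the linear bound on \<open>f1\<close> and is therefore at most \<open>L * D\<close>, and a
    nonlocal part, the tail of \<open>K * D\<close>.\<close>
  define E where "E x = L * D x + (LINT y|lborel. indicator {x..} y * (K * D y))" for x
  have iE: "integrable lborel (\<lambda>y. indicator {x..} y * (K * D y))" for x
    by (rule Bochner_Integration.integrable_bound[OF iKD])
      (use borel_measurable_integrable[OF D(1)] in \<open>auto simp: indicator_def\<close>)
  have E_lim: "(E \<longlongrightarrow> 0) at_top"
  proof -
    have "((\<lambda>x. LINT y|lborel. indicator {x..} y * (K * D y)) \<longlongrightarrow> integral\<^sup>L lborel (\<lambda>_::real. 0)) at_top"
    proof (rule integral_dominated_convergence_at_top[OF _ _ iKD])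
      show "(\<lambda>y. indicator {x..} y * (K * D y)) \<in> borel_measurable lborel" for x
        using iE by (rule borel_measurable_integrable)
      show "\<forall>\<^sub>F x in at_top. AE y in lborel. norm (indicator {x..} y * (K * D y)) \<le> K * D y"
        using K D0 by (intro always_eventually allI AE_I2) (simp add: indicator_def)
      show "AE y in lborel. ((\<lambda>x. indicator {x..} y * (K * D y)) \<longlongrightarrow> 0) at_top"
      proof (rule AE_I2)
        fix y
        show "((\<lambda>x. indicator {x..} y * (K * D y)) \<longlongrightarrow> 0) at_top"
          by (rule tendsto_eventually, rule eventually_mono[OF eventually_gt_at_top[of y]]) simp
      qed
    qed simp
    from tendsto_add[OF tendsto_mult_left[OF D(2), of L] this] show ?thesis by (simp add: E_def[abs_def])
  qed
  have ut_P: "\<bar>\<sigma> * exp x * ut t x - P t\<bar> \<le> E x" if t: "t \<in> {0..T}" and x: "x > 0" for t x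
  proof -
    have \<sigma>2: "\<sigma> * \<sigma> = 1" using \<sigma> by (metis abs_mult_self_eq mult_1)
    have "\<sigma> * exp x * ut t x - P t = - (\<sigma> * \<sigma>) * (exp x * (f1 (u t x) * p t x) + exp x * F t x) - P t"
      by (simp add: ut_def algebra_simps)
    also have "\<dots> = - (exp x * (f1 (u t x) * p t x)) - (exp x * F t x + P t)"
      unfolding \<sigma>2 by simp
    finally have eq: "\<sigma> * exp x * ut t x - P t = - (exp x * (f1 (u t x) * p t x)) - (exp x * F t x + P t)" .
    have "\<bar>f1 (u t x) * p t x\<bar> \<le> L * (\<bar>u t x\<bar> * \<bar>p t x\<bar>)"
      using mult_right_mono[OF f1_le[OF abs_u_le[OF t, of x]], of "\<bar>p t x\<bar>"] by (simp add: abs_mult)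
    also have "\<dots> \<le> L * ((u t x)\<^sup>2 + (p t x)\<^sup>2)"
    proof (rule mult_left_mono)
      show "\<bar>u t x\<bar> * \<bar>p t x\<bar> \<le> (u t x)\<^sup>2 + (p t x)\<^sup>2"
        by (rule order_trans[OF mult_le_half_squares]) simp
    qed (use L in simp)
    finally have "exp x * \<bar>f1 (u t x) * p t x\<bar> \<le> exp x * (L * ((u t x)\<^sup>2 + (p t x)\<^sup>2))"
      by (intro mult_left_mono) auto
    also have "\<dots> = L * (exp \<bar>x\<bar> * ((u t x)\<^sup>2 + (p t x)\<^sup>2))" using x by simp
    also have "\<dots> \<le> L * D x" using L by (intro mult_left_mono uD t) auto
    finally have 1: "\<bar>exp x * (f1 (u t x) * p t x)\<bar> \<le> L * D x" by (simp add: abs_mult)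
    have i1: "integrable lborel (\<lambda>y. exp x * (dx_green (x - y) * h t y))" 
      by (intro integrable_mult_right integrable_dx_green_h[OF t])
    have i2: "integrable lborel (\<lambda>y. exp y * h t y / 2)" using ieh[OF t] by simp
    have eqF: "exp x * F t x + P t = (LINT y|lborel. exp x * (dx_green (x - y) * h t y) + exp y * h t y / 2)"
      by (subst Bochner_Integration.integral_add[OF i1 i2]) (simp add: F_def P_def dx_inv_helmholtz_eq)
    have "\<bar>exp x * F t x + P t\<bar> \<le> (LINT y|lborel. \<bar>exp x * (dx_green (x - y) * h t y) + exp y * h t y / 2\<bar>)"
      unfolding eqF by (rule integral_abs_bound)
    also have "\<dots> \<le> (LINT y|lborel. indicator {x..} y * (K * D y))"
    proof (rule integral_mono[OF _ iE[of x]])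
      show "integrable lborel (\<lambda>y. \<bar>exp x * (dx_green (x - y) * h t y) + exp y * h t y / 2\<bar>)"
        by (rule integrable_abs[OF Bochner_Integration.integrable_add[OF i1 i2]])
      fix y
      show "\<bar>exp x * (dx_green (x - y) * h t y) + exp y * h t y / 2\<bar> \<le> indicator {x..} y * (K * D y)"
      proof (cases "y < x")
        case True
        have "exp x * exp (y - x) = exp y" by (simp flip: exp_add)
        then have "exp x * dx_green (x - y) = - exp y / 2"
          using True by (simp add: dx_green_def green_def)
        then have "exp x * (dx_green (x - y) * h t y) + exp y * h t y / 2 = 0"
          unfolding mult.assoc[symmetric] by simp
        then show ?thesis using True by simp
      next
        case False
        have "exp x * \<bar>dx_green (x - y)\<bar> \<le> exp x * (exp (x - y) / 2)"
          using abs_dx_green_le[of "x - y"] False by (intro mult_left_mono) auto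
        also have "\<dots> \<le> exp y / 2"
          using False by (simp flip: exp_add)
        finally have e: "exp x * \<bar>dx_green (x - y)\<bar> \<le> exp y / 2" .
        have "\<bar>exp x * (dx_green (x - y) * h t y) + exp y * h t y / 2\<bar>
           \<le> \<bar>exp x * (dx_green (x - y) * h t y)\<bar> + \<bar>exp y * h t y / 2\<bar>" by (rule abs_triangle_ineq)
        also have "\<dots> = exp x * \<bar>dx_green (x - y)\<bar> * h t y + exp y * h t y / 2"
          using h_nonneg[of t y] by (simp add: abs_mult)
        also have "\<dots> \<le> exp y / 2 * h t y + exp y * h t y / 2"
          by (intro add_right_mono mult_right_mono e h_nonneg)
        also have "\<dots> \<le> K * D y" using ehD[OF t, of y] by simp
        finally show ?thesis using False by simp
      qed
    qed
    finally have 2: "\<bar>exp x * F t x + P t\<bar> \<le> (LINT y|lborel. indicator {x..} y * (K * D y))" .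
    show ?thesis unfolding eq E_def using 1 2 by linarith
  qed
  define \<Phi> where "\<Phi> t = integral {0..1} (\<lambda>\<theta>. P (\<theta> * t))" for t
  \<comment> \<open>With this choice the expansion is an identity on the whole line, since
    \<open>\<sigma> * \<sigma> = 1\<close>; only the smallness of \<epsilon> is a matter of
    \<open>x > 0\<close>.\<close>
  define \<epsilon> where "\<epsilon> t x = \<sigma> * exp \<bar>x\<bar> * integral {0..1} (\<lambda>\<theta>. ut (\<theta> * t) x) - \<Phi> t" for t x
  have Pc2: "continuous_on ({0..T} \<times> UNIV) (\<lambda>(t, x::real). P t)"
    unfolding case_prod_beta by (intro continuous_on_compose2[OF P_cont] continuous_intros) auto
  have \<Phi>c2: "continuous_on ({0..T} \<times> UNIV) (\<lambda>(t, x::real). \<Phi> t)"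
    unfolding \<Phi>_def by (rule continuous_on_time_average[OF Pc2])
  have Pt: "continuous_on {0..1} (\<lambda>\<theta>. P (\<theta> * t))" if "t \<in> {0..T}" for t
    by (rule continuous_on_compose2[OF P_cont]) (use scale_mem[OF that] in \<open>auto intro!: continuous_intros\<close>)
  show ?thesis
  proof (rule that[of \<Phi> \<epsilon>])
    show "continuous_on {0..T} \<Phi>"
    proof -
      have c: "continuous_on {0..T} (\<lambda>t. (t, 0::real))" by (intro continuous_intros)
      from continuous_on_compose2[OF \<Phi>c2 c] show ?thesis by (auto simp: image_subset_iff)
    qed
    show "continuous_on ({0..T} \<times> UNIV) (\<lambda>(t, x). \<epsilon> t x)"
      unfolding \<epsilon>_def case_prod_beta
      by (intro continuous_intros continuous_on_time_average[OF ut_cont, unfolded case_prod_beta]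
          \<Phi>c2[unfolded case_prod_beta])
    show "u t x = u 0 x + \<sigma> * (t * exp (- \<bar>x\<bar>) * (\<Phi> t + \<epsilon> t x))" if "t \<in> {0..T}" for t x
    proof -
      have \<sigma>2: "\<sigma> * \<sigma> = 1" using \<sigma> by (metis abs_mult_self_eq mult_1)
      have "\<sigma> * (t * exp (- \<bar>x\<bar>) * (\<Phi> t + \<epsilon> t x))
        = (\<sigma> * \<sigma>) * (exp (- \<bar>x\<bar>) * exp \<bar>x\<bar>) * (t * integral {0..1} (\<lambda>\<theta>. ut (\<theta> * t) x))"
        by (simp add: \<epsilon>_def algebra_simps)
      also have "exp (- \<bar>x\<bar>) * exp \<bar>x\<bar> = 1" by (simp flip: exp_add)
      finally have e: "\<sigma> * (t * exp (- \<bar>x\<bar>) * (\<Phi> t + \<epsilon> t x)) = t * integral {0..1} (\<lambda>\<theta>. ut (\<theta> * t) x)"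
        unfolding \<sigma>2 by (simp only: mult_1)
      show ?thesis unfolding e by (rule u_increment[OF that])
    qed
    show "\<Phi> t > 0" if "t \<in> {0..T}" for t
    proof -
      have "\<Phi> t \<ge> 0" unfolding \<Phi>_def
        by (rule Henstock_Kurzweil_Integration.integral_nonneg[OF integrable_continuous_interval[OF Pt[OF that]]]) (rule P_nonneg)
      \<comment> \<open>A continuous non-negative integrand with integral 0 would vanish at \<theta>
        = 0, where its value is \<open>P 0\<close>.\<close>
      moreover have "\<Phi> t \<noteq> 0"
        using integral_eq_0_iff[OF Pt[OF that]] P_nonneg P0 unfolding \<Phi>_def by (auto intro!: bexI[of _ 0])
      ultimately show ?thesis by simp
    qed
    show "(\<epsilon> t \<longlongrightarrow> 0) at_top" if t: "t \<in> {0..T}" for t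
    proof (rule Lim_null_comparison[OF _ E_lim])
      have "norm (\<epsilon> t x) \<le> E x" if x: "x > 0" for x
      proof -
        have c: "continuous_on {0..1} (\<lambda>\<theta>. ut (\<theta> * t) x)"
        proof -
          have c: "continuous_on {0..1} (\<lambda>\<theta>. (\<theta> * t, x))" by (intro continuous_intros)
          show ?thesis
            using continuous_on_compose2[OF ut_cont c] scale_mem[OF t] by (auto simp: image_subset_iff)
        qed
        have "\<epsilon> t x = integral {0..1} (\<lambda>\<theta>. \<sigma> * exp x * ut (\<theta> * t) x - P (\<theta> * t))"
          unfolding \<epsilon>_def \<Phi>_def using x
          by (subst Henstock_Kurzweil_Integration.integral_diff)
            (auto intro!: integrable_continuous_interval Pt[OF t] c continuous_intros)
        also have "norm \<dots> \<le> E x * (1 - 0)"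
        proof (rule integral_bound)
          show "continuous_on {0..1} (\<lambda>\<theta>. \<sigma> * exp x * ut (\<theta> * t) x - P (\<theta> * t))"
            by (intro continuous_intros c Pt[OF t])
          show "norm (\<sigma> * exp x * ut (\<theta> * t) x - P (\<theta> * t)) \<le> E x" if "\<theta> \<in> {0..1}" for \<theta>
            using ut_P[OF scale_mem[OF t that] x] by simp
        qed simp
        finally show ?thesis by simp
      qed
      then show "\<forall>\<^sub>F x in at_top. norm (\<epsilon> t x) \<le> E x"
        by (intro eventually_mono[OF eventually_gt_at_top[of 0]])
    qed
  qed
qed

end

section \<open>The decay weight\<close>

lemma dx_inv_helmholtz_reflect:
  "dx_inv_helmholtz (\<lambda>y. k (- y)) x = - dx_inv_helmholtz k (- x)"
proof -
  have "dx_green (- x - y) = - dx_green (x + y)" for y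
    by (simp add: dx_green_def green_def sgn_real_def abs_if)
  then have odd: "dx_green (- x - y) = - dx_green (x - (- y))" for y by simp
  have "dx_inv_helmholtz (\<lambda>y. k (- y)) x = (LINT y|lborel. dx_green (x - (- y)) * k y)"
    using lborel_integral_real_affine[of "-1" "\<lambda>y. dx_green (x - y) * k (- y)" 0]
    by (simp add: dx_inv_helmholtz_eq)
  also have "\<dots> = - dx_inv_helmholtz k (- x)"
    unfolding dx_inv_helmholtz_eq odd by simp
  finally show ?thesis .
qed

context transport
begin

text \<open>Reduces minus infinity to plus infinity; the flipped \<sigma> becomes the minus sign of
  the expansion for \<open>x < 0\<close>. The source contains the space derivative only squared, so
  it is merely reflected, and the kernel is odd.\<close>

lemma transport_reflect: "transport f1 f2 g T (- \<sigma>) L b (\<lambda>t x. u t (- x)) (\<lambda>t x. - p t (- x))"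
proof -
  have c: "continuous_on ({0..T} \<times> UNIV) (\<lambda>q::real \<times> real. (fst q, - snd q))"
    by (intro continuous_intros)
  have sub: "(\<lambda>q::real \<times> real. (fst q, - snd q)) ` ({0..T} \<times> UNIV) \<subseteq> {0..T} \<times> UNIV" by auto
  show ?thesis
  proof
    show "continuous_on ({0..T} \<times> UNIV) (\<lambda>(t, x). u t (- x))"
      using continuous_on_compose2[OF u_cont c sub] by (simp add: case_prod_beta)
    show "continuous_on ({0..T} \<times> UNIV) (\<lambda>(t, x). - p t (- x))"
      using continuous_on_minus[OF continuous_on_compose2[OF p_cont c sub]] by (simp add: case_prod_beta)
    show "((\<lambda>x. u t (- x)) has_real_derivative - p t (- x)) (at x)" if "t \<in> {0..T}" for t x
      using u_x[OF that, of "- x"] by (simp add: DERIV_mirror)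
    show "((\<lambda>\<tau>. u \<tau> (- x)) has_real_derivative - (- \<sigma>) * (f1 (u t (- x)) * - p t (- x) +
        dx_inv_helmholtz (\<lambda>y. g (u t (- y)) + f2 (u t (- y)) / 2 * (- p t (- y))\<^sup>2) x)) (at t within {0..T})"
      if "t \<in> {0..T}" for t x
      using u_t[OF that, of "- x"]
      unfolding power2_minus dx_inv_helmholtz_reflect[of "\<lambda>y. g (u t y) + f2 (u t y) / 2 * (p t y)\<^sup>2"]
      by (simp add: algebra_simps)
  qed (use \<sigma> L b f1_cont f2_cont g_cont f1_le f1_lip f2_nonneg f2_le g_nonneg g_le u_bound in auto)
qed

lemma transport_reverse:
  assumes t0: "t0 \<in> {0..T}"
  shows "transport f1 f2 g t0 (- \<sigma>) L b (\<lambda>t. u (t0 - t)) (\<lambda>t. p (t0 - t))"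
proof -
  have c: "continuous_on ({0..t0} \<times> UNIV) (\<lambda>q::real \<times> real. (t0 - fst q, snd q))"
    by (intro continuous_intros)
  have sub: "(\<lambda>q::real \<times> real. (t0 - fst q, snd q)) ` ({0..t0} \<times> UNIV) \<subseteq> {0..T} \<times> UNIV"
    using t0 by auto
  show ?thesis
  proof
    show "continuous_on ({0..t0} \<times> UNIV) (\<lambda>(t, x). u (t0 - t) x)"
      using continuous_on_compose2[OF u_cont c sub] by (simp add: case_prod_beta)
    show "continuous_on ({0..t0} \<times> UNIV) (\<lambda>(t, x). p (t0 - t) x)"
      using continuous_on_compose2[OF p_cont c sub] by (simp add: case_prod_beta)
    show "(u (t0 - t) has_real_derivative p (t0 - t) x) (at x)" if "t \<in> {0..t0}" for t x
      using u_x[of "t0 - t"] that t0 by auto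
    show "\<bar>u (t0 - t) x\<bar> + \<bar>p (t0 - t) x\<bar> \<le> b" if "t \<in> {0..t0}" for t x
      using u_bound[of "t0 - t"] that t0 by auto
    show "((\<lambda>\<tau>. u (t0 - \<tau>) x) has_real_derivative - (- \<sigma>) * (f1 (u (t0 - t) x) * p (t0 - t) x +
        dx_inv_helmholtz (\<lambda>y. g (u (t0 - t) y) + f2 (u (t0 - t) y) / 2 * (p (t0 - t) y)\<^sup>2) x)) (at t within {0..t0})"
      if t: "t \<in> {0..t0}" for t x
    proof -
      have "t0 - t \<in> {0..T}" using t t0 by auto
      from has_field_derivative_subset[OF u_t[OF this, of x], of "(\<lambda>\<tau>. t0 - \<tau>) ` {0..t0}"] t0
      have 1: "((\<lambda>\<tau>. u \<tau> x) has_real_derivative - \<sigma> * (f1 (u (t0 - t) x) * p (t0 - t) x +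
        dx_inv_helmholtz (\<lambda>y. g (u (t0 - t) y) + f2 (u (t0 - t) y) / 2 * (p (t0 - t) y)\<^sup>2) x))
        (at (t0 - t) within (\<lambda>\<tau>. t0 - \<tau>) ` {0..t0})" by auto
      have 2: "((\<lambda>\<tau>. t0 - \<tau>) has_real_derivative - 1) (at t within {0..t0})"
        by (auto intro!: derivative_eq_intros)
      show ?thesis
        by (rule DERIV_cong[OF DERIV_image_chain[OF 1 2, unfolded comp_def]]) simp
    qed
  qed (use \<sigma> L b f1_cont f2_cont g_cont f1_le f1_lip f2_nonneg f2_le g_nonneg g_le in auto)
qed

text \<open>The right side of \<open>weighted_estimate\<close> is proportional to \<open>S\<close>,
  so \<open>S = 0\<close> persists in reversed time. The derivative vanishes at \<open>t0\<close> as
  well, the slice being constant.\<close>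

lemma backward_uniqueness:
  assumes t0: "t0 \<in> {0..T}" and z: "\<And>x. u t0 x = 0"
  shows "u 0 x = 0"
proof -
  interpret rev: transport f1 f2 g t0 "- \<sigma>" L b "\<lambda>t. u (t0 - t)" "\<lambda>t. p (t0 - t)"
    by (rule transport_reverse[OF t0])
  have "u t0 = (\<lambda>x. 0)" using z by auto
  then have p0: "p t0 x = 0" for x
    using u_x[OF t0, of x] DERIV_unique[of "\<lambda>x. 0" "p t0 x" x 0] by simp
  have "1 * (\<bar>u (t0 - t0) x\<bar> + \<bar>p (t0 - t0) x\<bar>) \<le> 8 * 0 * exp (84 * rev.C * t0)"
    by (rule rev.weighted_estimate[of "\<lambda>_. 1" "\<lambda>_. 0" 1]) (use t0 z p0 in auto)
  then show ?thesis by simp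
qed

end

section \<open>An explicit smooth weight\<close>

text \<open>A substitute for the weight in \<open>weighted\<close> that is differentiable and
  positive everywhere: \<open>sqrt (1 + x\<^sup>2)\<close> smooths \<open>\<bar>x\<bar>\<close>, and
  the shift keeps the logarithm at least 1, whereas \<open>ln (1 + \<bar>x\<bar>)\<close> vanishes
  at 0.\<close>

definition decay_weight :: "real \<Rightarrow> real \<Rightarrow> real" where
  "decay_weight d x = exp (sqrt (1 + x\<^sup>2) / 2) * (4 + 4 * d + sqrt (1 + x\<^sup>2)) powr (1/2)
     * ln (4 + 4 * d + sqrt (1 + x\<^sup>2)) powr d"

lemma bracket_bounds: "\<bar>x\<bar> \<le> sqrt (1 + x\<^sup>2)" "1 \<le> sqrt (1 + x\<^sup>2)" "sqrt (1 + x\<^sup>2) \<le> 1 + \<bar>x\<bar>"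
proof -
  show "sqrt (1 + x\<^sup>2) \<le> 1 + \<bar>x\<bar>"
    by (rule real_le_lsqrt) (auto simp: power2_eq_square algebra_simps)
qed (auto simp: real_le_rsqrt)

lemma ln_ge_one: "z \<ge> 4 \<Longrightarrow> 1 \<le> ln (z::real)"
  using exp_le by (subst ln_ge_iff) auto

lemma decay_weight_pos: "d > 0 \<Longrightarrow> decay_weight d x > 0"
proof -
  assume "d > 0"
  then have "4 + 4 * d + sqrt (1 + x\<^sup>2) \<ge> 4" using bracket_bounds(2)[of x] by simp
  moreover from ln_ge_one[OF this] have "ln (4 + 4 * d + sqrt (1 + x\<^sup>2)) \<noteq> 0" by linarith
  ultimately show ?thesis
    unfolding decay_weight_def by (intro mult_pos_pos) (simp_all only: powr_gt_zero, auto)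
qed

text \<open>The constant \<open>4 + 4 * d\<close> is large enough for the logarithmic derivative to stay below the decay
  rate 1 of the Green function.\<close>

lemma decay_weight_deriv:
  assumes d: "d > 0"
  obtains \<phi>' where "\<And>x. (decay_weight d has_real_derivative \<phi>' x) (at x)"
    "\<And>x. \<bar>\<phi>' x\<bar> \<le> 3/4 * decay_weight d x"
proof -
  define s where "s x = sqrt (1 + x\<^sup>2)" for x :: real
  define A where "A = 4 + 4 * d"
  define \<psi> where "\<psi> x = s x / 2 + ln (A + s x) / 2 + d * ln (ln (A + s x))" for x
  define \<psi>' where "\<psi>' x = x / s x * (1/2 + 1 / (2 * (A + s x)) + d / ((A + s x) * ln (A + s x)))" for x
  have s1: "s x \<ge> 1" "\<bar>x\<bar> \<le> s x" for x using bracket_bounds by (auto simp: s_def)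
  have A4: "A + s x \<ge> 4" "A + s x \<ge> A" for x using s1[of x] d by (auto simp: A_def)
  have l1: "ln (A + s x) \<ge> 1" for x by (rule ln_ge_one[OF A4(1)])
  have eq: "decay_weight d = (\<lambda>x. exp (\<psi> x))"
  proof
    fix x
    show "decay_weight d x = exp (\<psi> x)"
      using A4(1)[of x] l1[of x]
      by (simp add: decay_weight_def \<psi>_def exp_add powr_def flip: s_def A_def)
  qed
  have ds: "(s has_real_derivative x / s x) (at x)" for x
  proof -
    have p: "0 < 1 + x\<^sup>2" by (rule add_pos_nonneg) auto
    then show ?thesis unfolding s_def[abs_def] by (auto intro!: derivative_eq_intros simp: field_simps)
  qed
  have d\<psi>: "(\<psi> has_real_derivative \<psi>' x) (at x)" for x
  proof -
    have p: "A + s x > 0" "ln (A + s x) > 0" using A4(1)[of x] l1[of x] by auto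
    have d0: "((\<lambda>x. A + s x) has_real_derivative x / s x) (at x)"
      using DERIV_add[OF DERIV_const ds] by simp
    note d1 = DERIV_chain2[OF DERIV_ln_divide[OF p(1)] d0]
    note d2 = DERIV_chain2[OF DERIV_ln_divide[OF p(2)] d1]
    have alg: "X / 2 + 1 / Z * X / 2 + d * (1 / l * (1 / Z * X)) = X * (1/2 + 1 / (2 * Z) + d / (Z * l))"
      for X Z l :: real by (simp add: distrib_left mult_ac)
    show ?thesis
      unfolding \<psi>_def[abs_def] \<psi>'_def alg[symmetric]
      by (intro DERIV_add DERIV_cdivide DERIV_cmult ds d1 d2)
  qed
  have b: "\<bar>\<psi>' x\<bar> \<le> 3/4" for x
  proof -
    have "\<bar>\<psi>' x\<bar> = \<bar>x\<bar> / s x * \<bar>1/2 + 1 / (2 * (A + s x)) + d / ((A + s x) * ln (A + s x))\<bar>"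
      using s1(1)[of x] by (simp add: \<psi>'_def abs_mult abs_divide)
    also have "\<dots> \<le> 1 * (3/4)"
    proof (rule mult_mono)
      show "\<bar>x\<bar> / s x \<le> 1" using s1[of x] by (simp add: divide_le_eq)
      have A0: "A > 0" using d by (simp add: A_def)
      have "1 / (2 * (A + s x)) \<le> 1 / (2 * A)"
        using A4(2)[of x] A0 by (intro divide_left_mono) auto
      moreover have "d / ((A + s x) * ln (A + s x)) \<le> d / (A * 1)"
        using A4[of x] A0 d l1[of x] by (intro divide_left_mono mult_mono mult_pos_pos) auto
      moreover have "1 / (2 * A) + d / (A * 1) \<le> 1/4"
      proof -
        have "1 / (2 * A) + d / (A * 1) = (1/2 + d) / A" by (simp add: add_divide_distrib)
        also have "\<dots> \<le> 1/4" using A0 d by (subst divide_le_eq) (simp add: A_def)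
        finally show ?thesis .
      qed
      moreover have "0 \<le> 1 / (2 * (A + s x))" "0 \<le> d / ((A + s x) * ln (A + s x))"
        using A4(1)[of x] d l1[of x] by auto
      ultimately show "\<bar>1/2 + 1 / (2 * (A + s x)) + d / ((A + s x) * ln (A + s x))\<bar> \<le> 3/4" by linarith
    qed (use s1(1)[of x] in auto)
    finally show ?thesis by simp
  qed
  show ?thesis
  proof (rule that[of "\<lambda>x. exp (\<psi> x) * \<psi>' x"])
    show "(decay_weight d has_real_derivative exp (\<psi> x) * \<psi>' x) (at x)" for x
      unfolding eq by (auto intro!: derivative_eq_intros d\<psi>)
    show "\<bar>exp (\<psi> x) * \<psi>' x\<bar> \<le> 3/4 * decay_weight d x" for x
      unfolding eq using mult_left_mono[OF b[of x], of "exp (\<psi> x)"] by (simp add: abs_mult)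
  qed
qed

lemma weighted_le_decay_weight:
  assumes d: "d > 0"
  shows "weighted d h x \<le> decay_weight d x * (\<bar>h x\<bar> + \<bar>deriv h x\<bar>)"
  unfolding weighted_def decay_weight_def
  using bracket_bounds[of x] d
  by (intro mult_right_mono mult_mono powr_mono2) auto

text \<open>A comparison with the weight in \<open>weighted\<close> is possible only away from 0,
  where that weight vanishes; near 0 mere boundedness has to serve.\<close>

lemma decay_weight_le:
  assumes d: "d > 0"
  obtains M where "M > 0" "\<And>x. \<bar>x\<bar> \<le> 1 \<Longrightarrow> decay_weight d x \<le> M"
    "\<And>x. \<bar>x\<bar> \<ge> 1 \<Longrightarrow> decay_weight d x \<le>
       M * (exp (\<bar>x\<bar> / 2) * (1 + \<bar>x\<bar>) powr (1/2) * ln (1 + \<bar>x\<bar>) powr d)"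
proof -
  define A where "A = 4 + 4 * d"
  have A: "A > 0" using d by (simp add: A_def)
  \<comment> \<open>For \<open>\<bar>x\<bar> \<ge> 1\<close> one has
    \<open>ln 2 \<le> ln (1 + \<bar>x\<bar>)\<close>, so the additive constant
    \<open>ln (A + 1)\<close> is absorbed into a multiple of
    \<open>ln (1 + \<bar>x\<bar>)\<close>.\<close>
  define m where "m = ln (A + 1) / ln 2 + 1"
  have m: "m > 0" using A unfolding m_def by (intro add_nonneg_pos) auto
  define M1 where "M1 = exp (1/2) * (A + 1) powr (1/2) * m powr d"
  have M1: "M1 > 0" using A m by (simp add: M1_def)
  show ?thesis
  proof (rule that[of "max M1 (decay_weight d 1)"])
    show "0 < max M1 (decay_weight d 1)" using M1 by simp
    show "decay_weight d x \<le> max M1 (decay_weight d 1)" if "\<bar>x\<bar> \<le> 1" for x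
    proof -
      have "x\<^sup>2 \<le> 1\<^sup>2" using that by (simp add: abs_square_le_1)
      then have s: "sqrt (1 + x\<^sup>2) \<le> sqrt (1 + 1\<^sup>2)" by simp
      have "decay_weight d x \<le> decay_weight d 1"
      proof -
        have z: "4 + 4 * d + sqrt (1 + x\<^sup>2) \<ge> 4" using d bracket_bounds(2)[of x] by simp
        have "ln (4 + 4 * d + sqrt (1 + x\<^sup>2)) \<le> ln (4 + 4 * d + sqrt (1 + 1\<^sup>2))"
          using z s by (subst ln_le_cancel_iff) linarith+
        then show ?thesis
          unfolding decay_weight_def using s d z ln_ge_one[OF z]
          by (intro mult_mono powr_mono2) auto
      qed
      then show ?thesis by simp
    qed
    show "decay_weight d x \<le> max M1 (decay_weight d 1) * (exp (\<bar>x\<bar> / 2) * (1 + \<bar>x\<bar>) powr (1/2) * ln (1 + \<bar>x\<bar>) powr d)"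
      if x: "\<bar>x\<bar> \<ge> 1" for x
    proof -
      have b: "A + sqrt (1 + x\<^sup>2) \<le> (A + 1) * (1 + \<bar>x\<bar>)"
      proof -
        have "(A + 1) * (1 + \<bar>x\<bar>) = A + A * \<bar>x\<bar> + 1 + \<bar>x\<bar>" by (simp add: algebra_simps)
        moreover have "0 \<le> A * \<bar>x\<bar>" using A by simp
        ultimately show ?thesis using bracket_bounds(3)[of x] by linarith
      qed
      have l: "ln (A + sqrt (1 + x\<^sup>2)) \<le> m * ln (1 + \<bar>x\<bar>)"
      proof -
        have "ln (A + sqrt (1 + x\<^sup>2)) \<le> ln ((A + 1) * (1 + \<bar>x\<bar>))"
        proof (subst ln_le_cancel_iff)
          show "0 < A + sqrt (1 + x\<^sup>2)" using A bracket_bounds(2)[of x] by linarith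
        qed (use b A in \<open>auto intro: mult_pos_pos\<close>)
        also have "\<dots> = ln (A + 1) + ln (1 + \<bar>x\<bar>)" using A by (simp add: ln_mult)
        also have "\<dots> \<le> ln (A + 1) / ln 2 * ln (1 + \<bar>x\<bar>) + ln (1 + \<bar>x\<bar>)"
        proof -
          have "ln 2 \<le> ln (1 + \<bar>x\<bar>)" using x by simp
          then have "ln (A + 1) / ln 2 * ln 2 \<le> ln (A + 1) / ln 2 * ln (1 + \<bar>x\<bar>)"
            using A by (intro mult_left_mono) auto
          then show ?thesis by simp
        qed
        finally show ?thesis by (simp add: m_def algebra_simps)
      qed
      have "decay_weight d x \<le> exp (1/2 + \<bar>x\<bar> / 2) * ((A + 1) * (1 + \<bar>x\<bar>)) powr (1/2) * (m * ln (1 + \<bar>x\<bar>)) powr d"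
        unfolding decay_weight_def A_def[symmetric] using b l d A m bracket_bounds[of x] ln_ge_one[of "A + sqrt (1 + x\<^sup>2)"]
        by (intro mult_mono powr_mono2) (auto simp: A_def)
      also have "\<dots> = M1 * (exp (\<bar>x\<bar> / 2) * (1 + \<bar>x\<bar>) powr (1/2) * ln (1 + \<bar>x\<bar>) powr d)"
        using A m x by (simp add: M1_def powr_mult exp_add)
      also have "\<dots> \<le> max M1 (decay_weight d 1) * (exp (\<bar>x\<bar> / 2) * (1 + \<bar>x\<bar>) powr (1/2) * ln (1 + \<bar>x\<bar>) powr d)"
        by (intro mult_right_mono) auto
      finally show ?thesis .
    qed
  qed
qed

text \<open>\<open>q\<close> is the derivative of
  \<open>ln (exp 1 + y) powr (1 - 2 * d) / (1 - 2 * d)\<close>, which tends to 0 at infinity because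
  \<open>d > 1/2\<close>; the shift by \<open>exp 1\<close> keeps the logarithm at least 1. The last
  claim is the form in which the squared weight is played against
  \<open>exp \<bar>x\<bar>\<close>.\<close>

lemma integrable_inverse_decay:
  fixes d :: real
  assumes d: "d > 1/2"
  defines "q \<equiv> \<lambda>y::real. 1 / ((exp 1 + y) * ln (exp 1 + y) powr (2 * d))"
  shows "integrable lborel (\<lambda>x. q \<bar>x\<bar>)" and "((\<lambda>x. q \<bar>x\<bar>) \<longlongrightarrow> 0) at_top"
    and "exp \<bar>x\<bar> / (decay_weight d x)\<^sup>2 \<le> q \<bar>x\<bar>"
proof -
  have l1: "1 \<le> ln (exp 1 + y)" if "y \<ge> 0" for y :: real
    using that by (subst ln_ge_iff) (auto intro: add_pos_nonneg)
  have "has_bochner_integral lborel (\<lambda>x. q \<bar>x\<bar>) (2 * (0 - ln (exp 1 + 0) powr (1 - 2 * d) / (1 - 2 * d)))"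
  proof (rule has_bochner_integral_even_FTC[where Q = "\<lambda>y. ln (exp 1 + y) powr (1 - 2 * d) / (1 - 2 * d)"])
    show "q \<in> borel_measurable borel" unfolding q_def by measurable
    show "((\<lambda>y. ln (exp 1 + y) powr (1 - 2 * d) / (1 - 2 * d)) has_real_derivative q y) (at y)" if y: "y \<ge> 0" for y
    proof -
      have p: "exp 1 + y > 0" using y by (intro add_pos_nonneg) auto
      have dl: "((\<lambda>y. ln (exp 1 + y)) has_real_derivative 1 / (exp 1 + y)) (at y)"
        using p by (auto intro!: derivative_eq_intros)
      have "((\<lambda>y. ln (exp 1 + y) powr (1 - 2 * d)) has_real_derivative
        (1 - 2 * d) * ln (exp 1 + y) powr (1 - 2 * d - 1) * (1 / (exp 1 + y))) (at y)"
        using DERIV_fun_powr[OF dl, of "1 - 2 * d"] l1[OF y] by simp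
      moreover have "1 - 2 * d - 1 = - (2 * d)" by simp
      ultimately show ?thesis
        using d by (intro DERIV_cong[OF DERIV_cdivide]) (auto simp: q_def powr_minus_divide)
    qed
    show "q y \<ge> 0" if "y \<ge> 0" for y using that by (simp add: q_def add_nonneg_nonneg)
    show "((\<lambda>y. ln (exp 1 + y) powr (1 - 2 * d) / (1 - 2 * d)) \<longlongrightarrow> 0) at_top"
      using d by real_asymp
  qed
  then show "integrable lborel (\<lambda>x. q \<bar>x\<bar>)" by (auto simp: has_bochner_integral_iff)
  have "(q \<longlongrightarrow> 0) at_top" unfolding q_def using d by real_asymp
  then show "((\<lambda>x. q \<bar>x\<bar>) \<longlongrightarrow> 0) at_top"
    by (rule Lim_transform_eventually) (auto intro!: eventually_mono[OF eventually_ge_at_top[of 0]])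
  let ?s = "sqrt (1 + x\<^sup>2)"
  let ?z = "4 + 4 * d + ?s"
  have z: "?z \<ge> 4" "?z > 0" using bracket_bounds(2)[of x] d by linarith+
  have zx: "exp 1 + \<bar>x\<bar> \<le> ?z" using bracket_bounds(1)[of x] d exp_le by linarith
  have pp: "0 < exp 1 + \<bar>x\<bar>" by (intro add_pos_nonneg) auto
  have sq: "(decay_weight d x)\<^sup>2 = exp ?s * (?z * ln ?z powr (2 * d))"
  proof -
    have "(exp (?s / 2))\<^sup>2 = exp ?s" by (simp add: power2_eq_square flip: exp_add)
    moreover have "(?z powr (1/2))\<^sup>2 = ?z" using z by (simp add: power2_eq_square flip: powr_add)
    moreover have "(ln ?z powr d)\<^sup>2 = ln ?z powr (2 * d)" by (simp add: power2_eq_square flip: powr_add)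
    ultimately show ?thesis unfolding decay_weight_def power_mult_distrib by (simp only: mult.assoc)
  qed
  have "exp \<bar>x\<bar> / (decay_weight d x)\<^sup>2 \<le> exp ?s / (exp ?s * (?z * ln ?z powr (2 * d)))"
    unfolding sq using bracket_bounds(1)[of x] z by (intro divide_right_mono) auto
  also have "\<dots> = 1 / (?z * ln ?z powr (2 * d))" by simp
  also have "\<dots> \<le> q \<bar>x\<bar>"
    unfolding q_def
  proof (rule divide_left_mono)
    show "(exp 1 + \<bar>x\<bar>) * ln (exp 1 + \<bar>x\<bar>) powr (2 * d) \<le> ?z * ln ?z powr (2 * d)"
      using zx z pp d l1[of "\<bar>x\<bar>"] exp_ge_add_one_self[of 1] by (intro mult_mono powr_mono2) auto
    show "0 < (?z * ln ?z powr (2 * d)) * ((exp 1 + \<bar>x\<bar>) * ln (exp 1 + \<bar>x\<bar>) powr (2 * d))"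
      using z pp ln_ge_one[OF z(1)] l1[of "\<bar>x\<bar>"] by (intro mult_pos_pos) auto
  qed simp
  finally show "exp \<bar>x\<bar> / (decay_weight d x)\<^sup>2 \<le> q \<bar>x\<bar>" .
qed

text \<open>The weight is unbounded, hence the truncations \<open>N \<phi> / (N + \<phi>)\<close>, which satisfy the same
  differential inequality.\<close>

lemma (in transport) decay_estimate:
  assumes d: "d > 0"
    and S: "\<And>x. decay_weight d x * (\<bar>u 0 x\<bar> + \<bar>p 0 x\<bar>) \<le> S" and t: "t \<in> {0..T}"
  shows "decay_weight d x * (\<bar>u t x\<bar> + \<bar>p t x\<bar>) \<le> 8 * S * exp (84 * C * T)"
proof -
  define \<phi> where "\<phi> = decay_weight d"
  obtain \<phi>' where \<phi>': "\<And>x. (\<phi> has_real_derivative \<phi>' x) (at x)" "\<And>x. \<bar>\<phi>' x\<bar> \<le> 3/4 * \<phi> x"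
    using decay_weight_deriv[OF d] unfolding \<phi>_def by metis
  have \<phi>0: "\<phi> x > 0" for x using decay_weight_pos[OF d] by (simp add: \<phi>_def)
  have N: "\<phi> x * N / (N + \<phi> x) * (\<bar>u t x\<bar> + \<bar>p t x\<bar>) \<le> 8 * S * exp (84 * C * T)" if N: "N > 0" for N
  proof (rule weighted_estimate[where \<phi> = "\<lambda>x. \<phi> x * N / (N + \<phi> x)" and \<phi>' = "\<lambda>x. \<phi>' x * (N / (N + \<phi> x))\<^sup>2" and N = N])
    have Np: "N + \<phi> x > 0" for x using \<phi>0[of x] N by simp
    show "0 < \<phi> x * N / (N + \<phi> x)" for x using \<phi>0[of x] N by simp
    show "((\<lambda>x. \<phi> x * N / (N + \<phi> x)) has_real_derivative \<phi>' x * (N / (N + \<phi> x))\<^sup>2) (at x)" for x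
      by (rule DERIV_cong[OF DERIV_divide[OF DERIV_mult[OF \<phi>'(1) DERIV_const] DERIV_add[OF DERIV_const \<phi>'(1)]]])
        (use Np[of x] in \<open>auto simp: power2_eq_square algebra_simps divide_simps\<close>)
    show "\<bar>\<phi>' x * (N / (N + \<phi> x))\<^sup>2\<bar> \<le> 3/4 * (\<phi> x * N / (N + \<phi> x))" for x
    proof -
      \<comment> \<open>Differentiating the truncation yields \<open>r\<^sup>2\<close>; one factor
        belongs to the truncated weight, the other is at most 1.\<close>
      define r where "r = N / (N + \<phi> x)"
      have r: "0 \<le> r" "r \<le> 1" using N \<phi>0[of x] Np[of x] by (auto simp: r_def divide_le_eq)
      have "\<bar>\<phi>' x * r\<^sup>2\<bar> = \<bar>\<phi>' x\<bar> * (r * r)" by (simp add: abs_mult power2_eq_square)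
      also have "\<dots> \<le> (3/4 * \<phi> x) * (r * 1)"
        using \<phi>'(2)[of x] r \<phi>0[of x] by (intro mult_mono) auto
      finally show ?thesis by (simp add: r_def)
    qed
    show "\<phi> x * N / (N + \<phi> x) \<le> N" for x
      using \<phi>0[of x] N Np[of x] by (simp add: divide_le_eq algebra_simps)
    show "\<phi> x * N / (N + \<phi> x) * (\<bar>u 0 x\<bar> + \<bar>p 0 x\<bar>) \<le> S" for x
    proof -
      have "\<phi> x * N / (N + \<phi> x) \<le> \<phi> x"
        using \<phi>0[of x] N Np[of x] by (simp add: divide_le_eq algebra_simps)
      then have "\<phi> x * N / (N + \<phi> x) * (\<bar>u 0 x\<bar> + \<bar>p 0 x\<bar>) \<le> \<phi> x * (\<bar>u 0 x\<bar> + \<bar>p 0 x\<bar>)"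
        by (intro mult_right_mono) auto
      then show ?thesis using S[of x] by (simp add: \<phi>_def)
    qed
  qed (rule t)
  have "((\<lambda>N. \<phi> x * N / (N + \<phi> x)) \<longlongrightarrow> \<phi> x) at_top" by real_asymp
  then have "((\<lambda>N. \<phi> x * N / (N + \<phi> x) * (\<bar>u t x\<bar> + \<bar>p t x\<bar>)) \<longlongrightarrow> \<phi> x * (\<bar>u t x\<bar> + \<bar>p t x\<bar>)) at_top"
    by (rule tendsto_mult_right)
  then have "\<phi> x * (\<bar>u t x\<bar> + \<bar>p t x\<bar>) \<le> 8 * S * exp (84 * C * T)"
    by (rule tendsto_upperbound) (use N in \<open>auto intro!: eventually_mono[OF eventually_gt_at_top[of 0]]\<close>)
  then show ?thesis by (simp add: \<phi>_def)
qed

section \<open>Persistence of decay and asymptotic profile\<close>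

lemma smooth_deriv:
  assumes "smooth f"
  shows "(f has_real_derivative deriv f x) (at x)"
    and "(deriv f has_real_derivative deriv (deriv f) x) (at x)"
    and "continuous_on UNIV (deriv (deriv f))"
proof -
  have d: "(deriv ^^ n) f differentiable (at x)" for n x using assms by (auto simp: smooth_def)
  show "(f has_real_derivative deriv f x) (at x)"
    using d[of 0 x] by (simp add: DERIV_deriv_iff_real_differentiable)
  show "(deriv f has_real_derivative deriv (deriv f) x) (at x)"
    using d[of "Suc 0" x] by (simp add: DERIV_deriv_iff_real_differentiable)
  show "continuous_on UNIV (deriv (deriv f))"
    using d[of "Suc (Suc 0)"] by (auto intro!: continuous_at_imp_continuous_on differentiable_imp_continuous_within)
qed

lemma Lipschitz_on_interval:
  fixes k k' :: "real \<Rightarrow> real"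
  assumes d: "\<And>x. (k has_real_derivative k' x) (at x)" and b: "\<And>x. \<bar>x\<bar> \<le> b \<Longrightarrow> \<bar>k' x\<bar> \<le> L"
    and v: "\<bar>v\<bar> \<le> b" "\<bar>w\<bar> \<le> b"
  shows "\<bar>k v - k w\<bar> \<le> L * \<bar>v - w\<bar>"
proof -
  have "norm (k v - k w) \<le> L * norm (v - w)"
    by (rule field_differentiable_bound[of "{-b..b}" k k'])
      (use b v in \<open>auto intro!: has_field_derivative_at_within[OF d]\<close>)
  then show ?thesis by simp
qed

text \<open>Mean value bounds on [-b, b], with \<open>deriv f\<close> and \<open>g\<close> vanishing
  at 0. A single constant serves all conditions of \<open>transport\<close> and refers to no
  solution.\<close>

lemma smooth_flux_constants:
  assumes f: "smooth f" "deriv f 0 = 0" and g: "smooth g" "g 0 = 0"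
  shows "\<exists>L>0. (\<forall>v. \<bar>v\<bar> \<le> b \<longrightarrow> \<bar>deriv f v\<bar> \<le> L * \<bar>v\<bar>)
    \<and> (\<forall>v w. \<bar>v\<bar> \<le> b \<longrightarrow> \<bar>w\<bar> \<le> b \<longrightarrow> \<bar>deriv f v - deriv f w\<bar> \<le> L * \<bar>v - w\<bar>)
    \<and> (\<forall>v. \<bar>v\<bar> \<le> b \<longrightarrow> deriv (deriv f) v \<le> 2 * L)
    \<and> (\<forall>v. \<bar>v\<bar> \<le> b \<longrightarrow> g v \<le> L * \<bar>v\<bar>)"
proof -
  have bd: "\<exists>B. \<forall>v. \<bar>v\<bar> \<le> b \<longrightarrow> \<bar>k v\<bar> \<le> B" if "continuous_on UNIV k" for k :: "real \<Rightarrow> real"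
  proof -
    have "bounded (k ` {-b..b})"
      by (intro compact_imp_bounded compact_continuous_image continuous_on_subset[OF that]) auto
    then obtain B where "\<And>v. v \<in> {-b..b} \<Longrightarrow> \<bar>k v\<bar> \<le> B"
      unfolding bounded_iff by fastforce
    then show ?thesis by (intro exI[of _ B]) (auto simp: abs_le_iff)
  qed
  obtain B1 where B1: "\<And>v. \<bar>v\<bar> \<le> b \<Longrightarrow> \<bar>deriv (deriv f) v\<bar> \<le> B1"
    using bd[OF smooth_deriv(3)[OF f(1)]] by blast
  have "continuous_on UNIV (deriv g)"
    by (intro continuous_at_imp_continuous_on ballI DERIV_isCont[OF smooth_deriv(2)[OF g(1)]])
  then obtain B2 where B2: "\<And>v. \<bar>v\<bar> \<le> b \<Longrightarrow> \<bar>deriv g v\<bar> \<le> B2"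
    using bd by blast
  define L where "L = \<bar>B1\<bar> + \<bar>B2\<bar> + 1"
  have L1: "\<bar>deriv (deriv f) v\<bar> \<le> L" and L2: "\<bar>deriv g v\<bar> \<le> L" if "\<bar>v\<bar> \<le> b" for v
    using B1[OF that] B2[OF that] by (auto simp: L_def)
  have Lf: "\<bar>deriv f v - deriv f w\<bar> \<le> L * \<bar>v - w\<bar>" if "\<bar>v\<bar> \<le> b" "\<bar>w\<bar> \<le> b" for v w
    by (rule Lipschitz_on_interval[OF smooth_deriv(2)[OF f(1)] L1 that])
  have Lg: "\<bar>g v - g w\<bar> \<le> L * \<bar>v - w\<bar>" if "\<bar>v\<bar> \<le> b" "\<bar>w\<bar> \<le> b" for v w
    by (rule Lipschitz_on_interval[OF smooth_deriv(1)[OF g(1)] L2 that])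
  show ?thesis
  proof (intro exI[of _ L] conjI allI impI)
    show "L > 0" by (simp add: L_def)
    show "\<bar>deriv f v\<bar> \<le> L * \<bar>v\<bar>" if "\<bar>v\<bar> \<le> b" for v
    proof -
      have "\<bar>0\<bar> \<le> b" using that by linarith
      from Lf[OF that this] f(2) show ?thesis by simp
    qed
    show "g v \<le> L * \<bar>v\<bar>" if "\<bar>v\<bar> \<le> b" for v
    proof -
      have "\<bar>0\<bar> \<le> b" using that by linarith
      from Lg[OF that this] g(2) show ?thesis by simp
    qed
    show "deriv (deriv f) v \<le> 2 * L" if "\<bar>v\<bar> \<le> b" for v
    proof -
      have "L \<ge> 0" by (simp add: L_def)
      then show ?thesis using L1[OF that] by linarith
    qed
  qed (rule Lf)
qed

text \<open>Supplies the integrable majorant of \<open>asymptotics_at_top\<close>, the same for all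
  times.\<close>

lemma squares_decay:
  assumes d: "d > 1/2" and R: "decay_weight d y * (\<bar>v\<bar> + \<bar>w\<bar>) \<le> R"
  shows "exp \<bar>y\<bar> * (v\<^sup>2 + w\<^sup>2) \<le> R\<^sup>2 * (1 / ((exp 1 + \<bar>y\<bar>) * ln (exp 1 + \<bar>y\<bar>) powr (2 * d)))"
proof -
  let ?\<phi> = "decay_weight d y"
  have \<phi>: "?\<phi> > 0" using decay_weight_pos d by simp
  have "v\<^sup>2 + w\<^sup>2 \<le> (\<bar>v\<bar> + \<bar>w\<bar>)\<^sup>2" by (simp add: power2_sum)
  also have "\<dots> \<le> (R / ?\<phi>)\<^sup>2"
    using R \<phi> by (intro power_mono) (auto simp: field_simps)
  finally have "exp \<bar>y\<bar> * (v\<^sup>2 + w\<^sup>2) \<le> exp \<bar>y\<bar> * (R / ?\<phi>)\<^sup>2"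
    by (intro mult_left_mono) auto
  also have "\<dots> = R\<^sup>2 * (exp \<bar>y\<bar> / ?\<phi>\<^sup>2)" by (simp add: power_divide)
  also have "\<dots> \<le> R\<^sup>2 * (1 / ((exp 1 + \<bar>y\<bar>) * ln (exp 1 + \<bar>y\<bar>) powr (2 * d)))"
    by (intro mult_left_mono integrable_inverse_decay(3)[OF d]) auto
  finally show ?thesis .
qed

text \<open>At \<open>t = 0\<close> the estimate bounds the data themselves, so \<open>K\<close> has
  to see their weighted size. The second argument enters through the Lipschitz constants on the
  range of \<open>u\<close>, and through a neighbourhood of \<open>x = 0\<close>, where the weight
  in \<open>weighted\<close> gives no control. By the order of quantifiers \<open>K\<close> is
  chosen before \<open>s\<close>, \<open>u0\<close> and \<open>u\<close>.\<close>

theorem theorem2p3: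
  fixes f g :: "real \<Rightarrow> real" and T d :: real
  assumes "smooth f" and "smooth g"
    and "f 0 = 0" and "\<And>x. deriv (deriv f) x \<ge> 0"
    and "\<And>x. g x \<ge> 0" and "\<And>x. g x = 0 \<longleftrightarrow> x = 0"
    and "deriv f 0 = 0"
    and "T > 0" and "d > 1/2"
  shows "\<exists>K :: real \<Rightarrow> real \<Rightarrow> real. (\<forall>a b. K a b > 0) \<and>
    (\<forall>s u0 u.
       s > 3/2 \<longrightarrow>
       u0 \<in> Hs s \<longrightarrow>
       (\<exists>x. u0 x \<noteq> 0) \<longrightarrow>
       bdd_above (range (weighted d u0)) \<longrightarrow>
       C0_Hs T s u \<longrightarrow>
       solves f g T u0 u \<longrightarrow>
       (\<exists>c>0. \<forall>t\<in>{0..T}. \<forall>x. g (u t x) \<le> c * (u t x)\<^sup>2) \<longrightarrow>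
       (\<forall>t\<in>{0..T}. \<forall>x. weighted d (u t) x \<le>
          K (SUP y. weighted d u0 y)
            (SUP (\<tau>, y)\<in>{0..T} \<times> UNIV. \<bar>u \<tau> y\<bar> + \<bar>deriv (u \<tau>) y\<bar>)) \<and>
       (\<exists>\<Phi>p \<Phi>m :: real \<Rightarrow> real. \<exists>\<epsilon>p \<epsilon>m :: real \<Rightarrow> real \<Rightarrow> real. \<exists>R :: real \<Rightarrow> real.
          continuous_on {0..T} \<Phi>p \<and> continuous_on {0..T} \<Phi>m \<and>
          continuous_on ({0..T} \<times> UNIV) (\<lambda>(t, x). \<epsilon>p t x) \<and>
          continuous_on ({0..T} \<times> UNIV) (\<lambda>(t, x). \<epsilon>m t x) \<and>
          continuous_on UNIV R \<and>
          (\<forall>t\<in>{0..T}. \<forall>x>0. u t x = u0 x + t * exp (- \<bar>x\<bar>) * (\<Phi>p t + \<epsilon>p t x + R x)) \<and>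
          (\<forall>t\<in>{0..T}. \<forall>x<0. u t x = u0 x - t * exp (- \<bar>x\<bar>) * (\<Phi>m t + \<epsilon>m t x + R x)) \<and>
          (\<forall>t\<in>{0..T}. \<Phi>p t \<ge> 0 \<and> \<Phi>m t \<ge> 0) \<and>
          (\<forall>t0\<in>{0..T}. \<Phi>p t0 = 0 \<longleftrightarrow> (\<forall>x. u t0 x = 0)) \<and>
          (\<forall>t0\<in>{0..T}. \<Phi>m t0 = 0 \<longleftrightarrow> (\<forall>x. u t0 x = 0)) \<and>
          (\<forall>t\<in>{0..T}. (\<epsilon>p t \<longlongrightarrow> 0) at_top) \<and>
          (\<forall>t\<in>{0..T}. (\<epsilon>m t \<longlongrightarrow> 0) at_bot) \<and>
          (\<exists>c1\<ge>0. \<exists>c2\<ge>0. \<forall>t\<in>{0..T}.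
             c1 \<le> \<Phi>p t \<and> \<Phi>p t \<le> c2 \<and> c1 \<le> \<Phi>m t \<and> \<Phi>m t \<le> c2) \<and>
          sim_O R (\<lambda>x. ln (1 + \<bar>x\<bar>) powr (- d) * (1 + \<bar>x\<bar>) powr (- 1)) at_top \<and>
          sim_O R (\<lambda>x. ln (1 + \<bar>x\<bar>) powr (- d) * (1 + \<bar>x\<bar>) powr (- 1)) at_bot))"
proof -
  have d0: "d > 0" using assms by simp
  have g0: "g 0 = 0" using assms(6) by simp
  obtain M where M: "M > 0" "\<And>x. \<bar>x\<bar> \<le> 1 \<Longrightarrow> decay_weight d x \<le> M"
    "\<And>x. \<bar>x\<bar> \<ge> 1 \<Longrightarrow> decay_weight d x \<le>
       M * (exp (\<bar>x\<bar> / 2) * (1 + \<bar>x\<bar>) powr (1/2) * ln (1 + \<bar>x\<bar>) powr d)"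
    by (rule decay_weight_le[OF d0]) blast
  \<comment> \<open>The constants are fixed as a function of the bound before any solution
    appears.\<close>
  obtain L where L: "\<And>b. L b > 0" "\<And>b v. \<bar>v\<bar> \<le> b \<Longrightarrow> \<bar>deriv f v\<bar> \<le> L b * \<bar>v\<bar>"
    "\<And>b v w. \<bar>v\<bar> \<le> b \<Longrightarrow> \<bar>w\<bar> \<le> b \<Longrightarrow> \<bar>deriv f v - deriv f w\<bar> \<le> L b * \<bar>v - w\<bar>"
    "\<And>b v. \<bar>v\<bar> \<le> b \<Longrightarrow> deriv (deriv f) v \<le> 2 * L b"
    "\<And>b v. \<bar>v\<bar> \<le> b \<Longrightarrow> g v \<le> L b * \<bar>v\<bar>"
    using smooth_flux_constants[OF assms(1,7,2) g0] by metis
  \<comment> \<open>The bound of \<open>decay_estimate\<close> with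
    \<open>S = M * (\<bar>a\<bar> + \<bar>b\<bar>)\<close> and the locale constant written out. The
    absolute values make it non-negative for all real arguments; the 1 added below makes it
    positive.\<close>
  define R where "R a b = 8 * (M * (\<bar>a\<bar> + \<bar>b\<bar>)) * exp (84 * (L \<bar>b\<bar> * (1 + \<bar>b\<bar>)) * T)" for a b
  have R0: "R a b \<ge> 0" for a b using M(1) by (simp add: R_def)
  show ?thesis
  proof (rule exI[of _ "\<lambda>a b. R a b + 1"], rule conjI, goal_cases)
    case 1
    show ?case using R0 by (simp add: add_nonneg_pos)
  next
    case 2
    show ?case
    proof (intro allI impI, goal_cases)
      case (1 s u0 u)
      then have s: "s > 3/2" and nz: "\<exists>x. u0 x \<noteq> 0" and bw: "bdd_above (range (weighted d u0))"
        and C0: "C0_Hs T s u" and sol: "solves f g T u0 u"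
        and gc: "\<exists>c>0. \<forall>t\<in>{0..T}. \<forall>x. g (u t x) \<le> c * (u t x)\<^sup>2" by auto
      define a where "a = (SUP y. weighted d u0 y)"
      define b where "b = (SUP (\<tau>, y)\<in>{0..T} \<times> UNIV. \<bar>u \<tau> y\<bar> + \<bar>deriv (u \<tau>) y\<bar>)"
      have uc: "continuous_on UNIV (u t)" if "t \<in> {0..T}" for t
        using sol that by (simp add: solves_def)
      have u0: "u 0 = u0" using sol by (auto simp: solves_def)
      note reg = C0_Hs_regularity[OF s C0 uc]
      have bdd: "bdd_above ((\<lambda>(\<tau>, y). \<bar>u \<tau> y\<bar> + \<bar>deriv (u \<tau>) y\<bar>) ` ({0..T} \<times> UNIV))"
        using reg(4) by (fastforce intro: bdd_aboveI)
      have ub: "\<bar>u t x\<bar> + \<bar>deriv (u t) x\<bar> \<le> \<bar>b\<bar>" if "t \<in> {0..T}" for t x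
      proof -
        have "\<bar>u t x\<bar> + \<bar>deriv (u t) x\<bar> \<le> b"
          using cSUP_upper[OF _ bdd, of "(t, x)"] that by (simp add: b_def)
        then show ?thesis by simp
      qed
      interpret tr: transport "deriv f" "deriv (deriv f)" g T 1 "L \<bar>b\<bar>" "\<bar>b\<bar>" u "\<lambda>t. deriv (u t)"
      proof
        show "continuous_on UNIV (deriv f)" "continuous_on UNIV g"
          by (intro continuous_at_imp_continuous_on ballI DERIV_isCont[OF smooth_deriv(2)[OF assms(1)]]
              DERIV_isCont[OF smooth_deriv(1)[OF assms(2)]])+
        show "continuous_on UNIV (deriv (deriv f))" by (rule smooth_deriv(3)[OF assms(1)])
        show "((\<lambda>\<tau>. u \<tau> x) has_real_derivative - 1 * (deriv f (u t x) * deriv (u t) x +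
           dx_inv_helmholtz (\<lambda>y. g (u t y) + deriv (deriv f) (u t y) / 2 * (deriv (u t) y)\<^sup>2) x)) (at t within {0..T})"
          if t: "t \<in> {0..T}" for t x
        proof -
          from sol t obtain ut where "((\<lambda>\<tau>. u \<tau> x) has_real_derivative ut) (at t within {0..T})"
            "ut + deriv f (u t x) * deriv (u t) x
               + dx_inv_helmholtz (\<lambda>y. g (u t y) + deriv (deriv f) (u t y) / 2 * (deriv (u t) y)\<^sup>2) x = 0"
            unfolding solves_def by blast
          then show ?thesis by (elim DERIV_cong) (simp only: mult_minus1 eq_neg_iff_add_eq_0 add.assoc)
        qed
      qed (use L reg(1-3) ub assms(4,5) in auto)
      \<comment> \<open>For \<open>\<bar>x\<bar> \<le> 1\<close> the sup bound \<open>b\<close> is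
        used, elsewhere the weighted size \<open>a\<close> of the data.\<close>
      have S: "decay_weight d x * (\<bar>u 0 x\<bar> + \<bar>deriv (u 0) x\<bar>) \<le> M * (\<bar>a\<bar> + \<bar>b\<bar>)" for x
      proof (cases "\<bar>x\<bar> \<le> 1")
        case True
        have "decay_weight d x * (\<bar>u 0 x\<bar> + \<bar>deriv (u 0) x\<bar>) \<le> M * \<bar>b\<bar>"
          by (rule mult_mono[OF M(2)[OF True] ub]) (use M(1) assms(8) in auto)
        also have "\<dots> \<le> M * (\<bar>a\<bar> + \<bar>b\<bar>)" using M(1) by (intro mult_left_mono) auto
        finally show ?thesis .
      next
        case False
        then have x: "\<bar>x\<bar> \<ge> 1" by simp
        have "decay_weight d x * (\<bar>u 0 x\<bar> + \<bar>deriv (u 0) x\<bar>) \<le> M * weighted d u0 x"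
          using mult_right_mono[OF M(3)[OF x], of "\<bar>u0 x\<bar> + \<bar>deriv u0 x\<bar>"]
          by (simp add: weighted_def u0 mult_ac)
        also have "weighted d u0 x \<le> a" unfolding a_def by (rule cSUP_upper[OF _ bw]) simp
        also have "a \<le> \<bar>a\<bar> + \<bar>b\<bar>" by simp
        finally show ?thesis using M(1) by simp
      qed
      have dec: "decay_weight d x * (\<bar>u t x\<bar> + \<bar>deriv (u t) x\<bar>) \<le> R a b" if "t \<in> {0..T}" for t x
        using tr.decay_estimate[OF d0 S that, of x] unfolding R_def tr.C_def .
      define D where "D y = (R a b)\<^sup>2 * (1 / ((exp 1 + \<bar>y\<bar>) * ln (exp 1 + \<bar>y\<bar>) powr (2 * d)))" for y :: real
      have D: "integrable lborel D" "(D \<longlongrightarrow> 0) at_top"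
        using integrable_mult_right[OF integrable_inverse_decay(1)[OF assms(9)], of "(R a b)\<^sup>2"]
          tendsto_mult_left[OF integrable_inverse_decay(2)[OF assms(9)], of "(R a b)\<^sup>2"]
        unfolding D_def[abs_def] by simp_all
      have uD: "exp \<bar>y\<bar> * ((u t y)\<^sup>2 + (deriv (u t) y)\<^sup>2) \<le> D y" if "t \<in> {0..T}" for t y
        unfolding D_def by (rule squares_decay[OF assms(9) dec[OF that]])
      obtain c where c: "c > 0" "\<And>t x. t \<in> {0..T} \<Longrightarrow> g (u t x) \<le> c * (u t x)\<^sup>2" using gc by blast
      obtain x0 where "u0 x0 \<noteq> 0" using nz by blast
      then have gx0: "g (u 0 x0) > 0" using assms(5)[of "u0 x0"] assms(6)[of "u0 x0"] unfolding u0 by linarith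
      have alive: "\<not> (\<forall>x. u t0 x = 0)" if "t0 \<in> {0..T}" for t0
        using tr.backward_uniqueness[OF that] \<open>u0 x0 \<noteq> 0\<close> unfolding u0 by blast
      obtain \<Phi>p \<epsilon>p where P: "continuous_on {0..T} \<Phi>p" "continuous_on ({0..T} \<times> UNIV) (\<lambda>(t, x). \<epsilon>p t x)"
        "\<And>t x. t \<in> {0..T} \<Longrightarrow> u t x = u 0 x + 1 * (t * exp (- \<bar>x\<bar>) * (\<Phi>p t + \<epsilon>p t x))"
        "\<And>t. t \<in> {0..T} \<Longrightarrow> \<Phi>p t > 0" "\<And>t. t \<in> {0..T} \<Longrightarrow> (\<epsilon>p t \<longlongrightarrow> 0) at_top"
        by (rule tr.asymptotics_at_top[OF D uD c gx0 assms(8)]) blast+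
      \<comment> \<open>The reflected solution turns the asymptotics at plus infinity into those at
        minus infinity; its non-zero initial value sits at \<open>- x0\<close>, and the remainder is
        reflected back afterwards.\<close>
      interpret ref: transport "deriv f" "deriv (deriv f)" g T "- 1" "L \<bar>b\<bar>" "\<bar>b\<bar>"
        "\<lambda>t x. u t (- x)" "\<lambda>t x. - deriv (u t) (- x)"
        by (rule tr.transport_reflect)
      have uD': "exp \<bar>y\<bar> * ((u t (- y))\<^sup>2 + (- deriv (u t) (- y))\<^sup>2) \<le> D y" if "t \<in> {0..T}" for t y
        using uD[OF that, of "- y"] by (simp add: D_def)
      have gx0': "g (u 0 (- (- x0))) > 0" using gx0 by simp
      obtain \<Phi>m \<epsilon> where Q: "continuous_on {0..T} \<Phi>m" "continuous_on ({0..T} \<times> UNIV) (\<lambda>(t, x). \<epsilon> t x)"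
        "\<And>t x. t \<in> {0..T} \<Longrightarrow> u t (- x) = u 0 (- x) + - 1 * (t * exp (- \<bar>x\<bar>) * (\<Phi>m t + \<epsilon> t x))"
        "\<And>t. t \<in> {0..T} \<Longrightarrow> \<Phi>m t > 0" "\<And>t. t \<in> {0..T} \<Longrightarrow> (\<epsilon> t \<longlongrightarrow> 0) at_top"
        by (rule ref.asymptotics_at_top[OF D uD' c(1) c(2) gx0' assms(8)]) blast+
      have ec: "continuous_on ({0..T} \<times> UNIV) (\<lambda>(t, x). \<epsilon> t (- x))"
      proof -
        have c: "continuous_on ({0..T} \<times> UNIV) (\<lambda>q::real \<times> real. (fst q, - snd q))"
          by (intro continuous_intros)
        have "(\<lambda>q::real \<times> real. (fst q, - snd q)) ` ({0..T} \<times> UNIV) \<subseteq> {0..T} \<times> UNIV" by auto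
        from continuous_on_compose2[OF Q(2) c this] show ?thesis by (simp add: case_prod_beta)
      qed
      \<comment> \<open>The quotient is identically 0, also where the denominator vanishes, so the
        limit exists and is 0.\<close>
      have zero: "sim_O (\<lambda>_. 0) k F" for k F by (auto simp: sim_O_def)
      have bnd: "\<exists>B. \<forall>t\<in>{0..T}. \<Phi> t \<le> B" if "continuous_on {0..T} \<Phi>" for \<Phi> :: "real \<Rightarrow> real"
        using continuous_attains_sup[OF compact_Icc _ that] assms(8) by fastforce
      obtain B1 B2 where B: "\<And>t. t \<in> {0..T} \<Longrightarrow> \<Phi>p t \<le> B1" "\<And>t. t \<in> {0..T} \<Longrightarrow> \<Phi>m t \<le> B2"
        using bnd[OF P(1)] bnd[OF Q(1)] by blast
      have bounds: "\<exists>c1\<ge>0. \<exists>c2\<ge>0. \<forall>t\<in>{0..T}. c1 \<le> \<Phi>p t \<and> \<Phi>p t \<le> c2 \<and> c1 \<le> \<Phi>m t \<and> \<Phi>m t \<le> c2"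
        using B P(4) Q(4)
        by (intro exI[of _ 0] exI[of _ "max 0 (max B1 B2)"] conjI ballI) (auto simp: le_max_iff_disj less_imp_le)
      have eq_m: "u t x = u0 x - t * exp (- \<bar>x\<bar>) * (\<Phi>m t + \<epsilon> t (- x) + 0)" if "t \<in> {0..T}" for t x
        using Q(3)[OF that, of "- x"] by (simp add: u0)
      have lim_m: "((\<lambda>x. \<epsilon> t (- x)) \<longlongrightarrow> 0) at_bot" if "t \<in> {0..T}" for t
        using filterlim_compose[OF Q(5)[OF that] filterlim_uminus_at_top_at_bot] .
      have est: "\<forall>t\<in>{0..T}. \<forall>x. weighted d (u t) x \<le> R a b + 1"
      proof (intro ballI allI)
        fix t x assume t: "t \<in> {0..T}"
        show "weighted d (u t) x \<le> R a b + 1"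
          using weighted_le_decay_weight[OF d0, of "u t" x] dec[OF t, of x] by linarith
      qed
      show ?case
        unfolding a_def[symmetric] b_def[symmetric]
      proof (rule conjI[OF est], rule exI[of _ \<Phi>p], rule exI[of _ \<Phi>m], rule exI[of _ \<epsilon>p],
          rule exI[of _ "\<lambda>t x. \<epsilon> t (- x)"], rule exI[of _ "\<lambda>_. 0"],
          intro conjI P(1) Q(1) P(2) ec continuous_on_const bounds zero)
        show "\<forall>t\<in>{0..T}. \<forall>x>0. u t x = u0 x + t * exp (- \<bar>x\<bar>) * (\<Phi>p t + \<epsilon>p t x + 0)"
          using P(3) by (simp add: u0)
        show "\<forall>t\<in>{0..T}. \<forall>x<0. u t x = u0 x - t * exp (- \<bar>x\<bar>) * (\<Phi>m t + \<epsilon> t (- x) + 0)"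
          using eq_m by blast
        show "\<forall>t\<in>{0..T}. \<Phi>p t \<ge> 0 \<and> \<Phi>m t \<ge> 0" using P(4) Q(4) by (auto simp: less_imp_le)
        show "\<forall>t0\<in>{0..T}. \<Phi>p t0 = 0 \<longleftrightarrow> (\<forall>x. u t0 x = 0)" using P(4) alive by (metis less_irrefl)
        show "\<forall>t0\<in>{0..T}. \<Phi>m t0 = 0 \<longleftrightarrow> (\<forall>x. u t0 x = 0)" using Q(4) alive by (metis less_irrefl)
        show "\<forall>t\<in>{0..T}. (\<epsilon>p t \<longlongrightarrow> 0) at_top" using P(5) by blast
        show "\<forall>t\<in>{0..T}. ((\<lambda>x. \<epsilon> t (- x)) \<longlongrightarrow> 0) at_bot" using lim_m by blast
      qed
    qed
  qed
qed

end
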